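(* There are constants $c_0,r_0>0$ such that the following holds. Let $\mathcal P$ be a finite family of planar planks and let \[ H := D\setminus\bigcup_{P\in\mathcal P}P . \] If $H\subset rD$ for some $0<r<r_0$, then \[ \sum_{P\in\mathcal P}|P\cap D|\ \ge\ |D|+\frac{c_0}{r}|H| . \]
   Context: $D=\{x\in\mathbb R^2:\|x\|\le 1\}$ is the closed unit disk, $rD=\{rx:x\in D\}$, and $|\cdot|$ denotes area (planar Lebesgue measure). A plank in $\mathbb R^2$ is the closed region between two parallel lines. *)

theory Defs
  imports "HOL-Analysis.Analysis"
begin

definition unit_disk :: "(real ^ 2) set" where
  "unit_disk = cball 0 1"

text \<open>The two bounding lines are \<open>{x. u \<bullet> x = a}\<close> and \<open>{x. u \<bullet> x = b}\<close>; they are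
  required to be distinct, so a single line is not a plank.\<close>

definition is_plank :: "(real ^ 2) set \<Rightarrow> bool" where
  "is_plank P \<longleftrightarrow> (\<exists>u a b. norm u = 1 \<and> a < b \<and> P = {x. a \<le> u \<bullet> x \<and> u \<bullet> x \<le> b})"

definition area :: "(real ^ 2) set \<Rightarrow> real" where
  "area S = measure lebesgue S"

end

theory Submission
  imports Defs
begin

text \<open>
  The \<^emph>\<open>overlap\<close> of the family on a set \<open>S\<close> is the area that the planks cover there in
  excess, that is, the integral over \<open>S\<close> of \<open>max 0 (N - 1)\<close>, where \<open>N\<close> counts the planks
  containing a point.  It is nonnegative and additive over disjoint sets, and on the unit disk \<open>B\<close> it
  equals \<open>(\<Sum>i. |P i \<inter> B|) - |B| + |H|\<close>.  Hence the theorem says that an uncovered set of area \<open>|H|\<close>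
  inside the disk \<open>rB\<close> forces an overlap of order \<open>|H| / r\<close> (\<open>uncovered_area_le\<close>).

  Overlap near one uncovered point \<open>x\<close>.  A plank that meets a line through \<open>x\<close> but misses \<open>x\<close>
  crosses this line at a positive angle.  For a direction \<open>e\<close> and a threshold \<open>\<phi>\<close>, let
  \<open>mass x e \<phi>\<close> be the total length cut out of the line through \<open>x\<close> in direction \<open>e\<close> by the planks
  whose angle with the line has sine at least \<open>\<phi>\<close>.  For tiny \<open>\<phi>\<close> this counts all planks that cover
  the line, so it is large for every \<open>e\<close>; for \<open>\<phi> > 1\<close> it is zero.  Between the two there is a scale
  \<open>\<phi>\<close> at which the mass is small for some direction \<open>e\<close>, while at \<open>\<phi>/2\<close> it is large for all
  directions (\<open>scale_exists\<close>).  Along \<open>e\<close> the steep planks are then rare, so a rectangle of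
  height \<open>\<phi>\<close> close to \<open>x\<close> is mostly covered by flat planks, and by pigeonhole a fixed proportion of
  these are almost parallel to one direction \<open>e'\<close> (\<open>bundle_exists\<close>).  Across \<open>e'\<close> the planks that are
  steep at scale \<open>\<phi>/2\<close> have large mass, and each of them crosses each plank of the bundle
  (\<open>crossing_energy\<close>).  So two transversal subfamilies have pairwise intersections of total area at
  least a constant times \<open>\<phi>\<close>.

  From pairwise intersections to overlap.  Where \<open>N\<close> is bounded, \<open>N \<ge> 2\<close> gives an overlap density
  of at least \<open>1\<close> and a bounded number of pairs.  Where \<open>N\<close> is large, a stopping time in the manner
  of Calderon and Zygmund selects squares on which the mean of \<open>N\<close> is about \<open>2\<close>; the overlap of such
  a square is at least its area, and transversality bounds the pairwise intersections in it by the
  product of the masses of the two families, again of the order of its area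
  (\<open>transversal_overlap\<close>).  That \<open>N\<close> is an integer is essential here: a fractional cover may
  have \<open>N = 1\<close> throughout although transversal families meet everywhere.  The outcome is a box of
  length of order \<open>1\<close> and width of order \<open>\<phi>\<close> around \<open>x\<close> with overlap at least \<open>\<phi> / 10^17\<close>
  (\<open>heavy_box\<close>).

  Comparing boxes.  Choose for each \<open>x\<close> the widest such box up to a factor \<open>2\<close>; call its width \<open>D\<close>
  and its direction \<open>e\<close>.  If two of these boxes meet at an angle much larger than their widths, their
  axes bound a wedge, and every plank is steep with respect to at least one of the two axes.  Few
  planks can be steep and cross an axis.  So the planks that cover the wide end of the wedge must
  run into the narrower part without leaving the wedge through its sides, and there they have less
  room: the overlap is at least a constant times the angle (\<open>wedge_squeeze\<close>,
  \<open>meeting_lines_overlap\<close>).  This would be a much wider box with large overlap, contradicting the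
  choice of \<open>D\<close>.  Hence boxes that meet are almost parallel (\<open>adapted_boxes_parallel\<close>).

  Summation.  A box of width \<open>D\<close> meets \<open>rB\<close> only in a tile of area at most \<open>4 D r\<close>, although its
  overlap is of order \<open>D\<close>: this is where the factor \<open>1/r\<close> comes from.  Because boxes that meet
  are almost parallel, a greedy choice of disjoint boxes, widest first, has the property that the
  enlarged tiles of the chosen boxes cover all of \<open>H\<close>, up to passing to a compact subset
  (\<open>compact_uncovered_bound\<close>).  Adding the overlaps of the disjoint boxes gives the bound.
\<close>

section \<open>Plane geometry and areas of parallelograms\<close>

definition det2 :: "real^2 \<Rightarrow> real^2 \<Rightarrow> real" where
  "det2 v w = v$1 * w$2 - v$2 * w$1"

definition perp :: "real^2 \<Rightarrow> real^2" where
  "perp e = vector [- e$2, e$1]"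

definition strip :: "real^2 \<Rightarrow> real \<Rightarrow> real \<Rightarrow> (real^2) set" where
  "strip v lo hi = {y. lo \<le> v \<bullet> y \<and> v \<bullet> y \<le> hi}"

text \<open>
  Points in oblique coordinates with origin \<open>z\<close> and axes \<open>d\<close>, \<open>d'\<close>.  Rescaling a thin rectangle to
  a square and a narrow wedge to a quadrant are both changes to such coordinates.
\<close>
definition aff :: "real^2 \<Rightarrow> real^2 \<Rightarrow> real^2 \<Rightarrow> real^2 \<Rightarrow> real^2" where
  "aff z d d' q = z + q$1 *\<^sub>R d + q$2 *\<^sub>R d'"

lemma inner2: "v \<bullet> y = v$1 * y$1 + v$2 * y$2" for v y :: "real^2"
  by (simp add: inner_vec_def sum_2)

lemma perp_components [simp]: "perp e $ 1 = - e$2" "perp e $ 2 = e$1"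
  by (simp_all add: perp_def)

lemma perp_inner: "perp e \<bullet> y = det2 e y"
  by (simp add: inner2 det2_def)

lemma inner_perp_self [simp]: "e \<bullet> perp e = 0"
  by (simp add: inner2)

lemma norm2_sq: "(norm v)\<^sup>2 = (v$1)\<^sup>2 + (v$2)\<^sup>2" for v :: "real^2"
  using power2_norm_eq_inner[of v] by (simp add: inner2 power2_eq_square)

lemma norm_perp [simp]: "norm (perp e) = norm e"
proof -
  have "(norm (perp e))\<^sup>2 = (norm e)\<^sup>2" by (simp add: norm2_sq)
  then show ?thesis by simp
qed

lemma det2_simps [simp]: "det2 v v = 0" "det2 v 0 = 0" "det2 0 v = 0"
  "det2 (- v) w = - det2 v w" "det2 v (- w) = - det2 v w"
  by (simp_all add: det2_def)

lemma det2_linear: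
  "det2 v (x + y) = det2 v x + det2 v y" "det2 v (x - y) = det2 v x - det2 v y"
  "det2 v (a *\<^sub>R x) = a * det2 v x"
  "det2 (x + y) v = det2 x v + det2 y v" "det2 (x - y) v = det2 x v - det2 y v"
  "det2 (a *\<^sub>R x) v = a * det2 x v"
  by (simp_all add: det2_def algebra_simps)

lemma det2_swap: "det2 v w = - det2 w v"
  by (simp add: det2_def)

lemma det2_sq_add_inner_sq: "(det2 v w)\<^sup>2 + (v \<bullet> w)\<^sup>2 = (norm v)\<^sup>2 * (norm w)\<^sup>2"
  unfolding norm2_sq det2_def inner2 by (simp add: power2_eq_square algebra_simps)

lemma abs_det2_le: "\<bar>det2 v w\<bar> \<le> norm v * norm w"
proof -
  have "\<bar>det2 v w\<bar> = \<bar>perp v \<bullet> w\<bar>" by (simp add: perp_inner)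
  also have "\<dots> \<le> norm (perp v) * norm w" by (rule Cauchy_Schwarz_ineq2)
  finally show ?thesis by simp
qed

lemma det2_frame:
  assumes "norm e = 1"
  shows "det2 v w = (v \<bullet> e) * det2 e w - det2 e v * (w \<bullet> e)"
proof -
  have "det2 v w = ((e$1)\<^sup>2 + (e$2)\<^sup>2) * det2 v w"
    using assms norm2_sq[of e] by simp
  then show ?thesis
    by (simp add: det2_def inner2 power2_eq_square algebra_simps)
qed

lemma frame_expand:
  assumes "norm e = 1"
  shows "y = (e \<bullet> y) *\<^sub>R e + det2 e y *\<^sub>R perp e"
proof -
  have *: "(e$1)\<^sup>2 + (e$2)\<^sup>2 = 1" using assms norm2_sq[of e] by simp
  have "y$1 = ((e$1)\<^sup>2 + (e$2)\<^sup>2) * y$1" "y$2 = ((e$1)\<^sup>2 + (e$2)\<^sup>2) * y$2" by (simp_all add: *)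
  then have "y$1 = (e \<bullet> y) * e$1 + det2 e y * (- e$2)" "y$2 = (e \<bullet> y) * e$2 + det2 e y * (e$1)"
    unfolding inner2 det2_def by (simp_all add: power2_eq_square algebra_simps) 
  then show ?thesis by (simp add: vec_eq_iff forall_2)
qed

lemma inner_frame:
  assumes "norm e = 1" shows "v \<bullet> y = (v \<bullet> e) * (e \<bullet> y) + (v \<bullet> perp e) * det2 e y"
proof -
  have "v \<bullet> y = v \<bullet> ((e \<bullet> y) *\<^sub>R e + det2 e y *\<^sub>R perp e)" using frame_expand[OF assms, of y] by simp
  then show ?thesis by (simp add: inner_add_right mult.commute)
qed

lemma norm_frame:
  assumes "norm e = 1"
  shows "(norm (s *\<^sub>R e + t *\<^sub>R perp e))\<^sup>2 = s\<^sup>2 + t\<^sup>2"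
proof -
  have *: "(e$1)\<^sup>2 + (e$2)\<^sup>2 = 1" using assms norm2_sq[of e] by simp
  have "(norm (s *\<^sub>R e + t *\<^sub>R perp e))\<^sup>2 = (s\<^sup>2 + t\<^sup>2) * ((e$1)\<^sup>2 + (e$2)\<^sup>2)"
    unfolding norm2_sq by (simp add: power2_eq_square algebra_simps)
  then show ?thesis using * by simp
qed

lemma det2_perp_self: "norm e = 1 \<Longrightarrow> det2 e (perp e) = 1"
  using norm2_sq[of e] by (simp add: det2_def power2_eq_square)

lemma det2_perp: "det2 v (perp e) = v \<bullet> e"
  by (simp add: det2_def inner2)

text \<open>
  For a plank with unit normal \<open>u\<close>, the number \<open>\<bar>u \<bullet> d\<bar>\<close> is the sine of its angle with the direction
  \<open>d\<close>.  No plank can be almost parallel to two directions at once unless these are close to each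
  other.
\<close>
lemma abs_det2_triangle:
  assumes "norm u = 1" "norm d = 1" "norm d' = 1"
  shows "\<bar>det2 d d'\<bar> \<le> \<bar>u \<bullet> d\<bar> + \<bar>u \<bullet> d'\<bar>"
proof -
  have "det2 d d' = (d \<bullet> u) * det2 u d' - det2 u d * (d' \<bullet> u)"
    by (rule det2_frame[OF assms(1)])
  then have "\<bar>det2 d d'\<bar> \<le> \<bar>d \<bullet> u\<bar> * \<bar>det2 u d'\<bar> + \<bar>det2 u d\<bar> * \<bar>d' \<bullet> u\<bar>"
    by (metis abs_mult abs_triangle_ineq4)
  moreover have "\<bar>det2 u d'\<bar> \<le> 1" "\<bar>det2 u d\<bar> \<le> 1"
    using abs_det2_le[of u d] abs_det2_le[of u d'] assms by auto
  then have "\<bar>d \<bullet> u\<bar> * \<bar>det2 u d'\<bar> \<le> \<bar>d \<bullet> u\<bar>" "\<bar>det2 u d\<bar> * \<bar>d' \<bullet> u\<bar> \<le> \<bar>d' \<bullet> u\<bar>"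
    by (simp_all add: mult_left_le mult_left_le_one_le)
  ultimately show ?thesis by (simp add: inner_commute)
qed

text \<open>
  All areas below are compared with areas of such parallelograms, which the linear map
  \<open>y \<mapsto> (v \<bullet> y, w \<bullet> y)\<close> of determinant \<open>det2 v w\<close> turns into rectangles.
\<close>
lemma parallelogram_area:
  fixes v w :: "real^2"
  assumes "det2 v w \<noteq> 0" "a \<le> b" "c \<le> d"
  shows "area {y. a \<le> v \<bullet> y \<and> v \<bullet> y \<le> b \<and> c \<le> w \<bullet> y \<and> w \<bullet> y \<le> d} = (b - a) * (d - c) / \<bar>det2 v w\<bar>" (is "area ?S = _")
    and "compact {y. a \<le> v \<bullet> y \<and> v \<bullet> y \<le> b \<and> c \<le> w \<bullet> y \<and> w \<bullet> y \<le> d}"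
proof -
  define f where "f = (\<lambda>y::real^2. vector [v \<bullet> y, w \<bullet> y] :: real^2)"
  define h where "h = (\<lambda>q::real^2. vector [q$1 * w$2 - q$2 * v$2, q$2 * v$1 - q$1 * w$1] :: real^2)"
  define g where "g = (\<lambda>q. (1 / det2 v w) *\<^sub>R h q)"
  have linf: "linear f" unfolding f_def
    by (rule linearI) (simp_all add: vec_eq_iff forall_2 inner_add_right)
  have linh: "linear h" unfolding h_def
    by (rule linearI) (simp_all add: vec_eq_iff forall_2 algebra_simps)
  have ling: "linear g" unfolding g_def
    by (intro linear_compose_scale_right linh)
  have "v \<bullet> h q = det2 v w * q$1" "w \<bullet> h q = det2 v w * q$2" for q
    unfolding h_def inner2 det2_def by (simp_all add: algebra_simps)
  then have fg: "f (g q) = q" for q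
    using assms(1) by (simp add: vec_eq_iff forall_2 f_def g_def)
  have "h (f y) = det2 v w *\<^sub>R y" for y
    unfolding h_def f_def inner2 det2_def vec_eq_iff forall_2 by (simp add: algebra_simps)
  then have gf: "g (f y) = y" for y
    using assms(1) by (simp add: g_def)
  have S: "?S = g ` cbox (vector [a, c]) (vector [b, d])"
  proof (intro equalityI subsetI)
    fix y assume "y \<in> ?S"
    then have "f y \<in> cbox (vector [a, c]) (vector [b, d])"
      by (simp add: mem_box_cart forall_2 f_def)
    then show "y \<in> g ` cbox (vector [a, c]) (vector [b, d])" using gf by (metis imageI)
  next
    fix y assume "y \<in> g ` cbox (vector [a, c]) (vector [b, d])"
    then have "f y \<in> cbox (vector [a, c]) (vector [b, d])" using fg by auto
    then show "y \<in> ?S" by (simp add: mem_box_cart forall_2 f_def)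
  qed
  show c: "compact ?S" unfolding S
    by (intro compact_continuous_image linear_continuous_on compact_cbox) (simp add: ling linear_conv_bounded_linear[symmetric])
  have m: "matrix f $ 1 $ 1 = v$1" "matrix f $ 1 $ 2 = v$2" "matrix f $ 2 $ 1 = w$1" "matrix f $ 2 $ 2 = w$2"
    by (simp_all add: matrix_def f_def inner_axis)
  have fS: "f ` ?S = cbox (vector [a, c]) (vector [b, d])"
    unfolding S image_image fg by simp
  have "measure lebesgue (f ` ?S) = \<bar>det (matrix f)\<bar> * measure lebesgue ?S"
    by (rule measure_linear_image[OF linf lmeasurable_compact[OF c]])
  also have "det (matrix f) = det2 v w" by (simp add: det_2 m det2_def)
  finally have "\<bar>det2 v w\<bar> * area ?S = measure lebesgue (cbox (vector [a, c]) (vector [b, d] :: real^2))"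
    unfolding fS area_def by simp
  also have "\<dots> = (b - a) * (d - c)"
  proof -
    have "cbox (vector [a, c]) (vector [b, d] :: real^2) \<noteq> {}"
      using assms by (simp add: interval_ne_empty_cart forall_2)
    then show ?thesis by (simp add: content_cbox_cart UNIV_2)
  qed
  finally show "area ?S = (b - a) * (d - c) / \<bar>det2 v w\<bar>"
    using assms(1) by (simp add: field_simps)
qed

lemma closed_strip: "closed (strip v lo hi)"
proof -
  have "strip v lo hi = {y. lo \<le> v \<bullet> y} \<inter> {y. v \<bullet> y \<le> hi}" by (auto simp: strip_def)
  then show ?thesis by (simp add: closed_Int closed_halfspace_ge closed_halfspace_le)
qed

lemma area_aff_image:
  assumes "S \<in> lmeasurable"
  shows "area (aff z d d' ` S) = \<bar>det2 d d'\<bar> * area S" "aff z d d' ` S \<in> lmeasurable"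
proof -
  define f where "f = (\<lambda>q::real^2. q$1 *\<^sub>R d + q$2 *\<^sub>R d')"
  have lin: "linear f" unfolding f_def
    by (rule linearI) (simp_all add: algebra_simps)
  have im: "aff z d d' ` S = (+) z ` (f ` S)"
    by (auto simp: aff_def f_def image_image add.assoc)
  have m: "matrix f $ 1 $ 1 = d$1" "matrix f $ 1 $ 2 = d'$1" "matrix f $ 2 $ 1 = d$2" "matrix f $ 2 $ 2 = d'$2"
    by (simp_all add: matrix_def f_def axis_def)
  have "det (matrix f) = det2 d d'" by (simp add: det_2 m det2_def)
  then show "area (aff z d d' ` S) = \<bar>det2 d d'\<bar> * area S"
    unfolding im area_def by (simp add: measure_translation measure_linear_image[OF lin assms])
  show "aff z d d' ` S \<in> lmeasurable"
    unfolding im by (intro measurable_translation measurable_linear_image[OF lin assms])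
qed

lemma aff_vimage_strip:
  "aff z d d' -` strip u lo hi = strip (vector [u \<bullet> d, u \<bullet> d']) (lo - u \<bullet> z) (hi - u \<bullet> z)"
  by (auto simp: strip_def aff_def inner2[of "vector _"] inner_add_right algebra_simps)

section \<open>Overlap of a finite family of closed sets\<close>

definition overlap :: "nat set \<Rightarrow> (nat \<Rightarrow> (real^2) set) \<Rightarrow> (real^2) set \<Rightarrow> real" where
  "overlap I P S = (\<Sum>i\<in>I. area (P i \<inter> S)) - area (S \<inter> (\<Union>i\<in>I. P i))"

definition multiplicity_at :: "'b set \<Rightarrow> ('b \<Rightarrow> 'a set) \<Rightarrow> 'a \<Rightarrow> nat" where
  "multiplicity_at I P y = card {i\<in>I. y \<in> P i}"

lemma area_nonneg [simp]: "0 \<le> area S" by (simp add: area_def)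

lemma area_mono: "S \<subseteq> T \<Longrightarrow> S \<in> lmeasurable \<Longrightarrow> T \<in> lmeasurable \<Longrightarrow> area S \<le> area T"
  unfolding area_def by (intro measure_mono_fmeasurable) (auto simp: fmeasurableD)

lemma area_UN_le: "finite J \<Longrightarrow> (\<And>j. j \<in> J \<Longrightarrow> A j \<in> lmeasurable) \<Longrightarrow> area (\<Union>j\<in>J. A j) \<le> (\<Sum>j\<in>J. area (A j))"
  unfolding area_def by (intro measure_UNION_le) (auto simp: fmeasurableD)

lemma sum_indicator_multiplicity:
  "finite I \<Longrightarrow> (\<Sum>i\<in>I. indicator (P i) y :: real) = real (multiplicity_at I P y)"
  by (simp add: multiplicity_at_def indicator_def sum.If_cases Int_def)

text \<open>
  Sums of areas are integrals of the multiplicity; in this way pointwise bounds on the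
  multiplicity turn into bounds on such sums.
\<close>
lemma sum_area_eq_integral:
  assumes "finite I" "\<And>i. i \<in> I \<Longrightarrow> A i \<in> lmeasurable"
  shows "(\<Sum>i\<in>I. area (A i)) = integral\<^sup>L lebesgue (\<lambda>y. real (multiplicity_at I A y))"
    and "integrable lebesgue (\<lambda>y. real (multiplicity_at I A y))"
proof -
  have *: "integrable lebesgue (indicator (A i) :: _ \<Rightarrow> real)" if "i \<in> I" for i
    using assms(2)[OF that] by (auto simp: fmeasurable_def integrable_indicator_iff)
  have e: "(\<lambda>y. real (multiplicity_at I A y)) = (\<lambda>y. \<Sum>i\<in>I. indicator (A i) y)"
    using sum_indicator_multiplicity[OF assms(1)] by metis
  show "integrable lebesgue (\<lambda>y. real (multiplicity_at I A y))"
    unfolding e by (rule Bochner_Integration.integrable_sum) (rule *)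
  show "(\<Sum>i\<in>I. area (A i)) = integral\<^sup>L lebesgue (\<lambda>y. real (multiplicity_at I A y))"
    unfolding e using * by (subst Bochner_Integration.integral_sum) (auto simp: area_def)
qed

lemma sum_area_le_multiplicity:
  assumes "finite I" "\<And>i. i \<in> I \<Longrightarrow> A i \<in> lmeasurable" "W \<in> lmeasurable"
    and "\<And>i. i \<in> I \<Longrightarrow> A i \<subseteq> W" "\<And>y. y \<in> W \<Longrightarrow> real (multiplicity_at I A y) \<le> m"
  shows "(\<Sum>i\<in>I. area (A i)) \<le> m * area W"
proof -
  have "(\<Sum>i\<in>I. area (A i)) = integral\<^sup>L lebesgue (\<lambda>y. real (multiplicity_at I A y))"
    by (rule sum_area_eq_integral(1)[OF assms(1,2)])
  also have "\<dots> \<le> integral\<^sup>L lebesgue (\<lambda>y. m * indicator W y)"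
  proof (rule integral_mono)
    show "integrable lebesgue (\<lambda>y. real (multiplicity_at I A y))" by (rule sum_area_eq_integral(2)[OF assms(1,2)])
    show "integrable lebesgue (\<lambda>y. m * indicator W y)" using assms(3) by (auto simp: fmeasurable_def)
    fix y
    show "real (multiplicity_at I A y) \<le> m * indicator W y"
    proof (cases "y \<in> W")
      case False
      then have *: "{i\<in>I. y \<in> A i} = {}" using assms(4) by auto
      show ?thesis using False unfolding multiplicity_at_def * by simp
    qed (use assms(5) in auto)
  qed
  also have "\<dots> = m * area W" by (simp add: area_def)
  finally show ?thesis .
qed

lemma multiplicity_le_sum_area:
  assumes "finite I" "\<And>i. i \<in> I \<Longrightarrow> A i \<in> lmeasurable" "W \<in> lmeasurable"
    and "\<And>y. y \<in> W \<Longrightarrow> m \<le> real (multiplicity_at I A y)"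
  shows "m * area W \<le> (\<Sum>i\<in>I. area (A i))"
proof -
  have "m * area W = integral\<^sup>L lebesgue (\<lambda>y. m * indicator W y)" by (simp add: area_def)
  also have "\<dots> \<le> integral\<^sup>L lebesgue (\<lambda>y. real (multiplicity_at I A y))"
  proof (rule integral_mono)
    show "integrable lebesgue (\<lambda>y. real (multiplicity_at I A y))" by (rule sum_area_eq_integral(2)[OF assms(1,2)])
    show "integrable lebesgue (\<lambda>y. m * indicator W y)" using assms(3) by (auto simp: fmeasurable_def)
    show "m * indicator W y \<le> real (multiplicity_at I A y)" for y
      using assms(4) by (auto simp: indicator_def)
  qed
  also have "\<dots> = (\<Sum>i\<in>I. area (A i))" by (rule sum_area_eq_integral(1)[OF assms(1,2), symmetric])
  finally show ?thesis .
qed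

lemma Int_closed_lmeasurable: "closed (A::(real^2) set) \<Longrightarrow> S \<in> lmeasurable \<Longrightarrow> A \<inter> S \<in> lmeasurable"
  by (metis Int_commute borel_closed fmeasurable_Int_fmeasurable lborelD sets_completionI_sets sets_lborel)

context
  fixes I :: "nat set" and P :: "nat \<Rightarrow> (real^2) set"
  assumes fin: "finite I" and cl: "\<And>i. i \<in> I \<Longrightarrow> closed (P i)"
begin

lemma UN_lmeasurable: "S \<in> lmeasurable \<Longrightarrow> S \<inter> (\<Union>i\<in>I. P i) \<in> lmeasurable"
  using Int_closed_lmeasurable[of "\<Union>i\<in>I. P i" S] fin cl by (simp add: Int_commute closed_UN)

lemma overlap_ge: "S \<in> lmeasurable \<Longrightarrow> (\<Sum>i\<in>I. area (P i \<inter> S)) - area S \<le> overlap I P S"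
  unfolding overlap_def using UN_lmeasurable by (simp add: area_mono)

lemma overlap_nonneg:
  assumes "S \<in> lmeasurable" shows "0 \<le> overlap I P S"
proof -
  have "S \<inter> (\<Union>i\<in>I. P i) = (\<Union>i\<in>I. P i \<inter> S)" by auto
  then show ?thesis unfolding overlap_def
    using area_UN_le[OF fin, of "\<lambda>i. P i \<inter> S"] Int_closed_lmeasurable[OF cl assms] by simp
qed

lemma overlap_disjoint_Un:
  assumes "S \<in> lmeasurable" "T \<in> lmeasurable" "S \<inter> T = {}"
  shows "overlap I P (S \<union> T) = overlap I P S + overlap I P T"
proof -
  have 1: "area (P i \<inter> (S \<union> T)) = area (P i \<inter> S) + area (P i \<inter> T)" if "i \<in> I" for i
    unfolding area_def Int_Un_distrib
    by (rule measure_Un2[THEN trans]) 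
       (use assms that cl in \<open>auto simp: Int_closed_lmeasurable intro!: arg_cong[where f="measure lebesgue"]\<close>)
  have 2: "area ((S \<union> T) \<inter> (\<Union>i\<in>I. P i)) = area (S \<inter> (\<Union>i\<in>I. P i)) + area (T \<inter> (\<Union>i\<in>I. P i))"
    unfolding area_def Int_Un_distrib2
    by (rule measure_Un2[THEN trans]) 
       (use assms UN_lmeasurable in \<open>auto intro!: arg_cong[where f="measure lebesgue"]\<close>)
  show ?thesis unfolding overlap_def 2 using 1 by (simp add: sum.distrib)
qed

lemma overlap_mono:
  assumes "S \<in> lmeasurable" "T \<in> lmeasurable" "S \<subseteq> T"
  shows "overlap I P S \<le> overlap I P T"
proof -
  have "overlap I P (S \<union> (T - S)) = overlap I P S + overlap I P (T - S)"
    by (rule overlap_disjoint_Un) (use assms in auto)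
  moreover have "S \<union> (T - S) = T" using assms by auto
  ultimately show ?thesis using overlap_nonneg[of "T - S"] assms by auto
qed

lemma sum_overlap_le:
  assumes "finite J" "\<And>j. j \<in> J \<Longrightarrow> A j \<in> lmeasurable" "W \<in> lmeasurable"
    and "\<And>j. j \<in> J \<Longrightarrow> A j \<subseteq> W" "\<And>j k. j \<in> J \<Longrightarrow> k \<in> J \<Longrightarrow> j \<noteq> k \<Longrightarrow> A j \<inter> A k = {}"
  shows "(\<Sum>j\<in>J. overlap I P (A j)) \<le> overlap I P W"
proof -
  have "(\<Sum>j\<in>J. overlap I P (A j)) = overlap I P (\<Union>j\<in>J. A j)"
    using assms(1,2,5)
  proof (induction J rule: finite_induct)
    case empty
    show ?case by (simp add: overlap_def area_def)
  next
    case (insert x F)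
    have "overlap I P (A x \<union> (\<Union>j\<in>F. A j)) = overlap I P (A x) + overlap I P (\<Union>j\<in>F. A j)"
      by (rule overlap_disjoint_Un) (use insert in \<open>auto intro!: fmeasurable.finite_UN\<close>)
    moreover have "(\<Sum>j\<in>F. overlap I P (A j)) = overlap I P (\<Union>j\<in>F. A j)"
      by (rule insert.IH) (use insert.prems in auto)
    ultimately show ?case using insert.hyps by simp
  qed
  also have "\<dots> \<le> overlap I P W"
    by (rule overlap_mono) (use assms in \<open>auto intro!: fmeasurable.finite_UN\<close>)
  finally show ?thesis .
qed

lemma area_multiply_covered_le_overlap:
  assumes "S \<in> lmeasurable" "\<And>y. y \<in> S \<Longrightarrow> 2 \<le> multiplicity_at I P y"
  shows "area S \<le> overlap I P S"
proof -
  have "2 * area S \<le> (\<Sum>i\<in>I. area (P i \<inter> S))"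
  proof (rule multiplicity_le_sum_area[OF fin])
    fix y assume y: "y \<in> S"
    then have "multiplicity_at I (\<lambda>i. P i \<inter> S) y = multiplicity_at I P y" by (simp add: multiplicity_at_def)
    then show "2 \<le> real (multiplicity_at I (\<lambda>i. P i \<inter> S) y)" using assms(2)[OF y] by simp
  qed (use assms cl Int_closed_lmeasurable in auto)
  then show ?thesis using overlap_ge[OF assms(1)] by simp
qed

text \<open>
  High multiplicity is a closed condition because it is a finite union of finite intersections; this
  makes the set on which the stopping time is run compact.
\<close>
lemma closed_multiplicity_ge: "closed {y. m \<le> multiplicity_at I P y}"
proof -
  have "{y. m \<le> multiplicity_at I P y} = (\<Union>J\<in>{J. J \<subseteq> I \<and> card J = m}. \<Inter>i\<in>J. P i)"
  proof (intro equalityI subsetI)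
    fix y assume "y \<in> {y. m \<le> multiplicity_at I P y}"
    then have "m \<le> card {i\<in>I. y \<in> P i}" by (simp add: multiplicity_at_def)
    then obtain J where "J \<subseteq> {i\<in>I. y \<in> P i}" "card J = m" by (meson obtain_subset_with_card_n)
    then show "y \<in> (\<Union>J\<in>{J. J \<subseteq> I \<and> card J = m}. \<Inter>i\<in>J. P i)" by auto
  next
    fix y assume "y \<in> (\<Union>J\<in>{J. J \<subseteq> I \<and> card J = m}. \<Inter>i\<in>J. P i)"
    then obtain J where "J \<subseteq> I" "card J = m" "\<forall>i\<in>J. y \<in> P i" by auto
    then have "J \<subseteq> {i\<in>I. y \<in> P i}" by auto
    from card_mono[OF _ this] show "y \<in> {y. m \<le> multiplicity_at I P y}"
      using fin \<open>card J = m\<close> by (simp add: multiplicity_at_def)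
  qed
  moreover have "finite {J. J \<subseteq> I \<and> card J = m}" using fin by simp
  ultimately show ?thesis using cl by (auto intro!: closed_UN closed_INT)
qed

end

text \<open>
  Overlap scales like area under affine maps, and preimages of strips are strips
  (\<open>aff_vimage_strip\<close>); so estimates may be proved in whichever coordinates are convenient.
\<close>
lemma overlap_aff:
  assumes "finite I" "\<And>i. i \<in> I \<Longrightarrow> closed (P i)" "S \<in> lmeasurable" "det2 d d' \<noteq> 0"
  shows "overlap I P (aff z d d' ` S) = \<bar>det2 d d'\<bar> * overlap I (\<lambda>i. aff z d d' -` P i) S"
proof -
  have c: "closed (aff z d d' -` Q)" if "closed Q" for Q
    by (rule continuous_closed_vimage[OF that]) (unfold aff_def, intro continuous_intros)
  have "P i \<inter> aff z d d' ` S = aff z d d' ` (aff z d d' -` P i \<inter> S)" for i by auto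
  then have 1: "area (P i \<inter> aff z d d' ` S) = \<bar>det2 d d'\<bar> * area (aff z d d' -` P i \<inter> S)" if "i \<in> I" for i
    using area_aff_image(1)[OF Int_closed_lmeasurable[OF c[OF assms(2)[OF that]] assms(3)]] by simp
  have "aff z d d' ` S \<inter> (\<Union>i\<in>I. P i) = aff z d d' ` (S \<inter> (\<Union>i\<in>I. aff z d d' -` P i))" by auto
  moreover have "S \<inter> (\<Union>i\<in>I. aff z d d' -` P i) \<in> lmeasurable"
    by (rule UN_lmeasurable) (use assms c in auto)
  ultimately have 2: "area (aff z d d' ` S \<inter> (\<Union>i\<in>I. P i)) = \<bar>det2 d d'\<bar> * area (S \<inter> (\<Union>i\<in>I. aff z d d' -` P i))"
    using area_aff_image(1) by metis
  show ?thesis unfolding overlap_def 2 using 1 by (simp add: sum_distrib_left right_diff_distrib)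
qed

text \<open>
  The selection behind the Vitali covering lemma: repeatedly take an element of largest \<open>f\<close> and
  discard all elements in conflict with it.
\<close>
lemma greedy_selection:
  fixes f :: "'a \<Rightarrow> real"
  assumes "finite X" "\<And>x y. conflict x y \<Longrightarrow> conflict y x"
  shows "\<exists>Y\<subseteq>X. (\<forall>x\<in>Y. \<forall>y\<in>Y. x \<noteq> y \<longrightarrow> \<not> conflict x y) \<and> (\<forall>x\<in>X. \<exists>y\<in>Y. f x \<le> f y \<and> (x = y \<or> conflict x y))"
  using assms(1)
proof (induction X rule: finite_psubset_induct)
  case (psubset X)
  show ?case
  proof (cases "X = {}")
    case False
    then have "Max (f ` X) \<in> f ` X" using psubset.hyps by simp
    then obtain m where "m \<in> X" "f m = Max (f ` X)" by auto
    then have m: "m \<in> X" "\<And>x. x \<in> X \<Longrightarrow> f x \<le> f m" using psubset.hyps by simp_all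
    define X' where "X' = {x\<in>X. x \<noteq> m \<and> \<not> conflict x m}"
    have "X' \<subset> X" using m unfolding X'_def by auto
    from psubset.IH[OF this] obtain Y where Y: "Y \<subseteq> X'" "\<forall>x\<in>Y. \<forall>y\<in>Y. x \<noteq> y \<longrightarrow> \<not> conflict x y"
      "\<forall>x\<in>X'. \<exists>y\<in>Y. f x \<le> f y \<and> (x = y \<or> conflict x y)" by auto
    show ?thesis
    proof (intro exI[of _ "insert m Y"] conjI ballI)
      show "insert m Y \<subseteq> X" using Y m X'_def by auto
      show "x \<noteq> y \<longrightarrow> \<not> conflict x y" if "x \<in> insert m Y" "y \<in> insert m Y" for x y
        using that Y assms(2) unfolding X'_def by blast
      show "\<exists>y\<in>insert m Y. f x \<le> f y \<and> (x = y \<or> conflict x y)" if "x \<in> X" for x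
        using that Y(3) m unfolding X'_def by blast
    qed
  qed auto
qed

section \<open>Pairwise intersections of transversal strips are paid for by overlap\<close>

definition square :: "real^2 \<Rightarrow> real \<Rightarrow> (real^2) set" where
  "square z \<rho> = {y. \<bar>y$1 - z$1\<bar> \<le> \<rho> \<and> \<bar>y$2 - z$2\<bar> \<le> \<rho>}"

lemma square_eq_cbox: "square z \<rho> = cbox (vector [z$1 - \<rho>, z$2 - \<rho>]) (vector [z$1 + \<rho>, z$2 + \<rho>])"
  unfolding square_def by (auto simp: mem_box_cart forall_2)

lemma lmeasurable_square [simp]: "square z \<rho> \<in> lmeasurable"
  by (simp add: square_eq_cbox)

lemma area_square: "0 \<le> \<rho> \<Longrightarrow> area (square z \<rho>) = 4 * \<rho>\<^sup>2"
proof -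
  assume \<rho>: "0 \<le> \<rho>"
  then have "cbox (vector [z$1 - \<rho>, z$2 - \<rho>]) (vector [z$1 + \<rho>, z$2 + \<rho>] :: real^2) \<noteq> {}"
    by (simp add: interval_ne_empty_cart forall_2)
  then show ?thesis
    by (simp add: square_eq_cbox area_def content_cbox_cart UNIV_2 power2_eq_square)
qed

text \<open>
  A strip through the centre of a square fills a definite part of it, whatever its direction: it
  contains a rectangle of length \<open>\<rho>\<close> and width \<open>min (hi - lo) \<rho>\<close> with a side parallel to the strip.
\<close>
lemma strip_square_lower:
  assumes n: "norm n = 1" and y0: "y0 \<in> strip n lo hi" and \<rho>: "0 < \<rho>"
  shows "min (hi - lo) \<rho> * \<rho> \<le> area (strip n lo hi \<inter> square y0 (2 * \<rho>))"
proof -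
  define w where "w = min (hi - lo) \<rho>"
  have y: "lo \<le> n \<bullet> y0" "n \<bullet> y0 \<le> hi" using y0 by (auto simp: strip_def)
  have w: "0 \<le> w" "w \<le> \<rho>" "w \<le> hi - lo" using y \<rho> by (auto simp: w_def)
  define c where "c = max lo (n \<bullet> y0 - w)"
  have c: "lo \<le> c" "c + w \<le> hi" "c \<le> n \<bullet> y0" "n \<bullet> y0 \<le> c + w"
    using y w by (auto simp: c_def)
  define R where "R = {y. c \<le> n \<bullet> y \<and> n \<bullet> y \<le> c + w \<and> perp n \<bullet> y0 - \<rho>/2 \<le> perp n \<bullet> y \<and> perp n \<bullet> y \<le> perp n \<bullet> y0 + \<rho>/2}"
  have d: "det2 n (perp n) = 1" using n norm2_sq[of n] by (simp add: det2_def power2_eq_square)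
  have ar: "area R = w * \<rho>" "compact R"
    using parallelogram_area[of n "perp n" c "c + w" "perp n \<bullet> y0 - \<rho>/2" "perp n \<bullet> y0 + \<rho>/2"] d w \<rho>
    unfolding R_def by auto
  have "R \<subseteq> strip n lo hi \<inter> square y0 (2 * \<rho>)"
  proof
    fix y assume yR: "y \<in> R"
    have 1: "\<bar>n \<bullet> (y - y0)\<bar> \<le> \<rho>" using yR c w by (auto simp: R_def inner_diff_right)
    have 2: "\<bar>det2 n (y - y0)\<bar> \<le> \<rho>" using yR \<rho> by (auto simp: R_def perp_inner[symmetric] inner_diff_right)
    have "norm (y - y0) \<le> norm ((n \<bullet> (y - y0)) *\<^sub>R n) + norm (det2 n (y - y0) *\<^sub>R perp n)"
      by (subst frame_expand[OF n]) (rule norm_triangle_ineq)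
    also have "\<dots> \<le> 2 * \<rho>" using 1 2 n by simp
    finally have "norm (y - y0) \<le> 2 * \<rho>" .
    then have "\<bar>(y - y0)$1\<bar> \<le> 2 * \<rho>" "\<bar>(y - y0)$2\<bar> \<le> 2 * \<rho>"
      using component_le_norm_cart[of "y - y0"] order_trans by blast+
    then show "y \<in> strip n lo hi \<inter> square y0 (2 * \<rho>)"
      using yR c by (auto simp: R_def strip_def square_def)
  qed
  then have "area R \<le> area (strip n lo hi \<inter> square y0 (2 * \<rho>))"
    by (rule area_mono) (use ar in \<open>auto intro: lmeasurable_compact Int_closed_lmeasurable closed_strip\<close>)
  then show ?thesis using ar by (simp add: w_def)
qed

text \<open>
  Two strips that cross at an angle bounded below meet in a parallelogram whose area is comparable
  to the product of their widths, each width being cut off at the size of the square.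
\<close>
lemma strips_square_upper:
  assumes n: "norm n = 1" "norm n' = 1" and \<gamma>: "\<gamma> \<le> \<bar>det2 n n'\<bar>" "0 < \<gamma>" and \<rho>: "0 < \<rho>"
    and lh: "lo \<le> hi" "lo' \<le> hi'"
  shows "area (strip n lo hi \<inter> strip n' lo' hi' \<inter> square z (3 * \<rho>))
    \<le> 144 / \<gamma> * (min (hi - lo) \<rho> * min (hi' - lo') \<rho>)"
proof -
  define a b c d where "a = max lo (n \<bullet> z - 6 * \<rho>)" and "b = min hi (n \<bullet> z + 6 * \<rho>)"
    and "c = max lo' (n' \<bullet> z - 6 * \<rho>)" and "d = min hi' (n' \<bullet> z + 6 * \<rho>)"
  let ?S = "strip n lo hi \<inter> strip n' lo' hi' \<inter> square z (3 * \<rho>)"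
  let ?T = "{y. a \<le> n \<bullet> y \<and> n \<bullet> y \<le> b \<and> c \<le> n' \<bullet> y \<and> n' \<bullet> y \<le> d}"
  have sub: "?S \<subseteq> ?T"
  proof
    fix y assume y: "y \<in> ?S"
    have "norm (y - z) \<le> \<bar>(y - z)$1\<bar> + \<bar>(y - z)$2\<bar>"
      using norm_le_l1_cart[of "y - z"] by (simp add: sum_2)
    also have "\<dots> \<le> 6 * \<rho>" using y by (auto simp: square_def)
    finally have "norm (y - z) \<le> 6 * \<rho>" .
    then have "\<bar>m \<bullet> (y - z)\<bar> \<le> 6 * \<rho>" if "norm m = 1" for m
      using Cauchy_Schwarz_ineq2[of m "y - z"] that by simp
    from this[OF n(1)] this[OF n(2)] show "y \<in> ?T" using y
      by (auto simp: a_def b_def c_def d_def strip_def inner_diff_right)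
  qed
  have nn: "0 \<le> 144 / \<gamma> * (min (hi - lo) \<rho> * min (hi' - lo') \<rho>)"
    using \<gamma> \<rho> lh by simp
  show ?thesis
  proof (cases "a \<le> b \<and> c \<le> d")
    case False
    then have "?S = {}" using sub by force
    then show ?thesis using nn by (simp add: area_def)
  next
    case True
    have nz: "det2 n n' \<noteq> 0" using \<gamma> by auto
    have "area ?S \<le> area ?T"
      by (rule area_mono[OF sub]) (use True nz parallelogram_area(2) Int_closed_lmeasurable[OF closed_Int[OF closed_strip closed_strip]] in \<open>auto intro: lmeasurable_compact\<close>)
    also have "\<dots> = (b - a) * (d - c) / \<bar>det2 n n'\<bar>"
      using parallelogram_area(1)[OF nz] True by blast
    also have "\<dots> \<le> (b - a) * (d - c) / \<gamma>"
      using True \<gamma> by (intro divide_left_mono) auto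
    also have "\<dots> \<le> (12 * min (hi - lo) \<rho>) * (12 * min (hi' - lo') \<rho>) / \<gamma>"
      using True \<gamma> \<rho> lh by (intro divide_right_mono mult_mono) (auto simp: a_def b_def c_def d_def min_def max_def)
    finally show ?thesis by simp
  qed
qed

text \<open>
  The sum on the left counts pairs and so behaves like \<open>N\<^sup>2\<close> for the multiplicity \<open>N\<close>, whereas overlap
  only sees \<open>N - 1\<close>.  Where \<open>2 \<le> N < 32\<close>, the two are comparable.  A point with \<open>N \<ge> 32\<close> is the centre
  of a small square on which the mean of \<open>N\<close> is at least \<open>2\<close>; take such a square almost as large as
  possible.  Its overlap is at least its area, because it has area at most half of the mass it
  carries.  By maximality a square five times larger has mean less than \<open>2\<close>, and transversality
  (\<open>strips_square_upper\<close>) bounds the pairs by the product of the masses of the two families in it,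
  hence by a multiple of its area.  The hypothesis of small overlap keeps the squares well inside
  \<open>W\<close>.
\<close>
lemma transversal_overlap:
  fixes n :: "nat \<Rightarrow> real^2" and lo hi :: "nat \<Rightarrow> real"
  defines "P \<equiv> \<lambda>i. strip (n i) (lo i) (hi i)"
  assumes fin: "finite I" and LV: "L \<subseteq> I" "V \<subseteq> I"
    and n: "\<And>i. i \<in> I \<Longrightarrow> norm (n i) = 1" and w: "\<And>i. i \<in> I \<Longrightarrow> lo i < hi i"
    and \<gamma>: "0 < \<gamma>" "\<And>i j. i \<in> L \<Longrightarrow> j \<in> V \<Longrightarrow> \<gamma> \<le> \<bar>det2 (n i) (n j)\<bar>"
    and K: "compact K" and \<epsilon>: "0 < \<epsilon>" and W: "W \<in> lmeasurable" "\<And>z. z \<in> K \<Longrightarrow> square z \<epsilon> \<subseteq> W"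
    and small: "overlap I P W < \<epsilon>\<^sup>2 / 100"
  shows "(\<Sum>i\<in>L. \<Sum>j\<in>V. area (P i \<inter> P j \<inter> K)) \<le> (1024 + 1440000 / \<gamma>) * overlap I P W"
proof -
  have clP: "closed (P i)" for i by (simp add: P_def closed_strip)
  have clI: "\<And>i. i \<in> I \<Longrightarrow> closed (P i)" using clP by simp
  have finLV: "finite L" "finite V" using LV fin finite_subset by auto
  have Km: "K \<in> lmeasurable" by (rule lmeasurable_compact[OF K])
  have KW: "K \<subseteq> W" using W(2) \<epsilon> by (fastforce simp: square_def)
  have Pm: "P i \<inter> S \<in> lmeasurable" if "S \<in> lmeasurable" for i S
    using Int_closed_lmeasurable[OF clP that] .
  note ov = overlap_ge[where I=I and P=P, OF fin clI] overlap_nonneg[where I=I and P=P, OF fin clI] overlap_mono[where I=I and P=P, OF fin clI]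
  define big where "big z \<rho> \<longleftrightarrow> 8 * \<rho>\<^sup>2 \<le> (\<Sum>i\<in>I. area (P i \<inter> square z \<rho>))" for z \<rho>
  have bigov: "4 * \<rho>\<^sup>2 \<le> overlap I P (square z \<rho>)" if "big z \<rho>" "0 < \<rho>" for z \<rho>
    using ov(1)[of "square z \<rho>"] that by (simp add: big_def area_square)
  \<comment> \<open>The overlap of a larger big square would reach the bound \<open>small\<close>.\<close>
  have bigsmall: "\<rho> < \<epsilon> / 20" if "big z \<rho>" "0 < \<rho>" "\<rho> \<le> \<epsilon>" "z \<in> K" for z \<rho>
  proof (rule ccontr)
    assume "\<not> \<rho> < \<epsilon> / 20"
    then have "(\<epsilon> / 20)\<^sup>2 \<le> \<rho>\<^sup>2" using \<epsilon> by (intro power_mono) auto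
    then have "\<epsilon>\<^sup>2 / 100 \<le> 4 * \<rho>\<^sup>2" by (simp add: power_divide)
    also have "\<dots> \<le> overlap I P (square z \<rho>)" using bigov that by simp
    also have "\<dots> \<le> overlap I P W"
    proof (rule ov(3))
      have "square z \<rho> \<subseteq> square z \<epsilon>" using that by (auto simp: square_def)
      then show "square z \<rho> \<subseteq> W" using W(2)[OF that(4)] by simp
    qed (use W in auto)
    finally show False using small by simp
  qed
  \<comment> \<open>The points at which a stopping square is needed; elsewhere the multiplicity is bounded.\<close>
  define Z where "Z = {z. 32 \<le> multiplicity_at I P z} \<inter> K"
  have Zc: "compact Z" unfolding Z_def
    by (intro closed_Int_compact closed_multiplicity_ge fin clI K)
  \<comment> \<open>Small squares are big: once \<open>\<rho>\<close> is below all widths, each of the \<open>32\<close> strips through \<open>z\<close> has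
    area at least \<open>\<rho>\<^sup>2\<close> in the square of half-side \<open>2 * \<rho>\<close>, and \<open>32 * \<rho>\<^sup>2 = 8 * (2 * \<rho>)\<^sup>2\<close>.\<close>
  have "\<exists>\<rho>. 0 < \<rho> \<and> \<rho> < \<epsilon>/20 \<and> big z \<rho> \<and> (\<forall>\<rho>'. 2 * \<rho> \<le> \<rho>' \<and> \<rho>' \<le> \<epsilon> \<longrightarrow> \<not> big z \<rho>')" if z: "z \<in> Z" for z
  proof -
    define S where "S = {\<rho>. 0 < \<rho> \<and> \<rho> \<le> \<epsilon> \<and> big z \<rho>}"
    have zK: "z \<in> K" using z by (simp add: Z_def)
    have ub: "\<rho> \<le> \<epsilon>/20" if "\<rho> \<in> S" for \<rho> using bigsmall[OF _ _ _ zK] that by (fastforce simp: S_def)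
    have "\<exists>\<rho>. \<rho> \<in> S"
    proof -
      have "I \<noteq> {}" using z by (auto simp: Z_def multiplicity_at_def)
      define \<rho> where "\<rho> = min (\<epsilon>/2) (Min ((\<lambda>i. hi i - lo i) ` I))"
      have \<rho>: "0 < \<rho>" "\<rho> \<le> \<epsilon>/2" "\<And>i. i \<in> I \<Longrightarrow> \<rho> \<le> hi i - lo i"
        using fin \<open>I \<noteq> {}\<close> w \<epsilon> by (auto simp: \<rho>_def min_le_iff_disj)
      let ?J = "{i\<in>I. z \<in> P i}"
      have "8 * (2 * \<rho>)\<^sup>2 = (\<Sum>i::nat\<in>{..<32}. \<rho>\<^sup>2)" by (simp add: power_mult_distrib)
      also have "\<dots> \<le> (\<Sum>i\<in>?J. \<rho>\<^sup>2)"
        using z by (simp add: Z_def multiplicity_at_def mult_right_mono)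
      also have "\<dots> \<le> (\<Sum>i\<in>?J. area (P i \<inter> square z (2 * \<rho>)))"
      proof (rule sum_mono)
        fix i assume i: "i \<in> ?J"
        then have "min (hi i - lo i) \<rho> = \<rho>" using \<rho>(3)[of i] by simp
        then show "\<rho>\<^sup>2 \<le> area (P i \<inter> square z (2 * \<rho>))"
          using strip_square_lower[of "n i" z "lo i" "hi i" \<rho>] i \<rho> n by (simp add: P_def power2_eq_square)
      qed
      also have "\<dots> \<le> (\<Sum>i\<in>I. area (P i \<inter> square z (2 * \<rho>)))"
        by (rule sum_mono2) (use fin in auto)
      finally have "2 * \<rho> \<in> S" using \<rho> by (simp add: S_def big_def)
      then show ?thesis by blast
    qed
    then obtain \<rho>0 where \<rho>0: "\<rho>0 \<in> S" by blast
    have bdd: "bdd_above S" using ub by (rule bdd_aboveI)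
    have "0 < Sup S" using \<rho>0 cSup_upper[OF \<rho>0 bdd] by (simp add: S_def)
    then obtain \<rho> where \<rho>: "\<rho> \<in> S" "Sup S / 2 < \<rho>"
      using less_cSup_iff[of S "Sup S / 2"] \<rho>0 bdd by auto
    have "\<not> big z \<rho>'" if "2 * \<rho> \<le> \<rho>'" "\<rho>' \<le> \<epsilon>" for \<rho>'
    proof
      assume "big z \<rho>'"
      then have "\<rho>' \<in> S" using that \<rho> by (simp add: S_def)
      then show False using cSup_upper[OF _ bdd, of \<rho>'] that \<rho> by simp
    qed
    moreover have "\<rho> < \<epsilon>/20" using bigsmall[OF _ _ _ zK] \<rho> by (simp add: S_def)
    ultimately show ?thesis using \<rho> by (auto simp: S_def)
  qed
  then obtain \<rho> where \<rho>: "\<And>z. z \<in> Z \<Longrightarrow> 0 < \<rho> z \<and> \<rho> z < \<epsilon>/20 \<and> big z (\<rho> z)"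
    "\<And>z \<rho>'. z \<in> Z \<Longrightarrow> 2 * \<rho> z \<le> \<rho>' \<Longrightarrow> \<rho>' \<le> \<epsilon> \<Longrightarrow> \<not> big z \<rho>'"
    using bchoice[of Z "\<lambda>z \<rho>. 0 < \<rho> \<and> \<rho> < \<epsilon>/20 \<and> big z \<rho> \<and> (\<forall>\<rho>'. 2 * \<rho> \<le> \<rho>' \<and> \<rho>' \<le> \<epsilon> \<longrightarrow> \<not> big z \<rho>')"] by blast
  have "Z \<subseteq> (\<Union>z\<in>Z. ball z (\<rho> z))" using \<rho>(1) by auto
  then obtain C where C: "C \<subseteq> Z" "finite C" "Z \<subseteq> (\<Union>z\<in>C. ball z (\<rho> z))"
    using compactE_image[OF Zc, of Z "\<lambda>z. ball z (\<rho> z)"] by auto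
  define conflict where "conflict x y \<longleftrightarrow> square x (\<rho> x) \<inter> square y (\<rho> y) \<noteq> {}" for x y
  have "\<exists>Y\<subseteq>C. (\<forall>x\<in>Y. \<forall>y\<in>Y. x \<noteq> y \<longrightarrow> \<not> conflict x y) \<and> (\<forall>x\<in>C. \<exists>y\<in>Y. \<rho> x \<le> \<rho> y \<and> (x = y \<or> conflict x y))"
    by (rule greedy_selection) (use C in \<open>auto simp: conflict_def\<close>)
  then obtain Y where Y0: "Y \<subseteq> C" "\<forall>x\<in>Y. \<forall>y\<in>Y. x \<noteq> y \<longrightarrow> \<not> conflict x y"
    "\<forall>x\<in>C. \<exists>y\<in>Y. \<rho> x \<le> \<rho> y \<and> (x = y \<or> conflict x y)" by (elim exE conjE)
  have Y: "Y \<subseteq> C" "\<And>x y. x \<in> Y \<Longrightarrow> y \<in> Y \<Longrightarrow> x \<noteq> y \<Longrightarrow> \<not> conflict x y"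
    "\<And>x. x \<in> C \<Longrightarrow> \<exists>y\<in>Y. \<rho> x \<le> \<rho> y \<and> (x = y \<or> conflict x y)"
    using Y0(1) bspec[OF bspec[OF Y0(2)]] bspec[OF Y0(3)] by auto
  have finY: "finite Y" by (rule finite_subset[OF Y(1) C(2)])
  have YZ: "y \<in> Z" if "y \<in> Y" for y using that Y C by auto
  \<comment> \<open>The factor \<open>3\<close> of the Vitali lemma: a covering square lies in conflict with a chosen one that is
    at least as large.\<close>
  have cover: "Z \<subseteq> (\<Union>y\<in>Y. square y (3 * \<rho> y))"
  proof
    fix z assume "z \<in> Z"
    then obtain x where x: "x \<in> C" "dist x z < \<rho> x" using C(3) by auto
    have "\<bar>(z - x)$1\<bar> \<le> norm (z - x)" "\<bar>(z - x)$2\<bar> \<le> norm (z - x)" by (rule component_le_norm_cart)+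
    then have zx: "\<bar>z$1 - x$1\<bar> \<le> \<rho> x" "\<bar>z$2 - x$2\<bar> \<le> \<rho> x" using x by (simp_all add: dist_norm norm_minus_commute)
    obtain y where y: "y \<in> Y" "\<rho> x \<le> \<rho> y" "x = y \<or> conflict x y" using Y(3)[OF x(1)] by blast
    have "z \<in> square y (3 * \<rho> y)"
    proof (cases "x = y")
      case True
      then show ?thesis using zx \<rho>(1)[OF YZ[OF y(1)]] by (simp add: square_def)
    next
      case False
      then obtain p where "p \<in> square x (\<rho> x)" "p \<in> square y (\<rho> y)" using y by (auto simp: conflict_def)
      then show ?thesis using zx y(2) by (auto simp: square_def abs_le_iff)
    qed
    then show "z \<in> (\<Union>y\<in>Y. square y (3 * \<rho> y))" using y by blast
  qed
  \<comment> \<open>The good part, where the multiplicity is at least \<open>2\<close> but bounded.\<close>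
  define G where "G = {z. 2 \<le> multiplicity_at I P z} \<inter> K - {z. 32 \<le> multiplicity_at I P z}"
  have Gm: "G \<in> lmeasurable" unfolding G_def
    by (intro fmeasurable_Diff Int_closed_lmeasurable[OF closed_multiplicity_ge] fin clI Km)
       (use closed_multiplicity_ge[where I=I and P=P, OF fin clI] in auto)
  have ne: "i \<noteq> j" if "i \<in> L" "j \<in> V" for i j using \<gamma>(1) \<gamma>(2)[OF that] by auto
  have two: "2 \<le> multiplicity_at I P z" if "i \<in> L" "j \<in> V" "z \<in> P i" "z \<in> P j" for i j z
  proof -
    have "card {i, j} \<le> card {i\<in>I. z \<in> P i}"
      by (rule card_mono) (use that LV fin in auto)
    then show ?thesis using ne[OF that(1,2)] by (simp add: multiplicity_at_def)
  qed
  have split: "area (P i \<inter> P j \<inter> K) \<le> area (P i \<inter> P j \<inter> G) + (\<Sum>y\<in>Y. area (P i \<inter> P j \<inter> square y (3 * \<rho> y)))"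
    if "i \<in> L" "j \<in> V" for i j
  proof -
    have m: "P i \<inter> P j \<inter> S \<in> lmeasurable" if "S \<in> lmeasurable" for S using Pm[OF Pm[OF that]] by (simp add: Int_assoc)
    have mK: "P i \<inter> P j \<inter> K \<in> lmeasurable" and mG: "P i \<inter> P j \<inter> G \<in> lmeasurable"
      and mQ: "(\<Union>y\<in>Y. P i \<inter> P j \<inter> square y (3 * \<rho> y)) \<in> lmeasurable"
      by (rule m[OF Km], rule m[OF Gm], rule fmeasurable.finite_UN[OF finY m[OF lmeasurable_square]])
    have "P i \<inter> P j \<inter> K \<subseteq> (P i \<inter> P j \<inter> G) \<union> (\<Union>y\<in>Y. P i \<inter> P j \<inter> square y (3 * \<rho> y))"
    proof
      fix z assume z: "z \<in> P i \<inter> P j \<inter> K"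
      show "z \<in> (P i \<inter> P j \<inter> G) \<union> (\<Union>y\<in>Y. P i \<inter> P j \<inter> square y (3 * \<rho> y))"
      proof (cases "z \<in> Z")
        case True
        then obtain y where "y \<in> Y" "z \<in> square y (3 * \<rho> y)" using cover by blast
        then show ?thesis using z by blast
      next
        case False
        then have "z \<in> G" using z two[OF that, of z] by (simp add: G_def Z_def)
        then show ?thesis using z by blast
      qed
    qed
    then have "area (P i \<inter> P j \<inter> K) \<le> area ((P i \<inter> P j \<inter> G) \<union> (\<Union>y\<in>Y. P i \<inter> P j \<inter> square y (3 * \<rho> y)))"
      by (rule area_mono[OF _ mK fmeasurable.Un[OF mG mQ]])
    also have "\<dots> \<le> area (P i \<inter> P j \<inter> G) + area (\<Union>y\<in>Y. P i \<inter> P j \<inter> square y (3 * \<rho> y))"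
      unfolding area_def by (rule measure_Un_le[OF fmeasurableD[OF mG] fmeasurableD[OF mQ]])
    also have "\<dots> \<le> area (P i \<inter> P j \<inter> G) + (\<Sum>y\<in>Y. area (P i \<inter> P j \<inter> square y (3 * \<rho> y)))"
      by (intro add_left_mono area_UN_le[OF finY] m[OF lmeasurable_square])
    finally show ?thesis .
  qed
  have first: "(\<Sum>i\<in>L. \<Sum>j\<in>V. area (P i \<inter> P j \<inter> G)) \<le> 1024 * overlap I P W"
  proof -
    have "(\<Sum>i\<in>L. \<Sum>j\<in>V. area (P i \<inter> P j \<inter> G)) = (\<Sum>p\<in>L \<times> V. area (P (fst p) \<inter> P (snd p) \<inter> G))"
      by (simp add: sum.cartesian_product case_prod_beta)
    also have "\<dots> \<le> 1024 * area G"
    proof (rule sum_area_le_multiplicity)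
      show "P (fst p) \<inter> P (snd p) \<inter> G \<in> lmeasurable" for p using Pm[OF Pm[OF Gm]] by (simp add: Int_assoc)
      fix y assume y: "y \<in> G"
      have "{p \<in> L \<times> V. y \<in> P (fst p) \<inter> P (snd p) \<inter> G} \<subseteq> {i\<in>I. y \<in> P i} \<times> {i\<in>I. y \<in> P i}"
        using LV by auto
      then have "multiplicity_at (L \<times> V) (\<lambda>p. P (fst p) \<inter> P (snd p) \<inter> G) y \<le> multiplicity_at I P y * multiplicity_at I P y"
        unfolding multiplicity_at_def card_cartesian_product[symmetric] by (rule card_mono[rotated]) (use fin in auto)
      also have "\<dots> \<le> 32 * 32" using y by (intro mult_mono) (auto simp: G_def)
      finally show "real (multiplicity_at (L \<times> V) (\<lambda>p. P (fst p) \<inter> P (snd p) \<inter> G) y) \<le> 1024" by simp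
    qed (use finLV Gm in \<open>simp_all add: inf.coboundedI2\<close>)
    also have "area G \<le> overlap I P G"
      by (rule area_multiply_covered_le_overlap[where I=I and P=P, OF fin clI Gm]) (auto simp: G_def)
    also have "overlap I P G \<le> overlap I P W"
      by (rule ov(3)) (use Gm W KW in \<open>auto simp: G_def\<close>)
    finally show ?thesis by simp
  qed
  have second: "(\<Sum>i\<in>L. \<Sum>j\<in>V. area (P i \<inter> P j \<inter> square y (3 * \<rho> y))) \<le> 1440000 / \<gamma> * overlap I P (square y (\<rho> y))"
    if y: "y \<in> Y" for y
  proof -
    define r where "r = \<rho> y"
    have r: "0 < r" "r < \<epsilon>/20" "big y r" "\<And>r'. 2 * r \<le> r' \<Longrightarrow> r' \<le> \<epsilon> \<Longrightarrow> \<not> big y r'"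
      using \<rho>[OF YZ[OF y]] unfolding r_def by blast+
    \<comment> \<open>The size of \<open>m i\<close> is that of the width of strip \<open>i\<close>; the square of half-side \<open>5 * r\<close> contains a
      square of half-side \<open>2 * r\<close> around any point of the square of half-side \<open>3 * r\<close>.\<close>
    define m where "m i = area (P i \<inter> square y (5 * r)) / r" for i
    have m0: "0 \<le> m i" for i using r(1) by (simp add: m_def)
    have meet: "min (hi i - lo i) r \<le> m i" if i: "i \<in> I" "P i \<inter> square y (3 * r) \<noteq> {}" for i
    proof -
      obtain y0 where y0: "y0 \<in> P i" "y0 \<in> square y (3 * r)" using i(2) by blast
      have "min (hi i - lo i) r * r \<le> area (P i \<inter> square y0 (2 * r))"
        using strip_square_lower[of "n i" y0 "lo i" "hi i" r] n[OF i(1)] y0(1) r(1) by (simp add: P_def)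
      also have "\<dots> \<le> area (P i \<inter> square y (5 * r))"
      proof (rule area_mono[OF _ Pm[OF lmeasurable_square] Pm[OF lmeasurable_square]])
        show "P i \<inter> square y0 (2 * r) \<subseteq> P i \<inter> square y (5 * r)"
          using y0(2) by (auto simp: square_def abs_le_iff)
      qed
      finally show ?thesis using r(1) by (simp add: m_def pos_le_divide_eq)
    qed
    have pair: "area (P i \<inter> P j \<inter> square y (3 * r)) \<le> 144 / \<gamma> * (m i * m j)" if "i \<in> L" "j \<in> V" for i j
    proof (cases "P i \<inter> P j \<inter> square y (3 * r) = {}")
      case True
      then show ?thesis using m0 \<gamma>(1) by (simp add: area_def)
    next
      case False
      have ij: "i \<in> I" "j \<in> I" using that LV by auto
      have "area (P i \<inter> P j \<inter> square y (3 * r)) \<le> 144 / \<gamma> * (min (hi i - lo i) r * min (hi j - lo j) r)"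
        unfolding P_def by (rule strips_square_upper) (use n[OF ij(1)] n[OF ij(2)] w[OF ij(1)] w[OF ij(2)] \<gamma>(1) \<gamma>(2)[OF that] r(1) in auto)
      also have "\<dots> \<le> 144 / \<gamma> * (m i * m j)"
      proof -
        have "min (hi i - lo i) r \<le> m i" "min (hi j - lo j) r \<le> m j"
          using meet[OF ij(1)] meet[OF ij(2)] False by blast+
        then show ?thesis
          using \<gamma>(1) w[OF ij(1)] w[OF ij(2)] r(1) m0 by (intro mult_left_mono mult_mono) auto
      qed
      finally show ?thesis .
    qed
    have "(\<Sum>i\<in>L. \<Sum>j\<in>V. area (P i \<inter> P j \<inter> square y (3 * r))) \<le> (\<Sum>i\<in>L. \<Sum>j\<in>V. 144 / \<gamma> * (m i * m j))"
      by (intro sum_mono pair)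
    also have "\<dots> = 144 / \<gamma> * (sum m L * sum m V)" by (simp only: sum_product) (simp only: sum_distrib_left)
    \<comment> \<open>The square of half-side \<open>5 * r\<close> is not big, so \<open>sum m I * r < 8 * (5 * r)\<^sup>2\<close>.\<close>
    also have "\<dots> \<le> 144 / \<gamma> * ((200 * r) * (200 * r))"
    proof -
      have "sum m I * r = (\<Sum>i\<in>I. area (P i \<inter> square y (5 * r)))"
        using r(1) by (simp add: m_def sum_distrib_right)
      also have "\<dots> < 8 * (5 * r)\<^sup>2" using r(4)[of "5 * r"] r(1,2) by (simp add: big_def not_le)
      finally have "sum m I * r < (200 * r) * r" by (simp add: power2_eq_square)
      then have "sum m I \<le> 200 * r" using r(1) by simp
      moreover have "sum m L \<le> sum m I" "sum m V \<le> sum m I" using LV fin m0 by (auto intro: sum_mono2)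
      ultimately show ?thesis using \<gamma>(1) m0 r(1) by (intro mult_left_mono mult_mono sum_nonneg) auto
    qed
    also have "\<dots> = 1440000 / \<gamma> * (4 * r\<^sup>2)" by (simp add: power2_eq_square)
    also have "\<dots> \<le> 1440000 / \<gamma> * overlap I P (square y r)"
      using \<gamma>(1) bigov[OF r(3,1)] by (intro mult_left_mono) auto
    finally show ?thesis by (simp add: r_def)
  qed
  have "(\<Sum>i\<in>L. \<Sum>j\<in>V. area (P i \<inter> P j \<inter> K))
    \<le> (\<Sum>i\<in>L. \<Sum>j\<in>V. area (P i \<inter> P j \<inter> G) + (\<Sum>y\<in>Y. area (P i \<inter> P j \<inter> square y (3 * \<rho> y))))"
    by (intro sum_mono split)
  also have "\<dots> = (\<Sum>i\<in>L. \<Sum>j\<in>V. area (P i \<inter> P j \<inter> G)) + (\<Sum>y\<in>Y. \<Sum>i\<in>L. \<Sum>j\<in>V. area (P i \<inter> P j \<inter> square y (3 * \<rho> y)))"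
  proof -
    have "(\<Sum>i\<in>L. \<Sum>j\<in>V. \<Sum>y\<in>Y. f i j y) = (\<Sum>y\<in>Y. \<Sum>i\<in>L. \<Sum>j\<in>V. f i j y)" for f :: "nat \<Rightarrow> nat \<Rightarrow> real^2 \<Rightarrow> real"
    proof -
      have "(\<Sum>i\<in>L. \<Sum>j\<in>V. \<Sum>y\<in>Y. f i j y) = (\<Sum>i\<in>L. \<Sum>y\<in>Y. \<Sum>j\<in>V. f i j y)"
        by (intro sum.cong refl sum.swap)
      also have "\<dots> = (\<Sum>y\<in>Y. \<Sum>i\<in>L. \<Sum>j\<in>V. f i j y)" by (rule sum.swap)
      finally show ?thesis .
    qed
    then show ?thesis by (simp only: sum.distrib)
  qed
  also have "\<dots> \<le> 1024 * overlap I P W + (\<Sum>y\<in>Y. 1440000 / \<gamma> * overlap I P (square y (\<rho> y)))"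
    by (intro add_mono first sum_mono second)
  also have "\<dots> = 1024 * overlap I P W + 1440000 / \<gamma> * (\<Sum>y\<in>Y. overlap I P (square y (\<rho> y)))"
    unfolding sum_distrib_left ..
  also have "\<dots> \<le> 1024 * overlap I P W + 1440000 / \<gamma> * overlap I P W"
  proof (intro add_left_mono mult_left_mono sum_overlap_le[where I=I and P=P, OF fin clI finY])
    show "square y (\<rho> y) \<subseteq> W" if "y \<in> Y" for y
    proof -
      have "square y (\<rho> y) \<subseteq> square y \<epsilon>" using \<rho>(1)[OF YZ[OF that]] \<epsilon> by (auto simp: square_def)
      then show ?thesis using W(2) YZ[OF that] unfolding Z_def by blast
    qed
    show "square j (\<rho> j) \<inter> square k (\<rho> k) = {}" if "j \<in> Y" "k \<in> Y" "j \<noteq> k" for j k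
      using Y(2)[OF that] by (simp add: conflict_def)
  qed (use W \<gamma>(1) in simp_all)
  finally show ?thesis by (simp add: distrib_right)
qed

section \<open>Crossings of a strip with a line\<close>

definition crossing :: "(real^2) set \<Rightarrow> real^2 \<Rightarrow> real^2 \<Rightarrow> real \<Rightarrow> real \<Rightarrow> real set" where
  "crossing Q x e p q = {s. p \<le> s \<and> s \<le> q \<and> x + s *\<^sub>R e \<in> Q}"

lemma crossing_interval:
  assumes "v \<bullet> e \<noteq> 0"
  shows "\<exists>a b. crossing (strip v lo hi) x e p q = {a..b}"
proof -
  have *: "lo \<le> v \<bullet> (x + s *\<^sub>R e) \<and> v \<bullet> (x + s *\<^sub>R e) \<le> hi \<longleftrightarrow>
    lo - v \<bullet> x \<le> s * (v \<bullet> e) \<and> s * (v \<bullet> e) \<le> hi - v \<bullet> x" for s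
    by (auto simp: inner_add_right)
  show ?thesis
  proof (cases "0 < v \<bullet> e")
    case True
    then have "crossing (strip v lo hi) x e p q = {max p ((lo - v \<bullet> x) / (v \<bullet> e))..min q ((hi - v \<bullet> x) / (v \<bullet> e))}"
      unfolding crossing_def strip_def mem_Collect_eq * by (auto simp: pos_divide_le_eq pos_le_divide_eq)
    then show ?thesis by blast
  next
    case False
    then have "v \<bullet> e < 0" using assms by simp
    then have "crossing (strip v lo hi) x e p q = {max p ((hi - v \<bullet> x) / (v \<bullet> e))..min q ((lo - v \<bullet> x) / (v \<bullet> e))}"
      unfolding crossing_def strip_def mem_Collect_eq * by (auto simp: neg_divide_le_eq neg_le_divide_eq)
    then show ?thesis by blast
  qed
qed

lemma crossing_measurable:
  assumes "v \<bullet> e \<noteq> 0" shows "crossing (strip v a b) x e p q \<in> lmeasurable"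
  using crossing_interval[OF assms, of a b x p q] by auto

text \<open>
  The lines in direction orthogonal to \<open>v\<close> that pass through the points \<open>x + s *\<^sub>R e\<close> with \<open>s\<close> in an
  interval \<open>C\<close> form a strip; cut by a second strip it becomes a parallelogram.  This converts the
  length that a plank cuts out of a line into an area.
\<close>
lemma crossing_parallelogram:
  fixes v e w x :: "real^2"
  assumes ve: "v \<bullet> e \<noteq> 0" and d: "det2 v w \<noteq> 0" and C: "C = {a..b}" and cd: "c \<le> d"
  defines "F \<equiv> {y. (v \<bullet> (y - x)) / (v \<bullet> e) \<in> C \<and> c \<le> w \<bullet> y \<and> w \<bullet> y \<le> d}"
  shows "area F = measure lebesgue C * (d - c) * \<bar>v \<bullet> e\<bar> / \<bar>det2 v w\<bar>" "compact F"
proof -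
  have "area F = measure lebesgue C * (d - c) * \<bar>v \<bullet> e\<bar> / \<bar>det2 v w\<bar> \<and> compact F"
  proof (cases "a \<le> b")
    case False
    then have "F = {}" "C = {}" unfolding F_def C by auto
    then show ?thesis by (simp add: area_def)
  next
    case True
    have *: "(v \<bullet> (y - x)) / (v \<bullet> e) \<in> C \<longleftrightarrow>
      v \<bullet> x + min (a * (v \<bullet> e)) (b * (v \<bullet> e)) \<le> v \<bullet> y \<and> v \<bullet> y \<le> v \<bullet> x + max (a * (v \<bullet> e)) (b * (v \<bullet> e))" for y
    proof (cases "0 < v \<bullet> e")
      case pos: True
      then have "a * (v \<bullet> e) \<le> b * (v \<bullet> e)" using True by simp
      then show ?thesis unfolding C using pos
        by (simp add: min_def max_def inner_diff_right pos_divide_le_eq pos_le_divide_eq) linarith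
    next
      case False
      then have neg: "v \<bullet> e < 0" using ve by simp
      then have "b * (v \<bullet> e) \<le> a * (v \<bullet> e)" using True by simp
      then show ?thesis unfolding C using neg
        by (simp add: min_def max_def inner_diff_right neg_divide_le_eq neg_le_divide_eq) linarith
    qed
    have len: "max (a * (v \<bullet> e)) (b * (v \<bullet> e)) - min (a * (v \<bullet> e)) (b * (v \<bullet> e)) = (b - a) * \<bar>v \<bullet> e\<bar>"
    proof (cases "0 < v \<bullet> e")
      case pos: True
      then have "a * (v \<bullet> e) \<le> b * (v \<bullet> e)" using True by simp
      then show ?thesis using pos by (simp add: left_diff_distrib)
    next
      case False
      then have neg: "v \<bullet> e < 0" using ve by simp
      then have "b * (v \<bullet> e) \<le> a * (v \<bullet> e)" using True by simp
      then show ?thesis using neg by (simp add: left_diff_distrib max_absorb1 min_absorb2)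
    qed
    have F: "F = {y. v \<bullet> x + min (a * (v \<bullet> e)) (b * (v \<bullet> e)) \<le> v \<bullet> y \<and> v \<bullet> y \<le> v \<bullet> x + max (a * (v \<bullet> e)) (b * (v \<bullet> e)) \<and> c \<le> w \<bullet> y \<and> w \<bullet> y \<le> d}"
      unfolding F_def * by auto
    have le: "v \<bullet> x + min (a * (v \<bullet> e)) (b * (v \<bullet> e)) \<le> v \<bullet> x + max (a * (v \<bullet> e)) (b * (v \<bullet> e))" by simp
    have "measure lebesgue C = b - a" using True by (simp add: C)
    moreover have "area F = (b - a) * \<bar>v \<bullet> e\<bar> * (d - c) / \<bar>det2 v w\<bar>"
      unfolding F parallelogram_area(1)[OF d le cd] by (simp add: len)
    moreover have "compact F" unfolding F by (rule parallelogram_area(2)[OF d le cd])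
    ultimately show ?thesis by (simp add: mult.commute mult.left_commute)
  qed
  then show "area F = measure lebesgue C * (d - c) * \<bar>v \<bullet> e\<bar> / \<bar>det2 v w\<bar>" "compact F" by auto
qed

section \<open>A net of directions\<close>

text \<open>
  The concave function \<open>sin x\<close> lies above its chord of slope \<open>2/pi\<close>; the weaker slope \<open>1/2\<close> is enough to
  see that a direction of sine less than \<open>\<phi>\<close> has angle less than \<open>2 * \<phi>\<close>.
\<close>
lemma sin_ge_half:
  assumes "0 \<le> x" "x \<le> pi/2" shows "x/2 \<le> sin x"
proof (cases "x \<le> pi/3")
  case True
  have "(\<lambda>x. sin x - x/2) 0 \<le> (\<lambda>x. sin x - x/2) x"
  proof (rule DERIV_nonneg_imp_nondecreasing[OF assms(1)])
    fix t assume t: "0 \<le> t" "t \<le> x"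
    have "((\<lambda>x. sin x - x/2) has_real_derivative (cos t - 1/2)) (at t)"
      by (auto intro!: derivative_eq_intros)
    moreover have "cos (pi/3) \<le> cos t" using t True by (intro cos_monotone_0_pi_le) auto
    ultimately show "\<exists>y. ((\<lambda>x. sin x - x/2) has_real_derivative y) (at t) \<and> 0 \<le> y"
      by (intro exI[of _ "cos t - 1/2"]) (simp add: cos_60)
  qed
  then show ?thesis by simp
next
  case False
  have "sin (pi/3) \<le> sin x" using False assms by (intro sin_monotone_2pi_le) auto
  moreover have "x/2 \<le> sin (pi/3)"
  proof -
    have "x \<le> 1.6" using assms pi_less_4 pi_approx by simp
    moreover have "1.6 \<le> sqrt 3" by (rule real_le_rsqrt) (simp add: power2_eq_square)
    ultimately show ?thesis by (simp add: sin_60)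
  qed
  ultimately show ?thesis by simp
qed

definition net_dir :: "real^2 \<Rightarrow> real \<Rightarrow> int \<Rightarrow> real^2" where
  "net_dir e \<phi> j = cos (of_int j * \<phi> / 8) *\<^sub>R e + sin (of_int j * \<phi> / 8) *\<^sub>R perp e"

lemma norm_net_dir: "norm e = 1 \<Longrightarrow> norm (net_dir e \<phi> j) = 1"
  using norm_frame[of e "cos (of_int j * \<phi> / 8)" "sin (of_int j * \<phi> / 8)"]
  by (simp add: net_dir_def power2_eq_1_iff) (smt (verit) norm_ge_zero)

text \<open>
  A plank of inclination below \<open>\<phi>\<close> has an angle below \<open>2 * \<phi>\<close>, that is, below \<open>16\<close> steps of the net;
  rounding to the nearest step costs at most half a step, \<open>\<phi> / 16\<close>, and at most one more index.
\<close>
lemma net_dir_covers: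
  assumes e: "norm e = 1" and u: "norm u = 1" and \<phi>: "0 < \<phi>" and ue: "\<bar>u \<bullet> e\<bar> < \<phi>"
  shows "\<exists>j\<in>{-17..17}. \<bar>u \<bullet> net_dir e \<phi> j\<bar> \<le> \<phi> / 16"
proof -
  define \<alpha> \<beta> where "\<alpha> = u \<bullet> e" and "\<beta> = u \<bullet> perp e"
  have ab: "\<alpha>\<^sup>2 + \<beta>\<^sup>2 = 1"
    using det2_sq_add_inner_sq[of e u] e u by (simp add: \<alpha>_def \<beta>_def inner_commute[of u] perp_inner add.commute)
  have "\<bar>\<alpha>\<bar> \<le> 1" using ab by (metis abs_square_le_1 le_add_same_cancel1 zero_le_power2)
  define \<psi> where "\<psi> = arcsin \<alpha>"
  have \<psi>: "sin \<psi> = \<alpha>" "- (pi/2) \<le> \<psi>" "\<psi> \<le> pi/2"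
    using \<open>\<bar>\<alpha>\<bar> \<le> 1\<close> arcsin[of \<alpha>] by (auto simp: \<psi>_def)
  have "cos \<psi> = \<bar>\<beta>\<bar>"
  proof -
    have "0 \<le> cos \<psi>" using \<psi> by (intro cos_ge_zero) auto
    moreover have "(cos \<psi>)\<^sup>2 = \<beta>\<^sup>2" using ab \<psi>(1) sin_cos_squared_add[of \<psi>] by (simp add: add.commute)
    ultimately show ?thesis by (metis abs_of_nonneg power2_eq_iff_nonneg real_sqrt_abs)
  qed
  define \<sigma> where "\<sigma> = (if 0 \<le> \<beta> then 1 else - 1 :: real)"
  have \<sigma>: "\<bar>\<sigma>\<bar> = 1" "\<sigma> * \<sigma> = 1" "\<beta> = \<sigma> * cos \<psi>" using \<open>cos \<psi> = \<bar>\<beta>\<bar>\<close> by (auto simp: \<sigma>_def)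
  have "\<bar>\<psi>\<bar> / 2 \<le> \<bar>\<alpha>\<bar>"
  proof (cases "0 \<le> \<psi>")
    case True
    then show ?thesis using sin_ge_half[of \<psi>] \<psi> by simp
  next
    case False
    then show ?thesis using sin_ge_half[of "- \<psi>"] \<psi> by simp
  qed
  then have \<psi>2: "\<bar>\<psi>\<bar> < 2 * \<phi>" using ue by (simp add: \<alpha>_def)
  define j where "j = round (- \<sigma> * \<psi> * 8 / \<phi>)"
  have "\<bar>of_int j - (- \<sigma> * \<psi> * 8 / \<phi>)\<bar> \<le> 1/2" unfolding j_def by (rule of_int_round_abs_le)
  then have j1: "\<bar>of_int j + \<sigma> * \<psi> * 8 / \<phi>\<bar> \<le> 1/2" by simp
  have "\<bar>\<sigma> * \<psi> * 8 / \<phi>\<bar> < 16" using \<psi>2 \<phi> \<sigma>(1) by (simp add: abs_mult pos_divide_less_eq)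
  then have "\<bar>of_int j :: real\<bar> < 17" using j1 by linarith
  then have j: "j \<in> {-17..17}" by auto
  have "\<bar>\<psi> + \<sigma> * (of_int j * \<phi> / 8)\<bar> = \<bar>\<sigma> * (\<psi> + \<sigma> * (of_int j * \<phi> / 8))\<bar>"
    using \<sigma>(1) by (simp add: abs_mult)
  also have "\<dots> = \<bar>(of_int j + \<sigma> * \<psi> * 8 / \<phi>) * (\<phi> / 8)\<bar>"
    using \<phi> \<sigma>(2) by (simp add: algebra_simps) (simp add: mult.assoc[symmetric])
  also have "\<dots> \<le> 1/2 * (\<phi> / 8)" using j1 \<phi> unfolding abs_mult by (intro mult_mono) auto
  finally have small: "\<bar>\<psi> + \<sigma> * (of_int j * \<phi> / 8)\<bar> \<le> \<phi> / 16" by simp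
  have "u \<bullet> net_dir e \<phi> j = sin (\<psi> + \<sigma> * (of_int j * \<phi> / 8))"
  proof -
    have "u \<bullet> net_dir e \<phi> j = sin \<psi> * cos (of_int j * \<phi> / 8) + \<sigma> * cos \<psi> * sin (of_int j * \<phi> / 8)"
      using \<sigma>(3) \<psi>(1) by (simp add: net_dir_def inner_add_right \<alpha>_def[symmetric] \<beta>_def[symmetric] mult.commute)
    moreover have "cos (\<sigma> * t) = cos t" "sin (\<sigma> * t) = \<sigma> * sin t" for t by (auto simp: \<sigma>_def)
    ultimately show ?thesis by (simp only: sin_add) (simp add: mult.commute mult.left_commute)
  qed
  then have "\<bar>u \<bullet> net_dir e \<phi> j\<bar> \<le> \<phi> / 16" using abs_sin_x_le_abs_x small order_trans by metis
  then show ?thesis using j by blast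
qed

section \<open>The scale of an uncovered point\<close>

text \<open>
  The assumption \<open>covered\<close> says that what is left uncovered is confined to the disk of radius \<open>r\<close>.
  The bound \<open>1/10000\<close> makes \<open>r\<close> negligible against the numerical constants used below.
\<close>
locale plank_cover =
  fixes I :: "nat set" and u :: "nat \<Rightarrow> real^2" and lo hi :: "nat \<Rightarrow> real" and r :: real
  assumes fin: "finite I" and unit: "\<And>i. i \<in> I \<Longrightarrow> norm (u i) = 1" and wide: "\<And>i. i \<in> I \<Longrightarrow> lo i < hi i"
    and r_pos: "0 < r" and r_small: "r < 1/10000"
    and covered: "\<And>y. r < norm y \<Longrightarrow> norm y \<le> 1 \<Longrightarrow> \<exists>i\<in>I. y \<in> strip (u i) (lo i) (hi i)"
begin

abbreviation P :: "nat \<Rightarrow> (real^2) set" where "P i \<equiv> strip (u i) (lo i) (hi i)"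

definition uncovered :: "(real^2) set" where "uncovered = cball 0 1 - (\<Union>i\<in>I. P i)"

definition len :: "nat \<Rightarrow> real^2 \<Rightarrow> real^2 \<Rightarrow> real" where
  "len i x e = measure lebesgue (crossing (P i) x e (-1/4) (1/4))"

text \<open>
  As \<open>u i\<close> is the normal of plank \<open>i\<close>, the number \<open>\<bar>u i \<bullet> e\<bar>\<close> is the sine of the angle between the
  plank and the direction \<open>e\<close>: only planks that are steep at scale \<open>\<phi>\<close> are counted, with the lengths
  they cut out of a segment of length \<open>1/2\<close> centred at \<open>x\<close>.
\<close>
definition mass :: "real^2 \<Rightarrow> real^2 \<Rightarrow> real \<Rightarrow> real" where
  "mass x e \<phi> = (\<Sum>i | i \<in> I \<and> \<phi> \<le> \<bar>u i \<bullet> e\<bar>. len i x e)"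

text \<open>
  For a unit vector \<open>e\<close>, the number \<open>\<bar>det2 e (y - x)\<bar>\<close> is the distance of \<open>y\<close> from the line through \<open>x\<close> in
  direction \<open>e\<close>, the axis of the box.
\<close>
definition box :: "real^2 \<Rightarrow> real^2 \<Rightarrow> real \<Rightarrow> (real^2) set" where
  "box x e D = {y. norm (y - x) \<le> 1/2 \<and> \<bar>det2 e (y - x)\<bar> \<le> D}"

lemma cl: "i \<in> I \<Longrightarrow> closed (P i)" by (rule closed_strip)

lemma norm_uncovered: "x \<in> uncovered \<Longrightarrow> norm x \<le> r"
  using covered[of x] unfolding uncovered_def by (cases "r < norm x") auto

lemma len_nonneg: "0 \<le> len i x e" by (simp add: len_def)

text \<open>
  Each of the finitely many planks has positive distance from \<open>x\<close>, and a plank at positive distance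
  can reach a line through \<open>x\<close> within bounded distance only at a definite angle.
\<close>
lemma inclination_bound:
  assumes "x \<in> uncovered"
  shows "\<exists>\<delta>>0. \<forall>i\<in>I. \<forall>e s. \<bar>s\<bar> \<le> 1/4 \<longrightarrow> x + s *\<^sub>R e \<in> P i \<longrightarrow> \<delta> \<le> \<bar>u i \<bullet> e\<bar>"
proof -
  define g where "g i = max (lo i - u i \<bullet> x) (u i \<bullet> x - hi i)" for i
  have g: "0 < g i" if "i \<in> I" for i
    using assms that by (auto simp: uncovered_def g_def strip_def)
  define \<delta> where "\<delta> = Min (insert 1 (g ` I))"
  have "0 < \<delta>" "\<And>i. i \<in> I \<Longrightarrow> \<delta> \<le> g i" using g fin by (auto simp: \<delta>_def)
  moreover have "g i \<le> \<bar>u i \<bullet> e\<bar>" if "\<bar>s\<bar> \<le> 1/4" "x + s *\<^sub>R e \<in> P i" for i e s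
  proof -
    have "g i \<le> \<bar>s * (u i \<bullet> e)\<bar>" using that(2) by (auto simp: g_def strip_def inner_add_right)
    also have "\<dots> \<le> 1 * \<bar>u i \<bullet> e\<bar>" unfolding abs_mult using that(1) by (intro mult_right_mono) auto
    finally show ?thesis by simp
  qed
  ultimately show ?thesis by (meson order_trans)
qed

text \<open>
  The part of the segment outside the disk of radius \<open>r\<close> is covered; if every plank involved is
  steep, its length is a lower bound for the mass.
\<close>
lemma mass_large:
  assumes x: "x \<in> uncovered" and e: "norm e = 1" and \<delta>: "0 < \<phi>"
    "\<And>i s. i \<in> I \<Longrightarrow> \<bar>s\<bar> \<le> 1/4 \<Longrightarrow> x + s *\<^sub>R e \<in> P i \<Longrightarrow> \<phi> \<le> \<bar>u i \<bullet> e\<bar>"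
  shows "1/10000 < mass x e \<phi>"
proof -
  let ?J = "{i. i \<in> I \<and> \<phi> \<le> \<bar>u i \<bullet> e\<bar>}"
  have m: "crossing (P i) x e (-1/4) (1/4) \<in> lmeasurable" if "i \<in> ?J" for i
    using that \<delta>(1) by (intro crossing_measurable) auto
  have "{3 * r..1/4} \<subseteq> (\<Union>i\<in>?J. crossing (P i) x e (-1/4) (1/4))"
  proof
    fix s assume s: "s \<in> {3 * r..1/4}"
    have "norm (s *\<^sub>R e) = s" using s r_pos e by simp
    then have "s - r \<le> norm (x + s *\<^sub>R e)" "norm (x + s *\<^sub>R e) \<le> s + r"
      using norm_uncovered[OF x] norm_triangle_ineq[of x "s *\<^sub>R e"] norm_triangle_ineq4[of "x + s *\<^sub>R e" x] by auto
    then obtain i where i: "i \<in> I" "x + s *\<^sub>R e \<in> P i"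
      using covered[of "x + s *\<^sub>R e"] s r_pos r_small by auto
    then show "s \<in> (\<Union>i\<in>?J. crossing (P i) x e (-1/4) (1/4))"
      using \<delta>(2)[OF i(1) _ i(2)] s r_pos by (auto simp: crossing_def)
  qed
  then have "measure lebesgue {3 * r..1/4} \<le> measure lebesgue (\<Union>i\<in>?J. crossing (P i) x e (-1/4) (1/4))"
    using m fin by (intro measure_mono_fmeasurable fmeasurable.finite_UN) auto
  also have "\<dots> \<le> (\<Sum>i\<in>?J. measure lebesgue (crossing (P i) x e (-1/4) (1/4)))"
    using m fin by (intro measure_UNION_le) auto
  also have "\<dots> = mass x e \<phi>" by (simp add: mass_def len_def)
  finally show ?thesis using r_small r_pos by simp
qed

text \<open>
  Walking through the scales \<open>2, 1, 1/2, \<dots>\<close>: at scale \<open>2\<close> no plank is steep, so every direction has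
  mass zero; at small scales all planks that meet the segment are steep, so every direction has large mass.  The
  last scale at which some direction still has small mass is the required one.
\<close>
lemma scale_exists:
  assumes x: "x \<in> uncovered"
  shows "\<exists>\<phi> e. 0 < \<phi> \<and> \<phi> \<le> 2 \<and> norm e = 1 \<and> mass x e \<phi> \<le> 1/10000 \<and>
    (\<forall>e'. norm e' = 1 \<longrightarrow> 1/10000 < mass x e' (\<phi>/2))"
proof -
  define G where "G n \<longleftrightarrow> (\<exists>e. norm e = 1 \<and> mass x e (2 / 2^n) \<le> 1/10000)" for n :: nat
  have "G 0"
  proof -
    obtain e :: "real^2" where e: "norm e = 1" using vector_choose_size[of 1] by auto
    have "\<not> 2 \<le> \<bar>u i \<bullet> e\<bar>" if "i \<in> I" for i
      using Cauchy_Schwarz_ineq2[of "u i" e] e unit[OF that] by simp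
    then have *: "{i. i \<in> I \<and> 2 \<le> \<bar>u i \<bullet> e\<bar>} = {}" by auto
    have "mass x e 2 = 0" unfolding mass_def * by simp
    then show ?thesis using e by (auto simp: G_def)
  qed
  moreover have "\<exists>n. \<not> G n"
  proof -
    obtain \<delta> where \<delta>: "\<delta> > 0" "\<And>i e s. i \<in> I \<Longrightarrow> \<bar>s\<bar> \<le> 1/4 \<Longrightarrow> x + s *\<^sub>R e \<in> P i \<Longrightarrow> \<delta> \<le> \<bar>u i \<bullet> e\<bar>"
      using inclination_bound[OF x] by blast
    obtain n where "(1/2)^n < \<delta>/2" using real_arch_pow_inv[of "\<delta>/2" "1/2"] \<delta>(1) by auto
    then have n: "2/2^n < \<delta>" by (simp add: power_divide)
    have "1/10000 < mass x e (2/2^n)" if "norm e = 1" for e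
      by (rule mass_large[OF x that]) (use n \<delta>(2) in \<open>auto intro: order_trans less_imp_le\<close>)
    then have "\<not> G n" unfolding G_def by (metis not_le)
    then show ?thesis by blast
  qed
  ultimately obtain n where n: "G n" "\<not> G (Suc n)" by (metis nat_induct)
  then obtain e where "norm e = 1" "mass x e (2/2^n) \<le> 1/10000" by (auto simp: G_def)
  moreover have "1/10000 < mass x e' (2/2^n/2)" if "norm e' = 1" for e'
    using n(2) that by (auto simp: G_def not_le)
  moreover have "(2::real)/2^n \<le> 2" by (simp add: field_simps)
  ultimately show ?thesis by (intro exI[of _ "2/2^n"] exI[of _ e]) auto
qed

lemma mass_antimono:
  assumes "\<phi> \<le> \<phi>'" shows "mass x e \<phi>' \<le> mass x e \<phi>"
  unfolding mass_def by (rule sum_mono2) (use fin assms len_nonneg in auto)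

section \<open>A bundle of flat planks next to an uncovered point\<close>

text \<open>
  A thin rectangle at distance about \<open>3/1000\<close> from \<open>x\<close>.  Being farther than \<open>2 * r\<close> away, it is covered;
  being close to \<open>x\<close>, it meets only planks that come close to \<open>x\<close>; and its height is so small that a
  line of inclination at least \<open>\<phi>\<close> shifts by at most \<open>1/4000\<close> between the axis and the edge of the slab.
\<close>
definition slab :: "real^2 \<Rightarrow> real^2 \<Rightarrow> real \<Rightarrow> (real^2) set" where
  "slab x e \<phi> = {y. e \<bullet> x + 3/1000 \<le> e \<bullet> y \<and> e \<bullet> y \<le> e \<bullet> x + 45/10000 \<and>
    perp e \<bullet> x - \<phi>/4000 \<le> perp e \<bullet> y \<and> perp e \<bullet> y \<le> perp e \<bullet> x + \<phi>/4000}"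

lemma slab_area:
  assumes "norm e = 1" "0 < \<phi>"
  shows "area (slab x e \<phi>) = 75/10^8 * \<phi>" "compact (slab x e \<phi>)"
  unfolding slab_def
  using parallelogram_area[of e "perp e" "e \<bullet> x + 3/1000" "e \<bullet> x + 45/10000" "perp e \<bullet> x - \<phi>/4000" "perp e \<bullet> x + \<phi>/4000"]
    det2_perp_self[OF assms(1)] assms(2) by auto

lemma slab_norm:
  assumes e: "norm e = 1" and \<phi>: "0 < \<phi>" "\<phi> \<le> 2" and y: "y \<in> slab x e \<phi>"
  shows "3/1000 \<le> norm (y - x)" "norm (y - x) \<le> 5/1000" "\<bar>e \<bullet> (y - x)\<bar> \<le> 45/10000" "\<bar>det2 e (y - x)\<bar> \<le> \<phi>/4000"
proof -
  have 1: "3/1000 \<le> e \<bullet> (y - x)" "e \<bullet> (y - x) \<le> 45/10000" using y by (auto simp: slab_def inner_diff_right)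
  then show "\<bar>e \<bullet> (y - x)\<bar> \<le> 45/10000" by simp
  show 2: "\<bar>det2 e (y - x)\<bar> \<le> \<phi>/4000" unfolding abs_le_iff perp_inner[symmetric] inner_diff_right using y by (auto simp: slab_def)
  show "3/1000 \<le> norm (y - x)" using 1 Cauchy_Schwarz_ineq2[of e "y - x"] e by simp
  have "norm (y - x) \<le> norm ((e \<bullet> (y - x)) *\<^sub>R e) + norm (det2 e (y - x) *\<^sub>R perp e)"
    by (subst frame_expand[OF e]) (rule norm_triangle_ineq)
  also have "\<dots> \<le> 5/1000" using 1 2 e \<phi> by simp
  finally show "norm (y - x) \<le> 5/1000" .
qed

lemma slab_covered:
  assumes x: "x \<in> uncovered" and e: "norm e = 1" and \<phi>: "0 < \<phi>" "\<phi> \<le> 2"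
  shows "slab x e \<phi> \<subseteq> (\<Union>i\<in>I. P i)"
proof
  fix y assume "y \<in> slab x e \<phi>"
  from slab_norm[OF e \<phi> this] norm_uncovered[OF x] r_small
  have "r < norm y" "norm y \<le> 1"
    using norm_triangle_ineq4[of y x] norm_triangle_ineq[of x "y - x"] by auto
  from covered[OF this] show "y \<in> (\<Union>i\<in>I. P i)" by auto
qed

text \<open>
  Within the slab a steep plank shifts so little that the part of it there meets the axis inside the
  segment on which \<open>len\<close> is measured.  So this part lies in a parallelogram whose base is the crossing
  and whose height is that of the slab.
\<close>
lemma steep_area:
  assumes e: "norm e = 1" and \<phi>: "0 < \<phi>" and i: "i \<in> I" "\<phi> \<le> \<bar>u i \<bullet> e\<bar>"
  shows "area (P i \<inter> slab x e \<phi>) \<le> len i x e * (\<phi>/2000)"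
proof -
  define \<alpha> where "\<alpha> = u i \<bullet> e"
  have \<alpha>: "\<alpha> \<noteq> 0" "\<phi> \<le> \<bar>\<alpha>\<bar>" using \<phi> i by (auto simp: \<alpha>_def)
  let ?C = "crossing (P i) x e (-1/4) (1/4)"
  have ue: "u i \<bullet> e \<noteq> 0" using \<alpha>(1) by (simp add: \<alpha>_def)
  then obtain a b where C: "?C = {a..b}" using crossing_interval by blast
  let ?F = "{y. (u i \<bullet> (y - x)) / (u i \<bullet> e) \<in> ?C \<and> perp e \<bullet> x - \<phi>/4000 \<le> perp e \<bullet> y \<and> perp e \<bullet> y \<le> perp e \<bullet> x + \<phi>/4000}"
  have d: "det2 (u i) (perp e) = \<alpha>" by (simp add: det2_perp \<alpha>_def)
  have F: "area ?F = measure lebesgue ?C * (perp e \<bullet> x + \<phi>/4000 - (perp e \<bullet> x - \<phi>/4000)) * \<bar>u i \<bullet> e\<bar> / \<bar>det2 (u i) (perp e)\<bar>" "compact ?F"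
    using crossing_parallelogram[OF ue _ C, of "perp e"] d \<alpha>(1) \<phi> by auto
  have "P i \<inter> slab x e \<phi> \<subseteq> ?F"
  proof
    fix y assume y: "y \<in> P i \<inter> slab x e \<phi>"
    have s: "\<bar>e \<bullet> (y - x)\<bar> \<le> 45/10000" and t: "\<bar>det2 e (y - x)\<bar> \<le> \<phi>/4000"
      unfolding abs_le_iff perp_inner[symmetric] inner_diff_right using y by (auto simp: slab_def)
    define s' where "s' = (u i \<bullet> (y - x)) / \<alpha>"
    have "s' = e \<bullet> (y - x) + (u i \<bullet> perp e) * det2 e (y - x) / \<alpha>"
      using \<alpha>(1) unfolding s'_def inner_frame[OF e, of "u i" "y - x"] \<alpha>_def by (simp add: add_divide_distrib)
    moreover have "\<bar>(u i \<bullet> perp e) * det2 e (y - x) / \<alpha>\<bar> \<le> 1/4000"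
    proof -
      have "\<bar>u i \<bullet> perp e\<bar> \<le> 1" using Cauchy_Schwarz_ineq2[of "u i" "perp e"] e unit[OF i(1)] by simp
      then have "\<bar>(u i \<bullet> perp e) * det2 e (y - x)\<bar> \<le> 1 * (\<phi>/4000)"
        unfolding abs_mult using t by (intro mult_mono) auto
      also have "\<dots> \<le> 1/4000 * \<bar>\<alpha>\<bar>" using \<alpha>(2) by simp
      finally show ?thesis using \<alpha>(1) by (simp add: pos_divide_le_eq)
    qed
    ultimately have "\<bar>s'\<bar> \<le> 1/4" using s by linarith
    moreover have "u i \<bullet> (x + s' *\<^sub>R e) = u i \<bullet> y"
      using \<alpha>(1) by (simp add: s'_def \<alpha>_def inner_add_right inner_diff_right)
    ultimately have "s' \<in> ?C" using y by (auto simp: crossing_def strip_def)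
    then show "y \<in> ?F" using y by (simp add: s'_def \<alpha>_def slab_def)
  qed
  then have "area (P i \<inter> slab x e \<phi>) \<le> area ?F"
    by (rule area_mono) (use F slab_area(2)[OF e \<phi>] in \<open>auto intro: lmeasurable_compact Int_closed_lmeasurable closed_strip\<close>)
  also have "\<dots> = len i x e * (\<phi>/2000)" using F(1) d \<alpha>(1) by (simp add: len_def \<alpha>_def)
  finally show ?thesis .
qed

text \<open>
  The slab has area \<open>75/10^8 * \<phi>\<close>, and steep planks cover at most \<open>5/10^8 * \<phi>\<close> of it, as their total
  crossing length is at most \<open>1/10000\<close>; the flat planks have to cover the rest.
\<close>
lemma flat_area:
  assumes x: "x \<in> uncovered" and e: "norm e = 1" and \<phi>: "0 < \<phi>" "\<phi> \<le> 2" and m: "mass x e \<phi> \<le> 1/10000"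
  shows "7/10^7 * \<phi> \<le> (\<Sum>i | i \<in> I \<and> \<bar>u i \<bullet> e\<bar> < \<phi>. area (P i \<inter> slab x e \<phi>))"
proof -
  let ?S = "slab x e \<phi>"
  have Sm: "?S \<in> lmeasurable" using slab_area(2)[OF e \<phi>(1)] by (rule lmeasurable_compact)
  have "?S = (\<Union>i\<in>I. P i \<inter> ?S)" using slab_covered[OF x e \<phi>] by auto
  then have "area ?S \<le> (\<Sum>i\<in>I. area (P i \<inter> ?S))"
    using area_UN_le[OF fin, of "\<lambda>i. P i \<inter> ?S"] Int_closed_lmeasurable[OF cl Sm] by simp
  also have "I = {i. i \<in> I \<and> \<phi> \<le> \<bar>u i \<bullet> e\<bar>} \<union> {i. i \<in> I \<and> \<bar>u i \<bullet> e\<bar> < \<phi>}" by auto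
  also have "(\<Sum>i\<in>\<dots>. area (P i \<inter> ?S)) = (\<Sum>i | i \<in> I \<and> \<phi> \<le> \<bar>u i \<bullet> e\<bar>. area (P i \<inter> ?S)) + (\<Sum>i | i \<in> I \<and> \<bar>u i \<bullet> e\<bar> < \<phi>. area (P i \<inter> ?S))"
    by (rule sum.union_disjoint) (use fin in auto)
  also have "(\<Sum>i | i \<in> I \<and> \<phi> \<le> \<bar>u i \<bullet> e\<bar>. area (P i \<inter> ?S)) \<le> (\<Sum>i | i \<in> I \<and> \<phi> \<le> \<bar>u i \<bullet> e\<bar>. len i x e * (\<phi>/2000))"
    by (intro sum_mono steep_area[OF e \<phi>(1)]) auto
  also have "\<dots> = mass x e \<phi> * (\<phi>/2000)" by (simp only: mass_def sum_distrib_right)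
  also have "\<dots> \<le> 1/10000 * (\<phi>/2000)" using m \<phi> by (intro mult_right_mono) auto
  finally show ?thesis using slab_area(1)[OF e \<phi>(1), of x] by simp
qed

text \<open>
  Pigeonhole over the \<open>35\<close> directions of the net: \<open>35 * 2/10^8 = 7/10^7\<close>.
\<close>
lemma bundle_exists:
  assumes x: "x \<in> uncovered" and e: "norm e = 1" and \<phi>: "0 < \<phi>" "\<phi> \<le> 2" and m: "mass x e \<phi> \<le> 1/10000"
  shows "\<exists>e'. norm e' = 1 \<and> 2/10^8 * \<phi> \<le> (\<Sum>i | i \<in> I \<and> \<bar>u i \<bullet> e\<bar> < \<phi> \<and> \<bar>u i \<bullet> e'\<bar> \<le> \<phi>/16. area (P i \<inter> slab x e \<phi>))"
proof (rule ccontr)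
  assume neg: "\<not> ?thesis"
  let ?a = "\<lambda>i. area (P i \<inter> slab x e \<phi>)"
  let ?L = "{i. i \<in> I \<and> \<bar>u i \<bullet> e\<bar> < \<phi>}"
  let ?B = "\<lambda>j. {i. i \<in> I \<and> \<bar>u i \<bullet> e\<bar> < \<phi> \<and> \<bar>u i \<bullet> net_dir e \<phi> j\<bar> \<le> \<phi>/16}"
  have "7/10^7 * \<phi> \<le> (\<Sum>i\<in>?L. ?a i)" by (rule flat_area[OF x e \<phi> m])
  also have "\<dots> \<le> (\<Sum>i\<in>?L. \<Sum>j\<in>{-17..17}. if i \<in> ?B j then ?a i else 0)"
  proof (rule sum_mono)
    fix i assume i: "i \<in> ?L"
    obtain j where j: "j \<in> {-17..17}" "\<bar>u i \<bullet> net_dir e \<phi> j\<bar> \<le> \<phi>/16"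
      using net_dir_covers[OF e unit \<phi>(1), of i] i by auto
    have "?a i = (if i \<in> ?B j then ?a i else 0)" using i j by simp
    also have "\<dots> \<le> (\<Sum>j\<in>{-17..17}. if i \<in> ?B j then ?a i else 0)"
      by (rule member_le_sum[OF j(1)]) auto
    finally show "?a i \<le> (\<Sum>j\<in>{-17..17}. if i \<in> ?B j then ?a i else 0)" .
  qed
  also have "\<dots> = (\<Sum>j\<in>{-17..17}. \<Sum>i\<in>?L. if i \<in> ?B j then ?a i else 0)" by (rule sum.swap)
  also have "\<dots> = (\<Sum>j\<in>{-17..17}. \<Sum>i\<in>?B j. ?a i)"
  proof (rule sum.cong[OF refl])
    fix j
    have "?L \<inter> ?B j = ?B j" by auto
    then show "(\<Sum>i\<in>?L. if i \<in> ?B j then ?a i else 0) = (\<Sum>i\<in>?B j. ?a i)"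
      using sum.inter_restrict[of ?L ?a "?B j"] fin by simp
  qed
  also have "\<dots> < (\<Sum>j\<in>{-17..17::int}. 2/10^8 * \<phi>)"
  proof (rule sum_strict_mono)
    fix j :: int
    show "(\<Sum>i\<in>?B j. ?a i) < 2/10^8 * \<phi>" using neg norm_net_dir[OF e, of \<phi> j] by (auto simp: not_le)
  qed auto
  also have "\<dots> = 7/10^7 * \<phi>" by simp
  finally show False by simp
qed

section \<open>Uncovered points have boxes with large overlap\<close>

lemma compact_box: "compact (box x e D)"
proof -
  have "box x e D = cball x (1/2) \<inter> {y. \<bar>perp e \<bullet> (y - x)\<bar> \<le> D}"
    by (auto simp: box_def perp_inner dist_norm norm_minus_commute)
  moreover have "closed {y. \<bar>perp e \<bullet> (y - x)\<bar> \<le> D}" by (intro closed_Collect_le continuous_intros)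
  ultimately show ?thesis by (simp add: compact_Int_closed)
qed

lemma lmeasurable_box: "box x e D \<in> lmeasurable" by (rule lmeasurable_compact[OF compact_box])

text \<open>
  In the frame of \<open>e'\<close>, plank \<open>i\<close> is nearly horizontal and passes close to \<open>x\<close>, while plank \<open>j\<close> crosses
  the horizontal line through \<open>x\<close> with inclination at least eight times that of \<open>i\<close>.  So plank \<open>i\<close>,
  cut down to the levels it can attain in the slab, meets plank \<open>j\<close> in a parallelogram close to \<open>x\<close>, of
  area comparable to (thickness of \<open>i\<close>) times (crossing length of \<open>j\<close>).  The thickness is at least
  \<open>100\<close> times the area in the slab, whose extent along the plank is at
  most \<open>1/100\<close>.
\<close>
lemma crossing_energy:
  assumes x: "x \<in> uncovered" and e: "norm e = 1" "norm e' = 1" and \<phi>: "0 < \<phi>" "\<phi> \<le> 2"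
    and i: "i \<in> I" "\<bar>u i \<bullet> e\<bar> < \<phi>" "\<bar>u i \<bullet> e'\<bar> \<le> \<phi>/16"
    and j: "j \<in> I" "\<phi>/2 \<le> \<bar>u j \<bullet> e'\<bar>"
  defines "K \<equiv> aff x e' (\<phi> *\<^sub>R perp e') ` {q. \<bar>q$1\<bar> \<le> 3/10 \<and> \<bar>q$2\<bar> \<le> 1/40}"
  shows "800/9 * (area (P i \<inter> slab x e \<phi>) * len j x e') \<le> area (P i \<inter> P j \<inter> K)"
proof -
  \<comment> \<open>The slab lies between the levels \<open>u i \<bullet> x +/- 475/10^5 * \<phi>\<close> of plank \<open>i\<close>, because
    \<open>45/10000 * \<phi> + \<phi>/4000 = 475/10^5 * \<phi>\<close>.\<close>
  define c d where "c = max (lo i) (u i \<bullet> x - 475/10^5 * \<phi>)" and "d = min (hi i) (u i \<bullet> x + 475/10^5 * \<phi>)"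
  define \<alpha> \<beta> \<alpha>' \<beta>' where "\<alpha> = u i \<bullet> e'" and "\<beta> = u i \<bullet> perp e'" and "\<alpha>' = u j \<bullet> e'" and "\<beta>' = u j \<bullet> perp e'"
  have Slm: "slab x e \<phi> \<in> lmeasurable" using slab_area(2)[OF e(1) \<phi>(1)] by (rule lmeasurable_compact)
  have cK: "compact K"
  proof -
    have "{q::real^2. \<bar>q$1\<bar> \<le> 3/10 \<and> \<bar>q$2\<bar> \<le> 1/40} = cbox (vector [-3/10, -1/40]) (vector [3/10, 1/40])"
      by (auto simp: mem_box_cart forall_2 abs_le_iff)
    then show ?thesis unfolding K_def aff_def by (intro compact_continuous_image continuous_intros) simp_all
  qed
  have sub1: "P i \<inter> slab x e \<phi> \<subseteq> {y. c \<le> u i \<bullet> y \<and> u i \<bullet> y \<le> d \<and> perp (u i) \<bullet> x - 5/1000 \<le> perp (u i) \<bullet> y \<and> perp (u i) \<bullet> y \<le> perp (u i) \<bullet> x + 5/1000}"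
  proof
    fix y assume y: "y \<in> P i \<inter> slab x e \<phi>"
    then have sl: "norm (y - x) \<le> 5/1000" "\<bar>e \<bullet> (y - x)\<bar> \<le> 45/10000" "\<bar>det2 e (y - x)\<bar> \<le> \<phi>/4000"
      using slab_norm[OF e(1) \<phi>, of y x] by auto
    have "\<bar>u i \<bullet> (y - x)\<bar> \<le> \<bar>u i \<bullet> e\<bar> * \<bar>e \<bullet> (y - x)\<bar> + \<bar>u i \<bullet> perp e\<bar> * \<bar>det2 e (y - x)\<bar>"
      unfolding inner_frame[OF e(1), of "u i" "y - x"] by (metis abs_mult abs_triangle_ineq)
    also have "\<dots> \<le> \<phi> * (45/10000) + 1 * (\<phi>/4000)"
      using sl i(2) Cauchy_Schwarz_ineq2[of "u i" "perp e"] e unit[OF i(1)] \<phi>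
      by (intro add_mono mult_mono) auto
    also have "\<dots> = 475/10^5 * \<phi>" by simp
    finally have b1: "\<bar>u i \<bullet> (y - x)\<bar> \<le> 475/10^5 * \<phi>" .
    have b2: "\<bar>perp (u i) \<bullet> (y - x)\<bar> \<le> 5/1000"
      using Cauchy_Schwarz_ineq2[of "perp (u i)" "y - x"] sl(1) unit[OF i(1)] by simp
    show "y \<in> {y. c \<le> u i \<bullet> y \<and> u i \<bullet> y \<le> d \<and> perp (u i) \<bullet> x - 5/1000 \<le> perp (u i) \<bullet> y \<and> perp (u i) \<bullet> y \<le> perp (u i) \<bullet> x + 5/1000}"
      using y b1[unfolded abs_le_iff inner_diff_right] b2[unfolded abs_le_iff inner_diff_right]
      by (simp add: c_def d_def strip_def)
  qed
  show ?thesis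
  proof (cases "c \<le> d")
    case False
    then have "P i \<inter> slab x e \<phi> = {}" using sub1 by force
    then show ?thesis by (simp add: area_def)
  next
    case True
    have a1: "area (P i \<inter> slab x e \<phi>) \<le> (d - c) / 100"
    proof -
      have dd: "det2 (u i) (perp (u i)) = 1" by (rule det2_perp_self[OF unit[OF i(1)]])
      have le: "perp (u i) \<bullet> x - 5/1000 \<le> perp (u i) \<bullet> x + 5/1000" by simp
      have "area (P i \<inter> slab x e \<phi>) \<le> area {y. c \<le> u i \<bullet> y \<and> u i \<bullet> y \<le> d \<and> perp (u i) \<bullet> x - 5/1000 \<le> perp (u i) \<bullet> y \<and> perp (u i) \<bullet> y \<le> perp (u i) \<bullet> x + 5/1000}"
        by (rule area_mono[OF sub1 Int_closed_lmeasurable[OF closed_strip Slm]])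
           (rule lmeasurable_compact, rule parallelogram_area(2)[OF _ True le], simp add: dd)
      also have "\<dots> = (d - c) / 100"
        using parallelogram_area(1)[OF _ True le] dd by simp
      finally show ?thesis .
    qed
    have ab: "\<alpha>\<^sup>2 + \<beta>\<^sup>2 = 1" 
      using det2_sq_add_inner_sq[of e' "u i"] e unit[OF i(1)] by (simp add: \<alpha>_def \<beta>_def inner_commute[of "u i"] perp_inner add.commute)
    have al: "\<bar>\<alpha>\<bar> \<le> \<phi>/16" "\<bar>\<alpha>\<bar> \<le> 1/8" using i(3) \<phi> by (auto simp: \<alpha>_def)
    have be: "99/100 \<le> \<bar>\<beta>\<bar>"
    proof -
      have "\<alpha>\<^sup>2 \<le> (1/8)\<^sup>2" using al(2) by (metis abs_ge_zero power2_abs power_mono)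
      then have "(99/100)\<^sup>2 \<le> \<beta>\<^sup>2" using ab by (simp add: power2_eq_square)
      then show ?thesis by (metis abs_le_square_iff abs_of_nonneg divide_nonneg_nonneg zero_le_numeral)
    qed
    have be1: "\<bar>\<beta>\<bar> \<le> 1" "\<bar>\<beta>'\<bar> \<le> 1"
      using Cauchy_Schwarz_ineq2[of "u i" "perp e'"] Cauchy_Schwarz_ineq2[of "u j" "perp e'"] e unit[OF i(1)] unit[OF j(1)]
      by (auto simp: \<beta>_def \<beta>'_def)
    have al': "\<phi>/2 \<le> \<bar>\<alpha>'\<bar>" "\<alpha>' \<noteq> 0" using j(2) \<phi> by (auto simp: \<alpha>'_def)
    have det: "det2 (u j) (u i) = \<alpha>' * \<beta> - \<beta>' * \<alpha>"
      using det2_frame[OF e(2), of "u j" "u i"] by (simp add: \<alpha>_def \<beta>_def \<alpha>'_def \<beta>'_def perp_inner[symmetric] inner_commute mult.commute)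
    have det_le: "\<bar>det2 (u j) (u i)\<bar> \<le> 9/8 * \<bar>\<alpha>'\<bar>"
    proof -
      have "\<bar>det2 (u j) (u i)\<bar> \<le> \<bar>\<alpha>'\<bar> * \<bar>\<beta>\<bar> + \<bar>\<beta>'\<bar> * \<bar>\<alpha>\<bar>" unfolding det by (metis abs_mult abs_triangle_ineq4)
      also have "\<dots> \<le> \<bar>\<alpha>'\<bar> * 1 + 1 * (\<phi>/16)" using be1 al by (intro add_mono mult_mono) auto
      also have "\<dots> \<le> 9/8 * \<bar>\<alpha>'\<bar>" using al' by simp
      finally show ?thesis .
    qed
    have det_pos: "det2 (u j) (u i) \<noteq> 0"
    proof -
      have "\<bar>\<alpha>' * \<beta>\<bar> \<ge> \<bar>\<alpha>'\<bar> * (99/100)" unfolding abs_mult using be by (intro mult_left_mono) auto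
      moreover have "\<bar>\<beta>' * \<alpha>\<bar> \<le> 1 * (\<phi>/16)" unfolding abs_mult using be1 al by (intro mult_mono) auto
      ultimately have "\<bar>\<beta>' * \<alpha>\<bar> < \<bar>\<alpha>' * \<beta>\<bar>" using al' \<phi> by simp
      then show ?thesis unfolding det by auto
    qed
    let ?C = "crossing (P j) x e' (-1/4) (1/4)"
    have ue: "u j \<bullet> e' \<noteq> 0" using al' by (simp add: \<alpha>'_def)
    then obtain a b where C: "?C = {a..b}" using crossing_interval by blast
    let ?F = "{y. (u j \<bullet> (y - x)) / (u j \<bullet> e') \<in> ?C \<and> c \<le> u i \<bullet> y \<and> u i \<bullet> y \<le> d}"
    note F = crossing_parallelogram[OF ue det_pos C True, of x]
    have "?F \<subseteq> P i \<inter> P j \<inter> K"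
    proof
      fix y assume y: "y \<in> ?F"
      define s where "s = (u j \<bullet> (y - x)) / \<alpha>'"
      define s' t' where "s' = e' \<bullet> (y - x)" and "t' = det2 e' (y - x)"
      have sC: "s \<in> ?C" using y by (simp add: s_def \<alpha>'_def)
      then have s: "\<bar>s\<bar> \<le> 1/4" by (auto simp: crossing_def)
      have uj: "u j \<bullet> (y - x) = s * \<alpha>'" using al' by (simp add: s_def)
      have "u j \<bullet> y = u j \<bullet> (x + s *\<^sub>R e')" using uj by (simp add: inner_diff_right inner_add_right \<alpha>'_def)
      then have yj: "y \<in> P j" using sC by (simp add: crossing_def strip_def)
      have yi: "y \<in> P i" using y by (simp add: c_def d_def strip_def)
      have p: "\<bar>u i \<bullet> (y - x)\<bar> \<le> 475/10^5 * \<phi>" 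
        unfolding abs_le_iff inner_diff_right using y by (auto simp: c_def d_def)
      have e1: "u i \<bullet> (y - x) = \<alpha> * s' + \<beta> * t'" "s * \<alpha>' = \<alpha>' * s' + \<beta>' * t'"
        using inner_frame[OF e(2), of "u i" "y - x"] inner_frame[OF e(2), of "u j" "y - x"] uj
        unfolding \<alpha>_def \<beta>_def \<alpha>'_def \<beta>'_def s'_def t'_def by linarith+
      have "\<bar>\<beta>\<bar> * \<bar>t'\<bar> = \<bar>u i \<bullet> (y - x) - \<alpha> * s'\<bar>" using e1 by (simp add: abs_mult[symmetric])
      also have "\<dots> \<le> \<bar>u i \<bullet> (y - x)\<bar> + \<bar>\<alpha>\<bar> * \<bar>s'\<bar>" by (metis abs_mult abs_triangle_ineq4)
      also have "\<dots> \<le> 475/10^5 * \<phi> + \<phi>/16 * \<bar>s'\<bar>" using p al by (intro add_mono mult_right_mono) auto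
      finally have t1: "99/100 * \<bar>t'\<bar> \<le> 475/10^5 * \<phi> + \<phi>/16 * \<bar>s'\<bar>"
        using mult_right_mono[OF be, of "\<bar>t'\<bar>"] by simp
      define \<tau> where "\<tau> = \<bar>t'\<bar> / \<phi>"
      have t: "\<bar>t'\<bar> = \<tau> * \<phi>" "0 \<le> \<tau>" using \<phi> by (auto simp: \<tau>_def)
      have "99/100 * \<tau> * \<phi> \<le> (475/10^5 + \<bar>s'\<bar>/16) * \<phi>" using t1 by (simp add: t algebra_simps)
      then have t2: "99/100 * \<tau> \<le> 475/10^5 + \<bar>s'\<bar>/16" using \<phi>(1) by (rule mult_right_le_imp_le)
      have "\<alpha>' * (s' - s) = - \<beta>' * t'" using e1(2) by (simp add: algebra_simps)
      then have "\<bar>\<alpha>'\<bar> * \<bar>s' - s\<bar> = \<bar>\<beta>'\<bar> * \<bar>t'\<bar>" by (metis abs_minus_cancel abs_mult mult_minus_left)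
      also have "\<dots> \<le> 1 * \<bar>t'\<bar>" using be1 by (intro mult_right_mono) auto
      finally have "\<phi>/2 * \<bar>s' - s\<bar> \<le> \<tau> * \<phi>" using mult_right_mono[OF al'(1), of "\<bar>s' - s\<bar>"] t by simp
      then have "\<bar>s' - s\<bar> * \<phi> \<le> (2 * \<tau>) * \<phi>" by (simp add: algebra_simps)
      then have "\<bar>s' - s\<bar> \<le> 2 * \<tau>" using \<phi> by simp
      then have s2: "\<bar>s'\<bar> \<le> 1/4 + 2 * \<tau>" using s by simp
      have \<tau>: "\<tau> \<le> 1/40" "\<bar>s'\<bar> \<le> 3/10" using t2 s2 by simp_all
      have "y = aff x e' (\<phi> *\<^sub>R perp e') (vector [s', t'/\<phi>])"
        using frame_expand[OF e(2), of "y - x"] \<phi> by (simp add: aff_def s'_def t'_def algebra_simps)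
      moreover have "\<bar>t'/\<phi>\<bar> \<le> 1/40" using \<tau>(1) \<phi> by (simp add: \<tau>_def abs_divide)
      ultimately have "y \<in> K" using \<tau> unfolding K_def by (intro image_eqI[of _ _ "vector [s', t'/\<phi>]"]) auto
      then show "y \<in> P i \<inter> P j \<inter> K" using yi yj by simp
    qed
    then have a2: "area ?F \<le> area (P i \<inter> P j \<inter> K)"
      by (rule area_mono[OF _ lmeasurable_compact[OF F(2)] lmeasurable_compact[OF closed_Int_compact[OF closed_Int[OF closed_strip closed_strip] cK]]])
    have "area ?F = len j x e' * (d - c) * \<bar>\<alpha>'\<bar> / \<bar>det2 (u j) (u i)\<bar>"
      using F(1) by (simp add: len_def \<alpha>'_def)
    also have "\<dots> \<ge> len j x e' * (d - c) * \<bar>\<alpha>'\<bar> / (9/8 * \<bar>\<alpha>'\<bar>)"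
      using det_le det_pos True len_nonneg al'(2) by (intro divide_left_mono) auto
    finally have "len j x e' * (d - c) * \<bar>\<alpha>'\<bar> / (9/8 * \<bar>\<alpha>'\<bar>) \<le> area ?F" .
    moreover have "X * \<bar>\<alpha>'\<bar> / (9/8 * \<bar>\<alpha>'\<bar>) = 8/9 * X" for X using al'(2) by simp
    ultimately have "8/9 * (len j x e' * (d - c)) \<le> area ?F" by metis
    moreover have "area (P i \<inter> slab x e \<phi>) * len j x e' \<le> (d - c) / 100 * len j x e'"
      using a1 len_nonneg by (intro mult_right_mono) auto
    ultimately show ?thesis using a2 by (simp add: mult.commute)
  qed
qed

text \<open>
  Let \<open>e'\<close> be the direction of the bundle of flat planks.  Summing \<open>crossing_energy\<close> over the bundle
  \<open>L'\<close> and the planks \<open>V'\<close> that are steep with respect to \<open>e'\<close> gives pairwise intersections of total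
  area at least \<open>\<phi> / 10^10\<close>.  Stretching the direction orthogonal to \<open>e'\<close> by \<open>1/\<phi>\<close> turns the box into
  a set of unit size and makes the two families transversal, because inclinations of at most
  \<open>\<phi>/16\<close> and at least \<open>\<phi>/2\<close> become slopes of at most \<open>1/16\<close> and at least \<open>1/2\<close>.  Then
  \<open>transversal_overlap\<close> applies.
\<close>
lemma heavy_box:
  assumes x: "x \<in> uncovered" and e: "norm e = 1" and \<phi>: "0 < \<phi>" "\<phi> \<le> 2" and m: "mass x e \<phi> \<le> 1/10000"
    and m': "\<And>e'. norm e' = 1 \<Longrightarrow> 1/10000 < mass x e' (\<phi>/2)"
  shows "\<phi> / 10^17 \<le> overlap I P (box x e \<phi>)"
proof -
  obtain e' where e': "norm e' = 1"
    and L: "2/10^8 * \<phi> \<le> (\<Sum>i | i \<in> I \<and> \<bar>u i \<bullet> e\<bar> < \<phi> \<and> \<bar>u i \<bullet> e'\<bar> \<le> \<phi>/16. area (P i \<inter> slab x e \<phi>))"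
    using bundle_exists[OF x e \<phi> m] by (elim exE conjE)
  define L' V' where "L' = {i. i \<in> I \<and> \<bar>u i \<bullet> e\<bar> < \<phi> \<and> \<bar>u i \<bullet> e'\<bar> \<le> \<phi>/16}"
    and "V' = {j. j \<in> I \<and> \<phi>/2 \<le> \<bar>u j \<bullet> e'\<bar>}"
  have LV: "L' \<subseteq> I" "V' \<subseteq> I" by (auto simp: L'_def V'_def)
  define d' where "d' = \<phi> *\<^sub>R perp e'"
  define K where "K = {q::real^2. \<bar>q$1\<bar> \<le> 3/10 \<and> \<bar>q$2\<bar> \<le> 1/40}"
  define W where "W = {q::real^2. \<bar>q$1\<bar> \<le> 7/20 \<and> \<bar>q$2\<bar> \<le> 3/40}"
  have cK: "compact K"
  proof -
    have "K = cbox (vector [-3/10, -1/40]) (vector [3/10, 1/40])"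
      by (auto simp: K_def mem_box_cart forall_2 abs_le_iff)
    then show ?thesis by simp
  qed
  have cW: "compact W"
  proof -
    have "W = cbox (vector [-7/20, -3/40]) (vector [7/20, 3/40])"
      by (auto simp: W_def mem_box_cart forall_2 abs_le_iff)
    then show ?thesis by simp
  qed
  have KW: "square z (1/20) \<subseteq> W" if z: "z \<in> K" for z
  proof
    fix y assume y: "y \<in> square z (1/20)"
    have "\<bar>y$1\<bar> \<le> \<bar>z$1\<bar> + \<bar>y$1 - z$1\<bar>" "\<bar>y$2\<bar> \<le> \<bar>z$2\<bar> + \<bar>y$2 - z$2\<bar>"
      by linarith+
    moreover have "\<bar>z$1\<bar> \<le> 3/10" "\<bar>z$2\<bar> \<le> 1/40" using z by (simp_all add: K_def)
    moreover have "\<bar>y$1 - z$1\<bar> \<le> 1/20" "\<bar>y$2 - z$2\<bar> \<le> 1/20" using y by (simp_all add: square_def)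
    ultimately have "\<bar>y$1\<bar> \<le> 7/20" "\<bar>y$2\<bar> \<le> 3/40" by linarith+
    then show "y \<in> W" by (simp add: W_def)
  qed
  have dd: "det2 e' d' = \<phi>" by (simp add: d'_def det2_linear det2_perp_self[OF e'])
  \<comment> \<open>The constant is below \<open>800/9\<close> times the area of the bundle times the mass across it.\<close>
  have E: "1/10^10 * \<phi> \<le> (\<Sum>i\<in>L'. \<Sum>j\<in>V'. area (P i \<inter> P j \<inter> aff x e' d' ` K))"
  proof -
    have "1/10^10 * \<phi> \<le> 800/9 * ((2/10^8 * \<phi>) * (1/10000))" using \<phi> by simp
    also have "\<dots> \<le> 800/9 * ((\<Sum>i\<in>L'. area (P i \<inter> slab x e \<phi>)) * (\<Sum>j\<in>V'. len j x e'))"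
      using L m'[OF e'] \<phi> by (intro mult_left_mono mult_mono) (auto simp: L'_def V'_def mass_def intro!: sum_nonneg)
    also have "\<dots> = (\<Sum>i\<in>L'. \<Sum>j\<in>V'. 800/9 * (area (P i \<inter> slab x e \<phi>) * len j x e'))"
      by (simp only: sum_product) (simp only: sum_distrib_left)
    also have "\<dots> \<le> (\<Sum>i\<in>L'. \<Sum>j\<in>V'. area (P i \<inter> P j \<inter> aff x e' d' ` K))"
      unfolding d'_def K_def
      by (intro sum_mono crossing_energy[OF x e e' \<phi>]) (auto simp: L'_def V'_def)
    finally show ?thesis .
  qed
  \<comment> \<open>In the stretched coordinates plank \<open>i\<close> is a strip with normal \<open>v i\<close>, which has to be normalised.\<close>
  define v where "v i = (vector [u i \<bullet> e', \<phi> * (u i \<bullet> perp e')] :: real^2)" for i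
  have ab: "(u i \<bullet> e')\<^sup>2 + (u i \<bullet> perp e')\<^sup>2 = 1" if "i \<in> I" for i
    using det2_sq_add_inner_sq[of e' "u i"] e' unit[OF that] by (simp add: inner_commute[of "u i"] perp_inner add.commute)
  have nv: "(norm (v i))\<^sup>2 = (u i \<bullet> e')\<^sup>2 + \<phi>\<^sup>2 * (u i \<bullet> perp e')\<^sup>2" for i
    by (simp add: norm2_sq v_def power_mult_distrib)
  have v0: "0 < norm (v i)" if "i \<in> I" for i
  proof (rule ccontr)
    assume "\<not> ?thesis"
    then have "(norm (v i))\<^sup>2 = 0" by simp
    then have "(u i \<bullet> e')\<^sup>2 = 0 \<and> \<phi>\<^sup>2 * (u i \<bullet> perp e')\<^sup>2 = 0" unfolding nv by (simp only: sum_power2_eq_zero_iff power_mult_distrib[symmetric]) simp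
    then show False using ab[OF that] \<phi> by simp
  qed
  define n where "n i = (1 / norm (v i)) *\<^sub>R v i" for i
  define lo' hi' where "lo' i = (lo i - u i \<bullet> x) / norm (v i)" and "hi' i = (hi i - u i \<bullet> x) / norm (v i)" for i
  have st: "aff x e' d' -` P i = strip (n i) (lo' i) (hi' i)" if "i \<in> I" for i
    using v0[OF that] unfolding aff_vimage_strip d'_def
    by (simp add: strip_def n_def lo'_def hi'_def v_def[symmetric] divide_le_cancel)
  have trans: "1/3 \<le> \<bar>det2 (n i) (n j)\<bar>" if ij: "i \<in> L'" "j \<in> V'" for i j
  proof -
    define \<alpha> \<beta> \<alpha>' \<beta>' where "\<alpha> = u i \<bullet> e'" and "\<beta> = u i \<bullet> perp e'" and "\<alpha>' = u j \<bullet> e'" and "\<beta>' = u j \<bullet> perp e'"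
    have I: "i \<in> I" "j \<in> I" using ij LV by auto
    have al: "\<bar>\<alpha>\<bar> \<le> \<phi>/16" "\<bar>\<alpha>\<bar> \<le> 1/8" "\<phi>/2 \<le> \<bar>\<alpha>'\<bar>" using ij \<phi> by (auto simp: L'_def V'_def \<alpha>_def \<alpha>'_def)
    have a1: "\<alpha>\<^sup>2 + \<beta>\<^sup>2 = 1" "\<alpha>'\<^sup>2 + \<beta>'\<^sup>2 = 1" using ab I by (auto simp: \<alpha>_def \<beta>_def \<alpha>'_def \<beta>'_def)
    have bsq: "\<beta>\<^sup>2 \<le> 1" "\<beta>'\<^sup>2 \<le> 1" using a1 zero_le_power2[of \<alpha>] zero_le_power2[of \<alpha>'] by linarith+
    then have be1: "\<bar>\<beta>\<bar> \<le> 1" "\<bar>\<beta>'\<bar> \<le> 1" by (simp_all add: abs_square_le_1)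
    have be: "99/100 \<le> \<bar>\<beta>\<bar>"
    proof -
      have "\<alpha>\<^sup>2 \<le> (1/8)\<^sup>2" using al(2) by (metis abs_ge_zero power2_abs power_mono)
      then have "(99/100)\<^sup>2 \<le> \<beta>\<^sup>2" using a1 by (simp add: power2_eq_square)
      then show ?thesis by (metis abs_le_square_iff abs_of_nonneg divide_nonneg_nonneg zero_le_numeral)
    qed
    have "det2 (v i) (v j) = \<phi> * (\<alpha> * \<beta>' - \<beta> * \<alpha>')"
      by (simp add: det2_def v_def \<alpha>_def \<beta>_def \<alpha>'_def \<beta>'_def algebra_simps)
    moreover have "86/100 * \<bar>\<alpha>'\<bar> \<le> \<bar>\<alpha> * \<beta>' - \<beta> * \<alpha>'\<bar>"
    proof -
      have "\<bar>\<beta> * \<alpha>'\<bar> \<ge> 99/100 * \<bar>\<alpha>'\<bar>" unfolding abs_mult using be by (intro mult_right_mono) auto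
      moreover have "\<bar>\<alpha> * \<beta>'\<bar> \<le> \<phi>/16 * 1" unfolding abs_mult using be1 al by (intro mult_mono) auto
      ultimately show ?thesis using al(3) by linarith
    qed
    ultimately have D: "\<phi> * (86/100 * \<bar>\<alpha>'\<bar>) \<le> \<bar>det2 (v i) (v j)\<bar>"
      using \<phi> by (simp add: abs_mult)
    have "(norm (v i))\<^sup>2 \<le> (101/100 * \<phi>)\<^sup>2"
    proof -
      have "\<alpha>\<^sup>2 \<le> (\<phi>/16)\<^sup>2" using al(1) by (metis abs_ge_zero power2_abs power_mono)
      moreover have "\<phi>\<^sup>2 * \<beta>\<^sup>2 \<le> \<phi>\<^sup>2 * 1" using bsq by (intro mult_left_mono) auto
      moreover have "(101/100 * \<phi>)\<^sup>2 = 10201/10000 * \<phi>\<^sup>2" "(\<phi>/16)\<^sup>2 = \<phi>\<^sup>2/256"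
        by (simp_all add: power_mult_distrib power_divide)
      ultimately show ?thesis using zero_le_power2[of \<phi>]
        unfolding nv \<alpha>_def[symmetric] \<beta>_def[symmetric] by linarith
    qed
    then have n1: "norm (v i) \<le> 101/100 * \<phi>" using \<phi> by (simp add: power2_le_iff_abs_le)
    have "(norm (v j))\<^sup>2 \<le> (9/4 * \<bar>\<alpha>'\<bar>)\<^sup>2"
    proof -
      have "\<phi>\<^sup>2 \<le> (2 * \<bar>\<alpha>'\<bar>)\<^sup>2" using al(3) \<phi> by (intro power_mono) auto
      moreover have "\<phi>\<^sup>2 * \<beta>'\<^sup>2 \<le> \<phi>\<^sup>2 * 1" using bsq by (intro mult_left_mono) auto
      moreover have "(9/4 * \<bar>\<alpha>'\<bar>)\<^sup>2 = 81/16 * \<alpha>'\<^sup>2" "(2 * \<bar>\<alpha>'\<bar>)\<^sup>2 = 4 * \<alpha>'\<^sup>2"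
        by (simp_all add: power_mult_distrib power_divide)
      ultimately show ?thesis using zero_le_power2[of \<alpha>']
        unfolding nv \<alpha>'_def[symmetric] \<beta>'_def[symmetric] by linarith
    qed
    then have n2: "norm (v j) \<le> 9/4 * \<bar>\<alpha>'\<bar>" by (simp add: power2_le_iff_abs_le)
    have "1/3 * (norm (v i) * norm (v j)) \<le> 1/3 * ((101/100 * \<phi>) * (9/4 * \<bar>\<alpha>'\<bar>))"
      using n1 n2 \<phi> by (intro mult_left_mono mult_mono) auto
    also have "\<dots> \<le> \<phi> * (86/100 * \<bar>\<alpha>'\<bar>)" using \<phi> by (simp add: mult.commute mult.left_commute)
    also note D
    finally have "1/3 \<le> \<bar>det2 (v i) (v j)\<bar> / (norm (v i) * norm (v j))"
      using v0[OF I(1)] v0[OF I(2)] by (simp add: pos_le_divide_eq)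
    then show ?thesis by (simp add: n_def det2_linear abs_mult mult.commute)
  qed
  define Q where "Q i = strip (n i) (lo' i) (hi' i)" for i
  have ovQ: "overlap I P (aff x e' d' ` W) = \<phi> * overlap I Q W"
  proof -
    have "overlap I P (aff x e' d' ` W) = \<bar>det2 e' d'\<bar> * overlap I (\<lambda>i. aff x e' d' -` P i) W"
      by (rule overlap_aff[OF fin cl lmeasurable_compact[OF cW]]) (use dd \<phi> in auto)
    also have "overlap I (\<lambda>i. aff x e' d' -` P i) W = overlap I Q W"
      unfolding overlap_def using st by (simp add: Q_def)
    finally show ?thesis using dd \<phi> by simp
  qed
  have EQ: "1/10^10 \<le> (\<Sum>i\<in>L'. \<Sum>j\<in>V'. area (Q i \<inter> Q j \<inter> K))"
  proof -
    have "area (P i \<inter> P j \<inter> aff x e' d' ` K) = \<phi> * area (Q i \<inter> Q j \<inter> K)" if "i \<in> L'" "j \<in> V'" for i j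
    proof -
      have "P i \<inter> P j \<inter> aff x e' d' ` K = aff x e' d' ` (Q i \<inter> Q j \<inter> K)"
        using st that LV unfolding Q_def by blast
      moreover have "Q i \<inter> Q j \<inter> K \<in> lmeasurable"
        unfolding Q_def by (intro lmeasurable_compact closed_Int_compact closed_Int closed_strip cK)
      ultimately show ?thesis using area_aff_image(1) dd \<phi> by simp
    qed
    then have "(\<Sum>i\<in>L'. \<Sum>j\<in>V'. area (P i \<inter> P j \<inter> aff x e' d' ` K)) = (\<Sum>i\<in>L'. \<Sum>j\<in>V'. \<phi> * area (Q i \<inter> Q j \<inter> K))"
      by (intro sum.cong refl) auto
    also have "\<dots> = \<phi> * (\<Sum>i\<in>L'. \<Sum>j\<in>V'. area (Q i \<inter> Q j \<inter> K))" by (simp only: sum_distrib_left)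
    finally show ?thesis using E \<phi> by simp
  qed
  \<comment> \<open>Either the overlap is small and \<open>transversal_overlap\<close> applies, or it is large anyway.\<close>
  have "1/10^17 \<le> overlap I Q W"
  proof (cases "overlap I Q W < (1/20)\<^sup>2 / 100")
    case True
    have "(\<Sum>i\<in>L'. \<Sum>j\<in>V'. area (Q i \<inter> Q j \<inter> K)) \<le> (1024 + 1440000 / (1/3)) * overlap I Q W"
      unfolding Q_def
    proof (rule transversal_overlap[OF fin LV _ _ _ trans cK _ lmeasurable_compact[OF cW] KW])
      show "norm (n i) = 1" if "i \<in> I" for i using v0[OF that] by (simp add: n_def)
      show "lo' i < hi' i" if "i \<in> I" for i
        using v0[OF that] wide[OF that] by (simp add: lo'_def hi'_def divide_strict_right_mono)
      show "overlap I (\<lambda>i. strip (n i) (lo' i) (hi' i)) W < (1/20)\<^sup>2 / 100" using True by (simp add: Q_def[abs_def])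
    qed auto
    then show ?thesis using EQ by simp
  next
    case False
    then show ?thesis by (simp add: power2_eq_square)
  qed
  then have "\<phi> * (1/10^17) \<le> overlap I P (aff x e' d' ` W)" unfolding ovQ using \<phi> by (intro mult_left_mono) auto
  also have "\<dots> \<le> overlap I P (box x e \<phi>)"
  proof (rule overlap_mono[where I=I and P=P, OF fin cl])
    have "L' \<noteq> {}"
    proof
      assume "L' = {}"
      then have "2/10^8 * \<phi> \<le> 0" using L unfolding L'_def[symmetric] by simp
      then show False using \<phi> by simp
    qed
    then obtain i where i: "i \<in> I" "\<bar>u i \<bullet> e\<bar> < \<phi>" "\<bar>u i \<bullet> e'\<bar> \<le> \<phi>/16" by (auto simp: L'_def)
    have dete: "\<bar>det2 e e'\<bar> \<le> 17/16 * \<phi>" using abs_det2_triangle[OF unit[OF i(1)] e e'] i by simp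
    show "aff x e' d' ` W \<subseteq> box x e \<phi>"
    proof
      fix y assume "y \<in> aff x e' d' ` W"
      then obtain q where q: "\<bar>q$1\<bar> \<le> 7/20" "\<bar>q$2\<bar> \<le> 3/40" "y = aff x e' d' q" by (auto simp: W_def)
      have yx: "y - x = q$1 *\<^sub>R e' + (q$2 * \<phi>) *\<^sub>R perp e'" by (simp add: q(3) aff_def d'_def)
      have "norm (y - x) \<le> \<bar>q$1\<bar> + \<bar>q$2 * \<phi>\<bar>"
        unfolding yx using norm_triangle_ineq[of "q$1 *\<^sub>R e'" "(q$2 * \<phi>) *\<^sub>R perp e'"] e' by simp
      also have "\<dots> \<le> 7/20 + 3/40 * 2" unfolding abs_mult using q \<phi> by (intro add_mono mult_mono) auto
      finally have 1: "norm (y - x) \<le> 1/2" by simp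
      have "\<bar>det2 e (y - x)\<bar> \<le> \<bar>q$1\<bar> * \<bar>det2 e e'\<bar> + \<bar>q$2 * \<phi>\<bar> * \<bar>det2 e (perp e')\<bar>"
        unfolding yx det2_linear by (metis abs_mult abs_triangle_ineq)
      also have "\<dots> \<le> 7/20 * (17/16 * \<phi>) + (3/40 * \<phi>) * 1"
        using q \<phi> dete abs_det2_le[of e "perp e'"] e e' unfolding abs_mult by (intro add_mono mult_mono) auto
      also have "\<dots> \<le> \<phi>" using \<phi> by simp
      finally show "y \<in> box x e \<phi>" using 1 by (simp add: box_def)
    qed
    show "aff x e' d' ` W \<in> lmeasurable" by (rule area_aff_image(2)[OF lmeasurable_compact[OF cW]])
    show "box x e \<phi> \<in> lmeasurable" by (rule lmeasurable_box)
  qed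
  finally show ?thesis by simp
qed

end

section \<open>Planks squeezed through a wedge\<close>

lemma mult_between_ends:
  fixes a s l h :: real
  assumes "l \<le> s" "s \<le> h"
  shows "min (a * l) (a * h) \<le> a * s" "a * s \<le> max (a * l) (a * h)"
proof -
  have "min (a * l) (a * h) \<le> a * s \<and> a * s \<le> max (a * l) (a * h)"
  proof (cases "0 \<le> a")
    case True
    then show ?thesis using mult_left_mono[OF assms(1) True] mult_left_mono[OF assms(2) True]
      by (simp only: min_le_iff_disj le_max_iff_disj) simp
  next
    case False
    then have "a \<le> 0" by simp
    then show ?thesis using mult_left_mono_neg[OF assms(1)] mult_left_mono_neg[OF assms(2)]
      by (simp only: min_le_iff_disj le_max_iff_disj) simp
  qed
  then show "min (a * l) (a * h) \<le> a * s" "a * s \<le> max (a * l) (a * h)" by auto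
qed

text \<open>
  In the quadrant, consider the line \<open>\<alpha> * q + \<alpha>' * q' = c\<close> through a point near the outer edge
  \<open>q + q' = \<tau>\<close>.  It meets the axes at \<open>c/\<alpha>\<close> and \<open>c/\<alpha>'\<close>.  Either one of these crossings lies between
  \<open>3/5 * \<tau>\<close> and \<open>\<tau>\<close>, or the line stays inside the quadrant from the edge inwards to \<open>q + q' = 3/5 * \<tau>\<close>.
  In the first case the line is steep with respect to the axis it crosses: if it had coefficient less
  than \<open>D\<close> there, the other coefficient would exceed \<open>20 * D\<close>, and the line could not be \<open>\<tau>/20\<close> away
  from the axis after moving by at most \<open>\<tau>\<close> along it.
\<close>
lemma wedge_trichotomy_aux:
  fixes \<alpha> \<alpha>' q q' \<tau> D c :: real
  assumes \<tau>: "0 < \<tau>" and D: "0 < D" and c: "c = \<alpha> * q + \<alpha>' * q'"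
    and q: "9/10 * \<tau> \<le> q + q'" "q + q' \<le> \<tau>" "\<tau>/20 \<le> q" "\<tau>/20 \<le> q'"
    and flat: "\<bar>\<alpha>\<bar> < D \<longrightarrow> 20 * D < \<bar>\<alpha>'\<bar>" "\<bar>\<alpha>'\<bar> < D \<longrightarrow> 20 * D < \<bar>\<alpha>\<bar>"
    and le: "\<alpha> \<le> \<alpha>'"
  shows "(\<exists>s. 3/5 * \<tau> \<le> s \<and> s \<le> \<tau> \<and> c = \<alpha> * s \<and> D \<le> \<bar>\<alpha>\<bar>) \<or>
    (\<exists>s. 3/5 * \<tau> \<le> s \<and> s \<le> \<tau> \<and> c = \<alpha>' * s \<and> D \<le> \<bar>\<alpha>'\<bar>) \<or>
    (\<alpha> \<noteq> \<alpha>' \<and> max (\<alpha> * (3/5 * \<tau>)) (\<alpha> * \<tau>) \<le> c \<and> c \<le> min (\<alpha>' * (3/5 * \<tau>)) (\<alpha>' * \<tau>))"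
proof -
  have between: "\<exists>s. 3/5 * \<tau> \<le> s \<and> s \<le> \<tau> \<and> c = a * s"
    if "min (a * (3/5 * \<tau>)) (a * \<tau>) \<le> c" "c \<le> max (a * (3/5 * \<tau>)) (a * \<tau>)" for a
  proof (cases "a = 0")
    case True
    then show ?thesis using that \<tau> by (intro exI[of _ \<tau>]) auto
  next
    case False
    show ?thesis
    proof (intro exI[of _ "c / a"] conjI)
      show "c = a * (c / a)" using False by simp
      show "3/5 * \<tau> \<le> c / a" "c / a \<le> \<tau>"
      proof -
        consider "0 < a" | "a < 0" using False by linarith
        then show "3/5 * \<tau> \<le> c / a" "c / a \<le> \<tau>"
        proof (atomize(full), cases)
          case 1
          then have "a * (3/5 * \<tau>) \<le> a * \<tau>" using \<tau> by (intro mult_left_mono) auto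
          then show "3/5 * \<tau> \<le> c / a \<and> c / a \<le> \<tau>" using that 1
            by (simp add: pos_le_divide_eq pos_divide_le_eq mult.commute)
        next
          case 2
          then have "a * \<tau> \<le> a * (3/5 * \<tau>)" using \<tau> by (intro mult_left_mono_neg) auto
          then show "3/5 * \<tau> \<le> c / a \<and> c / a \<le> \<tau>" using that 2
            by (simp add: neg_le_divide_eq neg_divide_le_eq mult.commute)
        qed
      qed
    qed
  qed
  have "3/5 * \<tau> \<le> q + q'" using q \<tau> by simp
  note mid = mult_between_ends[OF this q(2)]
  have c1: "\<alpha> * (q + q') \<le> c" and c2: "c \<le> \<alpha>' * (q + q')"
  proof -
    have "c = \<alpha> * (q + q') + (\<alpha>' - \<alpha>) * q'" "c = \<alpha>' * (q + q') - (\<alpha>' - \<alpha>) * q" by (simp_all add: c algebra_simps)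
    moreover have "0 \<le> (\<alpha>' - \<alpha>) * q'" "0 \<le> (\<alpha>' - \<alpha>) * q" using le q \<tau> by simp_all
    ultimately show "\<alpha> * (q + q') \<le> c" "c \<le> \<alpha>' * (q + q')" by linarith+
  qed
  have side: False if "0 \<le> s" "s \<le> \<tau>" "a * s = a * p + a' * p'" "\<tau>/20 \<le> p'" "0 \<le> p" "p \<le> \<tau>" "\<bar>a\<bar> < D" "20 * D < \<bar>a'\<bar>" for s a a' p p'
  proof -
    have "a' * p' = a * (s - p)" using that(3) by (simp add: algebra_simps)
    then have "\<bar>a'\<bar> * \<bar>p'\<bar> = \<bar>a\<bar> * \<bar>s - p\<bar>" by (metis abs_mult)
    also have "\<dots> \<le> D * \<tau>" using that \<tau> D by (intro mult_mono) (auto simp: abs_le_iff)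
    finally have 1: "\<bar>a'\<bar> * \<bar>p'\<bar> \<le> D * \<tau>" .
    have "20 * D * (\<tau>/20) < \<bar>a'\<bar> * \<bar>p'\<bar>" using that \<tau> D by (intro mult_less_le_imp_less) auto
    then show False using 1 by simp
  qed
  have qb: "0 \<le> q" "q \<le> \<tau>" "0 \<le> q'" "q' \<le> \<tau>" using q \<tau> by auto
  show ?thesis
  proof (cases "c \<le> max (\<alpha> * (3/5 * \<tau>)) (\<alpha> * \<tau>)")
    case True
    then obtain s where s: "3/5 * \<tau> \<le> s" "s \<le> \<tau>" "c = \<alpha> * s"
      using between[of \<alpha>] mid(1)[of \<alpha>] c1 by force
    have "D \<le> \<bar>\<alpha>\<bar>"
    proof (rule ccontr)
      assume n: "\<not> ?thesis"
      show False
        by (rule side[of s \<alpha> q \<alpha>' q']) (use s c q qb \<tau> n flat in \<open>simp_all add: not_le\<close>)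
    qed
    then show ?thesis using s by blast
  next
    case False
    show ?thesis
    proof (cases "min (\<alpha>' * (3/5 * \<tau>)) (\<alpha>' * \<tau>) \<le> c")
      case True
      then obtain s where s: "3/5 * \<tau> \<le> s" "s \<le> \<tau>" "c = \<alpha>' * s"
        using between[of \<alpha>'] mid(2)[of \<alpha>'] c2 by force
      have "D \<le> \<bar>\<alpha>'\<bar>"
      proof (rule ccontr)
        assume n: "\<not> ?thesis"
        show False
          by (rule side[of s \<alpha>' q' \<alpha> q]) (use s c q qb \<tau> n flat in \<open>simp_all add: not_le\<close>)
      qed
      then show ?thesis using s by blast
    next
      case F2: False
      have "\<alpha> \<noteq> \<alpha>'" using False F2 by (auto simp: min_def max_def split: if_splits)
      then show ?thesis using False F2 by auto
    qed
  qed
qed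

text \<open>
  The symmetric form, without an order between \<open>\<alpha>\<close> and \<open>\<alpha>'\<close>.  In the third alternative \<open>c\<close> lies
  between \<open>\<alpha> * t\<close> and \<open>\<alpha>' * t\<close> for every \<open>t\<close> from \<open>3/5 * \<tau>\<close> to \<open>\<tau>\<close>; the outer \<open>min\<close> and \<open>max\<close>
  cover both orders, the inner ones both signs of the coefficients.
\<close>
lemma wedge_trichotomy:
  fixes \<alpha> \<alpha>' q q' \<tau> D c :: real
  assumes \<tau>: "0 < \<tau>" and D: "0 < D" and c: "c = \<alpha> * q + \<alpha>' * q'"
    and q: "9/10 * \<tau> \<le> q + q'" "q + q' \<le> \<tau>" "\<tau>/20 \<le> q" "\<tau>/20 \<le> q'"
    and flat: "\<bar>\<alpha>\<bar> < D \<longrightarrow> 20 * D < \<bar>\<alpha>'\<bar>" "\<bar>\<alpha>'\<bar> < D \<longrightarrow> 20 * D < \<bar>\<alpha>\<bar>"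
  shows "(\<exists>s. 3/5 * \<tau> \<le> s \<and> s \<le> \<tau> \<and> c = \<alpha> * s \<and> D \<le> \<bar>\<alpha>\<bar>) \<or>
    (\<exists>s. 3/5 * \<tau> \<le> s \<and> s \<le> \<tau> \<and> c = \<alpha>' * s \<and> D \<le> \<bar>\<alpha>'\<bar>) \<or>
    (\<alpha> \<noteq> \<alpha>' \<and> min (max (\<alpha> * (3/5 * \<tau>)) (\<alpha> * \<tau>)) (max (\<alpha>' * (3/5 * \<tau>)) (\<alpha>' * \<tau>)) \<le> c \<and>
      c \<le> max (min (\<alpha> * (3/5 * \<tau>)) (\<alpha> * \<tau>)) (min (\<alpha>' * (3/5 * \<tau>)) (\<alpha>' * \<tau>)))"
proof (cases "\<alpha> \<le> \<alpha>'")
  case True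
  from wedge_trichotomy_aux[OF \<tau> D c q flat True] show ?thesis
    by (elim disjE) (auto intro: min.coboundedI1 max.coboundedI2)
next
  case False
  have c': "c = \<alpha>' * q' + \<alpha> * q" using c by simp
  have q2: "9/10 * \<tau> \<le> q' + q" "q' + q \<le> \<tau>" using q by auto
  have le: "\<alpha>' \<le> \<alpha>" using False by simp
  from wedge_trichotomy_aux[OF \<tau> D c' q2 q(4,3) flat(2,1) le] show ?thesis
    by (elim disjE) (auto intro: min.coboundedI2 max.coboundedI1)
qed

definition wedge_end :: "real \<Rightarrow> (real^2) set" where
  "wedge_end \<tau> = {q. 3/5 * \<tau> \<le> q$1 + q$2 \<and> q$1 + q$2 \<le> 7/10 * \<tau> \<and> 0 \<le> q$1 \<and> 0 \<le> q$2}"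

lemma compact_wedge_end: "compact (wedge_end \<tau>)" and area_wedge_end: "0 \<le> \<tau> \<Longrightarrow> area (wedge_end \<tau>) \<le> 7/100 * \<tau>\<^sup>2"
proof -
  let ?one = "vector [1, 1] :: real^2" and ?e2 = "vector [0, 1] :: real^2"
  let ?T = "{y. 3/5 * \<tau> \<le> ?one \<bullet> y \<and> ?one \<bullet> y \<le> 7/10 * \<tau> \<and> 0 \<le> ?e2 \<bullet> y \<and> ?e2 \<bullet> y \<le> 7/10 * \<tau>}"
  have sub: "wedge_end \<tau> \<subseteq> ?T" by (auto simp: wedge_end_def inner2)
  have cl: "closed (wedge_end \<tau>)"
    unfolding wedge_end_def by (intro closed_Collect_conj closed_Collect_le continuous_intros)
  have d: "det2 ?one ?e2 = 1" by (simp add: det2_def)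
  have T: "area ?T = 7/100 * \<tau>\<^sup>2 \<and> compact ?T" if "0 \<le> \<tau>"
    using parallelogram_area[of ?one ?e2 "3/5 * \<tau>" "7/10 * \<tau>" 0 "7/10 * \<tau>"] that d by (simp add: power2_eq_square)
  show c: "compact (wedge_end \<tau>)"
  proof (cases "0 \<le> \<tau>")
    case True
    have "compact (wedge_end \<tau> \<inter> ?T)" using closed_Int_compact[OF cl] T[OF True] by blast
    then show ?thesis using sub by (simp add: Int_absorb2)
  next
    case False
    then have "wedge_end \<tau> = {}" by (auto simp: wedge_end_def)
    then show ?thesis by simp
  qed
  assume "0 \<le> \<tau>"
  then show "area (wedge_end \<tau>) \<le> 7/100 * \<tau>\<^sup>2"
    using area_mono[OF sub lmeasurable_compact[OF c] lmeasurable_compact] T by metis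
qed

lemma lmeasurable_wedge_end: "wedge_end \<tau> \<in> lmeasurable"
  by (rule lmeasurable_compact[OF compact_wedge_end])

text \<open>
  Write \<open>t = q$1 + q$2\<close>.  The planks that leave the wedge through its sides cover little of the outer
  end \<open>9/10 * \<tau> \<le> t \<le> \<tau>\<close>, since they are steep there and their total crossing length is at most \<open>\<tau>/500\<close>
  on each side.  The other lines of the planks run through the wedge down to \<open>t = 3/5 * \<tau>\<close>.  A strip
  cuts equal areas out of two strips \<open>p \<le> t \<le> p + \<tau>/10\<close> of equal thickness, so these planks have in the
  inner end \<open>3/5 * \<tau> \<le> t \<le> 7/10 * \<tau>\<close> at least the total area \<open>76/1000 * \<tau>\<^sup>2\<close> that they cover in the
  outer end, although the inner end has area at most
  \<open>70/1000 * \<tau>\<^sup>2\<close>.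
\<close>
lemma wedge_squeeze:
  fixes v :: "nat \<Rightarrow> real^2" and lo hi :: "nat \<Rightarrow> real"
  defines "P \<equiv> \<lambda>i. strip (v i) (lo i) (hi i)"
  assumes fin: "finite I" and \<tau>: "0 < \<tau>" and D: "0 < D"
    and flat: "\<And>i. i \<in> I \<Longrightarrow> \<bar>v i $ 1\<bar> < D \<Longrightarrow> 20 * D < \<bar>v i $ 2\<bar>"
      "\<And>i. i \<in> I \<Longrightarrow> \<bar>v i $ 2\<bar> < D \<Longrightarrow> 20 * D < \<bar>v i $ 1\<bar>"
    and m1: "(\<Sum>i | i \<in> I \<and> D \<le> \<bar>v i $ 1\<bar>. measure lebesgue (crossing (P i) 0 (vector [1, 0]) (3/5 * \<tau>) \<tau>)) \<le> \<tau>/500"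
    and m2: "(\<Sum>i | i \<in> I \<and> D \<le> \<bar>v i $ 2\<bar>. measure lebesgue (crossing (P i) 0 (vector [0, 1]) (3/5 * \<tau>) \<tau>)) \<le> \<tau>/500"
    and cov: "\<And>q. 9/10 * \<tau> \<le> q$1 + q$2 \<Longrightarrow> q$1 + q$2 \<le> \<tau> \<Longrightarrow> \<tau>/20 \<le> q$1 \<Longrightarrow> \<tau>/20 \<le> q$2 \<Longrightarrow> \<exists>i\<in>I. q \<in> P i"
  shows "6/1000 * \<tau>\<^sup>2 \<le> overlap I P (wedge_end \<tau>)"
proof -
  define e1 e2 one where "e1 = (vector [1, 0] :: real^2)" and "e2 = (vector [0, 1] :: real^2)" and "one = (vector [1, 1] :: real^2)"
  have ip: "w \<bullet> e1 = w$1" "w \<bullet> e2 = w$2" "e1 \<bullet> w = w$1" "e2 \<bullet> w = w$2" "one \<bullet> w = w$1 + w$2" for w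
    by (simp_all add: inner2 e1_def e2_def one_def)
  have dt: "det2 w e2 = w$1" "det2 w e1 = - w$2" "det2 w one = w$1 - w$2" "one $ 1 = 1" "one $ 2 = 1" for w
    by (simp_all add: det2_def e1_def e2_def one_def)
  have clP: "\<And>i. i \<in> I \<Longrightarrow> closed (P i)" by (simp add: P_def closed_strip)
  let ?I1 = "{i. i \<in> I \<and> D \<le> \<bar>v i $ 1\<bar>}" and ?I2 = "{i. i \<in> I \<and> D \<le> \<bar>v i $ 2\<bar>}"
  let ?C1 = "\<lambda>i. crossing (P i) 0 e1 (3/5 * \<tau>) \<tau>" and ?C2 = "\<lambda>i. crossing (P i) 0 e2 (3/5 * \<tau>) \<tau>"
  \<comment> \<open>The lines of strip \<open>i\<close> that leave through the first or the second side.\<close>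
  define F1 F2 where "F1 i = {y. (v i \<bullet> (y - 0)) / (v i \<bullet> e1) \<in> ?C1 i \<and> 0 \<le> e2 \<bullet> y \<and> e2 \<bullet> y \<le> \<tau>}"
    and "F2 i = {y. (v i \<bullet> (y - 0)) / (v i \<bullet> e2) \<in> ?C2 i \<and> 0 \<le> e1 \<bullet> y \<and> e1 \<bullet> y \<le> \<tau>}" for i
  have F1: "area (F1 i) = measure lebesgue (?C1 i) * \<tau> \<and> compact (F1 i)" if "i \<in> ?I1" for i
  proof -
    have nz: "v i \<bullet> e1 \<noteq> 0" "det2 (v i) e2 \<noteq> 0" using that D by (auto simp: ip dt)
    obtain a b where C: "?C1 i = {a..b}" using crossing_interval[OF nz(1)] unfolding P_def by blast
    have "0 \<le> \<tau>" using \<tau> by simp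
    from crossing_parallelogram[OF nz C this, of 0] show ?thesis
      using nz unfolding F1_def by (simp add: ip dt)
  qed
  have F2: "area (F2 i) = measure lebesgue (?C2 i) * \<tau> \<and> compact (F2 i)" if "i \<in> ?I2" for i
  proof -
    have nz: "v i \<bullet> e2 \<noteq> 0" "det2 (v i) e1 \<noteq> 0" using that D by (auto simp: ip dt)
    obtain a b where C: "?C2 i = {a..b}" using crossing_interval[OF nz(1)] unfolding P_def by blast
    have "0 \<le> \<tau>" using \<tau> by simp
    from crossing_parallelogram[OF nz C this, of 0] show ?thesis
      using nz unfolding F2_def by (simp add: ip dt)
  qed
  \<comment> \<open>The levels \<open>c\<close> between \<open>A i\<close> and \<open>B i\<close> are those of the lines of strip \<open>i\<close> that run through to the
    inner end; \<open>R i p\<close> is the part of these lines with \<open>p \<le> t \<le> p + \<tau>/10\<close>.\<close>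
  define A B where "A i = max (lo i) (min (max (v i $ 1 * (3/5 * \<tau>)) (v i $ 1 * \<tau>)) (max (v i $ 2 * (3/5 * \<tau>)) (v i $ 2 * \<tau>)))"
    and "B i = min (hi i) (max (min (v i $ 1 * (3/5 * \<tau>)) (v i $ 1 * \<tau>)) (min (v i $ 2 * (3/5 * \<tau>)) (v i $ 2 * \<tau>)))" for i
  define Th where "Th = {i\<in>I. v i $ 1 \<noteq> v i $ 2 \<and> A i \<le> B i}"
  define R where "R i p = {y. A i \<le> v i \<bullet> y \<and> v i \<bullet> y \<le> B i \<and> p \<le> one \<bullet> y \<and> one \<bullet> y \<le> p + \<tau>/10}" for i p
  have R: "area (R i p) = (B i - A i) * (\<tau>/10) / \<bar>v i $ 1 - v i $ 2\<bar>" "compact (R i p)" if "i \<in> Th" for i p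
    using parallelogram_area[of "v i" one "A i" "B i" p "p + \<tau>/10"] that \<tau> unfolding R_def by (auto simp: dt Th_def)
  \<comment> \<open>Points at distance at least \<open>\<tau>/20\<close> from both sides: \<open>9/10 - 17/20 = 1/20\<close>.\<close>
  define M where "M = {y. 9/10 * \<tau> \<le> one \<bullet> y \<and> one \<bullet> y \<le> \<tau> \<and> \<tau>/20 \<le> e2 \<bullet> y \<and> e2 \<bullet> y \<le> 17/20 * \<tau>}"
  have M: "area M = 8/100 * \<tau>\<^sup>2" "compact M"
    using parallelogram_area[of one e2 "9/10 * \<tau>" \<tau> "\<tau>/20" "17/20 * \<tau>"] \<tau> unfolding M_def
    by (auto simp: dt power2_eq_square)
  have "M \<subseteq> (\<Union>i\<in>?I1. F1 i) \<union> (\<Union>i\<in>?I2. F2 i) \<union> (\<Union>i\<in>Th. R i (9/10 * \<tau>))"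
  proof
    fix y assume y: "y \<in> M"
    have q: "9/10 * \<tau> \<le> y$1 + y$2" "y$1 + y$2 \<le> \<tau>" "\<tau>/20 \<le> y$1" "\<tau>/20 \<le> y$2"
      using y by (auto simp: M_def ip)
    obtain i where i: "i \<in> I" "y \<in> P i" using cov[OF q] by blast
    have lh: "lo i \<le> v i \<bullet> y" "v i \<bullet> y \<le> hi i" using i(2) by (auto simp: P_def strip_def)
    have q0: "0 \<le> y$1" "0 \<le> y$2" "y$1 \<le> \<tau>" "y$2 \<le> \<tau>" using q \<tau> by auto
    have fl: "\<bar>v i $ 1\<bar> < D \<longrightarrow> 20 * D < \<bar>v i $ 2\<bar>" "\<bar>v i $ 2\<bar> < D \<longrightarrow> 20 * D < \<bar>v i $ 1\<bar>"
      using flat[OF i(1)] by auto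
    from wedge_trichotomy[OF \<tau> D inner2 q fl]
    show "y \<in> (\<Union>i\<in>?I1. F1 i) \<union> (\<Union>i\<in>?I2. F2 i) \<union> (\<Union>i\<in>Th. R i (9/10 * \<tau>))"
    proof (elim disjE exE conjE)
      fix s assume s: "3/5 * \<tau> \<le> s" "s \<le> \<tau>" "v i \<bullet> y = v i $ 1 * s" "D \<le> \<bar>v i $ 1\<bar>"
      have nz: "v i $ 1 \<noteq> 0" using s D by auto
      have "s \<in> ?C1 i" using s lh by (simp add: crossing_def P_def strip_def ip mult.commute)
      then have "y \<in> F1 i" using q0 nz by (simp add: F1_def ip s(3))
      then show ?thesis using i(1) s(4) by blast
    next
      fix s assume s: "3/5 * \<tau> \<le> s" "s \<le> \<tau>" "v i \<bullet> y = v i $ 2 * s" "D \<le> \<bar>v i $ 2\<bar>"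
      have nz: "v i $ 2 \<noteq> 0" using s D by auto
      have "s \<in> ?C2 i" using s lh by (simp add: crossing_def P_def strip_def ip mult.commute)
      then have "y \<in> F2 i" using q0 nz by (simp add: F2_def ip s(3))
      then show ?thesis using i(1) s(4) by blast
    next
      assume t: "v i $ 1 \<noteq> v i $ 2"
        "min (max (v i $ 1 * (3/5 * \<tau>)) (v i $ 1 * \<tau>)) (max (v i $ 2 * (3/5 * \<tau>)) (v i $ 2 * \<tau>)) \<le> v i \<bullet> y"
        "v i \<bullet> y \<le> max (min (v i $ 1 * (3/5 * \<tau>)) (v i $ 1 * \<tau>)) (min (v i $ 2 * (3/5 * \<tau>)) (v i $ 2 * \<tau>))"
      have AB: "A i \<le> v i \<bullet> y" "v i \<bullet> y \<le> B i" unfolding A_def B_def using t lh by (simp_all only: max.bounded_iff min.bounded_iff)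
      then have "y \<in> R i (9/10 * \<tau>)" "i \<in> Th" using q i(1) t(1) by (auto simp: R_def Th_def ip)
      then show ?thesis by blast
    qed
  qed
  then have "area M \<le> area ((\<Union>i\<in>?I1. F1 i) \<union> (\<Union>i\<in>?I2. F2 i) \<union> (\<Union>i\<in>Th. R i (9/10 * \<tau>)))"
  proof (rule area_mono)
    show "(\<Union>i\<in>?I1. F1 i) \<union> (\<Union>i\<in>?I2. F2 i) \<union> (\<Union>i\<in>Th. R i (9/10 * \<tau>)) \<in> lmeasurable"
      by (intro fmeasurable.Un fmeasurable.finite_UN) (use fin F1 F2 R in \<open>auto simp: Th_def intro: lmeasurable_compact\<close>)
  qed (rule lmeasurable_compact[OF M(2)])
  also have "\<dots> \<le> (\<Sum>i\<in>?I1. area (F1 i)) + (\<Sum>i\<in>?I2. area (F2 i)) + (\<Sum>i\<in>Th. area (R i (9/10 * \<tau>)))"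
  proof -
    have m: "(\<Union>i\<in>?I1. F1 i) \<in> lmeasurable" "(\<Union>i\<in>?I2. F2 i) \<in> lmeasurable" "(\<Union>i\<in>Th. R i (9/10 * \<tau>)) \<in> lmeasurable"
      by (rule fmeasurable.finite_UN; use fin F1 F2 R in \<open>auto simp: Th_def intro: lmeasurable_compact\<close>)+
    have "area ((\<Union>i\<in>?I1. F1 i) \<union> (\<Union>i\<in>?I2. F2 i) \<union> (\<Union>i\<in>Th. R i (9/10 * \<tau>)))
      \<le> area ((\<Union>i\<in>?I1. F1 i) \<union> (\<Union>i\<in>?I2. F2 i)) + area (\<Union>i\<in>Th. R i (9/10 * \<tau>))"
      unfolding area_def using m by (intro measure_Un_le fmeasurableD fmeasurable.Un)
    also have "area ((\<Union>i\<in>?I1. F1 i) \<union> (\<Union>i\<in>?I2. F2 i)) \<le> area (\<Union>i\<in>?I1. F1 i) + area (\<Union>i\<in>?I2. F2 i)"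
      unfolding area_def using m by (intro measure_Un_le fmeasurableD)
    also have "area (\<Union>i\<in>?I1. F1 i) \<le> (\<Sum>i\<in>?I1. area (F1 i))"
      by (rule area_UN_le) (use fin F1 in \<open>auto intro: lmeasurable_compact\<close>)
    also have "area (\<Union>i\<in>?I2. F2 i) \<le> (\<Sum>i\<in>?I2. area (F2 i))"
      by (rule area_UN_le) (use fin F2 in \<open>auto intro: lmeasurable_compact\<close>)
    also have "area (\<Union>i\<in>Th. R i (9/10 * \<tau>)) \<le> (\<Sum>i\<in>Th. area (R i (9/10 * \<tau>)))"
      by (rule area_UN_le) (use fin R in \<open>auto simp: Th_def intro: lmeasurable_compact\<close>)
    finally show ?thesis by simp
  qed
  also have "(\<Sum>i\<in>?I1. area (F1 i)) = (\<Sum>i\<in>?I1. measure lebesgue (?C1 i)) * \<tau>"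
    unfolding sum_distrib_right by (rule sum.cong[OF refl]) (use F1 in blast)
  also have "(\<Sum>i\<in>?I2. area (F2 i)) = (\<Sum>i\<in>?I2. measure lebesgue (?C2 i)) * \<tau>"
    unfolding sum_distrib_right by (rule sum.cong[OF refl]) (use F2 in blast)
  also have "(\<Sum>i\<in>?I1. measure lebesgue (?C1 i)) * \<tau> \<le> \<tau>/500 * \<tau>"
    using m1 \<tau> by (intro mult_right_mono) (auto simp: e1_def)
  also have "(\<Sum>i\<in>?I2. measure lebesgue (?C2 i)) * \<tau> \<le> \<tau>/500 * \<tau>"
    using m2 \<tau> by (intro mult_right_mono) (auto simp: e2_def)
  also have "(\<Sum>i\<in>Th. area (R i (9/10 * \<tau>))) = (\<Sum>i\<in>Th. area (R i (3/5 * \<tau>)))"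
    by (rule sum.cong[OF refl]) (simp add: R)
  finally have thr: "76/1000 * \<tau>\<^sup>2 \<le> (\<Sum>i\<in>Th. area (R i (3/5 * \<tau>)))"
    unfolding M(1) by (simp add: power2_eq_square)
  have E: "area (wedge_end \<tau>) \<le> 7/100 * \<tau>\<^sup>2" using area_wedge_end \<tau> by simp
  note Em = lmeasurable_wedge_end[of \<tau>]
  have "(\<Sum>i\<in>Th. area (R i (3/5 * \<tau>))) \<le> (\<Sum>i\<in>Th. area (P i \<inter> wedge_end \<tau>))"
  proof (rule sum_mono)
    fix i assume i: "i \<in> Th"
    have "R i (3/5 * \<tau>) \<subseteq> P i \<inter> wedge_end \<tau>"
    proof
      fix y assume y: "y \<in> R i (3/5 * \<tau>)"
      define \<alpha> \<alpha>' \<sigma> where "\<alpha> = v i $ 1" and "\<alpha>' = v i $ 2" and "\<sigma> = y$1 + y$2"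
      have \<sigma>: "3/5 * \<tau> \<le> \<sigma>" "\<sigma> \<le> \<tau>" "\<sigma> \<le> 7/10 * \<tau>" using y \<tau> by (auto simp: R_def ip \<sigma>_def)
      have ne: "\<alpha> \<noteq> \<alpha>'" using i by (simp add: Th_def \<alpha>_def \<alpha>'_def)
      have AB: "A i \<le> v i \<bullet> y" "v i \<bullet> y \<le> B i" using y by (auto simp: R_def)
      have vy: "v i \<bullet> y = \<alpha> * \<sigma> + (\<alpha>' - \<alpha>) * y$2" "v i \<bullet> y = \<alpha>' * \<sigma> + (\<alpha> - \<alpha>') * y$1"
        by (simp_all add: inner2 \<alpha>_def \<alpha>'_def \<sigma>_def algebra_simps)
      note bd = mult_between_ends[OF \<sigma>(1,2)]
      define X X' Y Y' where "X = max (\<alpha> * (3/5 * \<tau>)) (\<alpha> * \<tau>)" and "X' = max (\<alpha>' * (3/5 * \<tau>)) (\<alpha>' * \<tau>)"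
        and "Y = min (\<alpha> * (3/5 * \<tau>)) (\<alpha> * \<tau>)" and "Y' = min (\<alpha>' * (3/5 * \<tau>)) (\<alpha>' * \<tau>)"
      have b: "\<alpha> * \<sigma> \<le> X" "Y \<le> \<alpha> * \<sigma>" "\<alpha>' * \<sigma> \<le> X'" "Y' \<le> \<alpha>' * \<sigma>"
        unfolding X_def X'_def Y_def Y'_def by (rule bd)+
      have AX: "min X X' \<le> v i \<bullet> y" "v i \<bullet> y \<le> max Y Y'"
        using AB unfolding A_def B_def X_def X'_def Y_def Y'_def \<alpha>_def \<alpha>'_def by (auto simp only: max.bounded_iff min.bounded_iff)
      have pos: "0 \<le> y$1 \<and> 0 \<le> y$2"
      proof (cases "\<alpha> < \<alpha>'")
        case True
        have "X \<le> X'" "Y \<le> Y'"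
          unfolding X_def X'_def Y_def Y'_def using True \<tau> by (intro max.mono min.mono mult_right_mono; simp)+
        then have "\<alpha> * \<sigma> \<le> v i \<bullet> y" "v i \<bullet> y \<le> \<alpha>' * \<sigma>" using AX b by (simp_all add: min_def max_def split: if_splits)
        then have "0 \<le> (\<alpha>' - \<alpha>) * y$2" "0 \<le> (\<alpha>' - \<alpha>) * y$1" using vy by (simp_all add: algebra_simps)
        then show ?thesis using True by (simp add: zero_le_mult_iff)
      next
        case False
        then have lt: "\<alpha>' < \<alpha>" using ne by simp
        have "X' \<le> X" "Y' \<le> Y"
          unfolding X_def X'_def Y_def Y'_def using lt \<tau> by (intro max.mono min.mono mult_right_mono; simp)+
        then have "\<alpha>' * \<sigma> \<le> v i \<bullet> y" "v i \<bullet> y \<le> \<alpha> * \<sigma>" using AX b by (simp_all add: min_def max_def split: if_splits)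
        then have "0 \<le> (\<alpha> - \<alpha>') * y$2" "0 \<le> (\<alpha> - \<alpha>') * y$1" using vy by (simp_all add: algebra_simps)
        then show ?thesis using lt by (simp add: zero_le_mult_iff)
      qed
      have "y \<in> P i" using AB by (simp add: P_def strip_def A_def B_def)
      then show "y \<in> P i \<inter> wedge_end \<tau>" using pos \<sigma> by (simp add: wedge_end_def \<sigma>_def)
    qed
    then show "area (R i (3/5 * \<tau>)) \<le> area (P i \<inter> wedge_end \<tau>)"
      by (rule area_mono[OF _ lmeasurable_compact[OF R(2)[OF i]] Int_closed_lmeasurable[OF _ Em]]) (simp add: P_def closed_strip)
  qed
  also have "\<dots> \<le> (\<Sum>i\<in>I. area (P i \<inter> wedge_end \<tau>))"
    by (rule sum_mono2) (use fin in \<open>auto simp: Th_def\<close>)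
  finally show ?thesis
    using thr E overlap_ge[where I=I and P=P, OF fin clP Em] by linarith
qed

context plank_cover
begin

text \<open>
  The lines through \<open>x\<close> and \<open>x'\<close> meet at \<open>z\<close>, and \<open>\<sigma>\<close>, \<open>\<sigma>'\<close> select one of the four wedges they bound.
  In oblique coordinates along the two lines this wedge is a quadrant and \<open>wedge_squeeze\<close> applies:
  by \<open>abs_det2_triangle\<close> each plank is steep with respect to at least one side, and the masses of \<open>x\<close>
  and \<open>x'\<close> bound the crossing lengths on the sides, provided the relevant part of each side belongs
  to the segment on which the mass is measured, which is the assumption \<open>range\<close>.
\<close>
lemma wedge_overlap:
  assumes x: "x \<in> uncovered" "x' \<in> uncovered" and e: "norm e = 1" "norm e' = 1" and D: "0 < D"
    and m: "mass x e D \<le> 1/10000" "mass x' e' D \<le> 1/10000"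
    and \<theta>: "50 * D \<le> \<bar>det2 e e'\<bar>"
    and z: "z = x + s *\<^sub>R e" "z = x' + s' *\<^sub>R e'"
    and \<sigma>: "\<bar>\<sigma>\<bar> = 1" "\<bar>\<sigma>'\<bar> = (1::real)" and \<tau>: "1/10 \<le> \<tau>" "\<tau> \<le> 1"
    and range: "\<And>t. 3/5 * \<tau> \<le> t \<Longrightarrow> t \<le> \<tau> \<Longrightarrow> \<bar>s + \<sigma> * t\<bar> \<le> 1/4 \<and> \<bar>s' + \<sigma>' * t\<bar> \<le> 1/4"
    and out: "\<And>q. 9/10 * \<tau> \<le> q$1 + q$2 \<Longrightarrow> q$1 + q$2 \<le> \<tau> \<Longrightarrow> \<tau>/20 \<le> q$1 \<Longrightarrow> \<tau>/20 \<le> q$2 \<Longrightarrow>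
      r < norm (aff z (\<sigma> *\<^sub>R e) (\<sigma>' *\<^sub>R e') q)"
  shows "6/100000 * \<bar>det2 e e'\<bar> \<le> overlap I P (box x e \<bar>det2 e e'\<bar>)"
proof -
  define d d' where "d = \<sigma> *\<^sub>R e" and "d' = \<sigma>' *\<^sub>R e'"
  have dn: "norm d = 1" "norm d' = 1" using e \<sigma> by (simp_all add: d_def d'_def)
  have dd: "\<bar>det2 d d'\<bar> = \<bar>det2 e e'\<bar>" using \<sigma> by (simp add: d_def d'_def det2_linear abs_mult)
  have nz: "det2 d d' \<noteq> 0" using dd \<theta> D by auto
  have \<tau>0: "0 < \<tau>" using \<tau> by simp
  define v where "v i = (vector [u i \<bullet> d, u i \<bullet> d'] :: real^2)" for i
  define lo' hi' where "lo' i = lo i - u i \<bullet> z" and "hi' i = hi i - u i \<bullet> z" for i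
  have vim: "aff z d d' -` P i = strip (v i) (lo' i) (hi' i)" for i
    by (simp add: aff_vimage_strip v_def lo'_def hi'_def)
  have vc: "\<bar>v i $ 1\<bar> = \<bar>u i \<bullet> e\<bar>" "\<bar>v i $ 2\<bar> = \<bar>u i \<bullet> e'\<bar>" for i
    using \<sigma> by (simp_all add: v_def d_def d'_def abs_mult)
  \<comment> \<open>Points of the wedge are convex combinations of points on its two sides, which lie within \<open>1/4\<close>
    of \<open>x\<close> or \<open>x'\<close>.\<close>
  have near: "norm (aff z d d' q - x) \<le> 1/2" if q: "0 \<le> q$1" "0 \<le> q$2" "3/5 * \<tau> \<le> q$1 + q$2" "q$1 + q$2 \<le> \<tau>" for q
  proof -
    define t where "t = q$1 + q$2"
    have t: "0 < t" using q \<tau>0 by (simp add: t_def)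
    have rg: "\<bar>s + \<sigma> * t\<bar> \<le> 1/4" "\<bar>s' + \<sigma>' * t\<bar> \<le> 1/4" using range[of t] q by (auto simp: t_def)
    have n1: "norm (z + t *\<^sub>R d - x) \<le> 1/2"
    proof -
      have "z + t *\<^sub>R d - x = (s + \<sigma> * t) *\<^sub>R e" unfolding z(1) d_def by (simp add: algebra_simps)
      then show ?thesis using rg e by simp
    qed
    have n2: "norm (z + t *\<^sub>R d' - x) \<le> 1/2"
    proof -
      have "z + t *\<^sub>R d' - x = (s' + \<sigma>' * t) *\<^sub>R e' + (x' - x)" unfolding z(2) d'_def by (simp add: algebra_simps)
      then have "norm (z + t *\<^sub>R d' - x) \<le> norm ((s' + \<sigma>' * t) *\<^sub>R e') + norm (x' - x)" by (metis norm_triangle_ineq)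
      also have "\<dots> \<le> 1/4 + 2 * r"
        using rg e norm_triangle_ineq4[of x' x] norm_uncovered[OF x(1)] norm_uncovered[OF x(2)] by simp
      finally show ?thesis using r_small by simp
    qed
    have "t *\<^sub>R (aff z d d' q - x) = (q$1) *\<^sub>R (z + t *\<^sub>R d - x) + (q$2) *\<^sub>R (z + t *\<^sub>R d' - x)"
      by (simp add: aff_def t_def algebra_simps)
    then have "norm (t *\<^sub>R (aff z d d' q - x)) \<le> norm ((q$1) *\<^sub>R (z + t *\<^sub>R d - x)) + norm ((q$2) *\<^sub>R (z + t *\<^sub>R d' - x))"
      by (metis norm_triangle_ineq)
    also have "\<dots> = q$1 * norm (z + t *\<^sub>R d - x) + q$2 * norm (z + t *\<^sub>R d' - x)" using q by simp
    also have "\<dots> \<le> q$1 * (1/2) + q$2 * (1/2)" using q n1 n2 by (intro add_mono mult_left_mono) auto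
    finally have "norm (t *\<^sub>R (aff z d d' q - x)) \<le> q$1 * (1/2) + q$2 * (1/2)" .
    moreover have "norm (t *\<^sub>R (aff z d d' q - x)) = t * norm (aff z d d' q - x)" using t by simp
    moreover have "q$1 * (1/2) + q$2 * (1/2) = t * (1/2)" by (simp add: t_def)
    ultimately have "t * norm (aff z d d' q - x) \<le> t * (1/2)" by linarith
    then show ?thesis using t by (simp only: mult_le_cancel_left_pos)
  qed
  \<comment> \<open>Crossings with a side of the quadrant are, up to a reflection and a shift of the parameter,
    crossings with the line through \<open>x\<close> or \<open>x'\<close>.\<close>
  have len_le: "measure lebesgue (crossing (strip (v i) (lo' i) (hi' i)) 0 w (3/5 * \<tau>) \<tau>) \<le> len i y f"
    if w: "w = vector [1, 0] \<and> y = x \<and> f = e \<or> w = vector [0, 1] \<and> y = x' \<and> f = e'" and uf: "u i \<bullet> f \<noteq> 0" for i w y f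
  proof -
    define a m where "a = (if w = vector [1, 0] then \<sigma> else \<sigma>')" and "m = (if w = vector [1, 0] then s else s')"
    have ne: "(vector [1, 0] :: real^2) \<noteq> vector [0, 1]" by (simp add: vec_eq_iff forall_2)
    have "(\<lambda>t. a *\<^sub>R t + m) ` crossing (strip (v i) (lo' i) (hi' i)) 0 w (3/5 * \<tau>) \<tau> \<subseteq> crossing (P i) y f (-1/4) (1/4)"
    proof (intro subsetI, elim imageE)
      fix p t assume p: "p = a *\<^sub>R t + m" and t: "t \<in> crossing (strip (v i) (lo' i) (hi' i)) 0 w (3/5 * \<tau>) \<tau>"
      have tb: "3/5 * \<tau> \<le> t" "t \<le> \<tau>" and ts: "t *\<^sub>R w \<in> aff z d d' -` P i" using t vim by (auto simp: crossing_def)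
      have "aff z d d' (t *\<^sub>R w) = y + p *\<^sub>R f"
        using w
      proof
        assume w1: "w = vector [1, 0] \<and> y = x \<and> f = e"
        then have "aff z d d' (t *\<^sub>R w) = z + t *\<^sub>R d" by (simp add: aff_def)
        then show ?thesis using w1 by (simp add: z(1) d_def p a_def m_def algebra_simps)
      next
        assume w2: "w = vector [0, 1] \<and> y = x' \<and> f = e'"
        then have "aff z d d' (t *\<^sub>R w) = z + t *\<^sub>R d'" by (simp add: aff_def)
        then show ?thesis using w2 ne by (simp add: z(2) d'_def p a_def m_def algebra_simps)
      qed
      moreover have "\<bar>p\<bar> \<le> 1/4" using range[OF tb] w ne by (auto simp: p a_def m_def add.commute)
      ultimately show "p \<in> crossing (P i) y f (-1/4) (1/4)" using ts by (auto simp: crossing_def)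
    qed
    moreover have "crossing (P i) y f (-1/4) (1/4) \<in> lmeasurable" by (rule crossing_measurable[OF uf])
    moreover have "(\<lambda>t. a *\<^sub>R t + m) ` crossing (strip (v i) (lo' i) (hi' i)) 0 w (3/5 * \<tau>) \<tau> \<in> sets lebesgue"
    proof -
      have "v i \<bullet> w \<noteq> 0" using w uf \<sigma> by (auto simp: v_def d_def d'_def inner2[of "vector _"])
      then obtain p q where "crossing (strip (v i) (lo' i) (hi' i)) 0 w (3/5 * \<tau>) \<tau> = {p..q}"
        using crossing_interval by blast
      then have "compact ((\<lambda>t. a *\<^sub>R t + m) ` crossing (strip (v i) (lo' i) (hi' i)) 0 w (3/5 * \<tau>) \<tau>)"
        by (auto intro!: compact_continuous_image continuous_intros)
      then show ?thesis by (intro fmeasurableD lmeasurable_compact)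
    qed
    ultimately have "measure lebesgue ((\<lambda>t. a *\<^sub>R t + m) ` crossing (strip (v i) (lo' i) (hi' i)) 0 w (3/5 * \<tau>) \<tau>) \<le> len i y f"
      unfolding len_def by (intro measure_mono_fmeasurable)
    moreover have "\<bar>a\<bar> = 1" using \<sigma> by (simp add: a_def)
    ultimately show ?thesis using measure_lebesgue_affine[of a m "crossing (strip (v i) (lo' i) (hi' i)) 0 w (3/5 * \<tau>) \<tau>"] by simp
  qed
  define Q where "Q i = strip (v i) (lo' i) (hi' i)" for i
  have sq: "6/1000 * \<tau>\<^sup>2 \<le> overlap I Q (wedge_end \<tau>)"
    unfolding Q_def
  proof (rule wedge_squeeze[OF fin \<tau>0 D])
    fix i assume i: "i \<in> I"
    have tri: "50 * D \<le> \<bar>u i \<bullet> e\<bar> + \<bar>u i \<bullet> e'\<bar>" using abs_det2_triangle[OF unit[OF i] e] \<theta> by simp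
    show "20 * D < \<bar>v i $ 2\<bar>" if "\<bar>v i $ 1\<bar> < D" using that tri D unfolding vc by simp
    show "20 * D < \<bar>v i $ 1\<bar>" if "\<bar>v i $ 2\<bar> < D" using that tri D unfolding vc by simp
  next
    have "(\<Sum>i | i \<in> I \<and> D \<le> \<bar>v i $ 1\<bar>. measure lebesgue (crossing (strip (v i) (lo' i) (hi' i)) 0 (vector [1, 0]) (3/5 * \<tau>) \<tau>)) \<le> mass x e D"
      unfolding mass_def vc by (rule sum_mono, rule len_le) (use D in auto)
    then show "(\<Sum>i | i \<in> I \<and> D \<le> \<bar>v i $ 1\<bar>. measure lebesgue (crossing (strip (v i) (lo' i) (hi' i)) 0 (vector [1, 0]) (3/5 * \<tau>) \<tau>)) \<le> \<tau>/500"
      using m(1) \<tau> by simp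
  next
    have "(\<Sum>i | i \<in> I \<and> D \<le> \<bar>v i $ 2\<bar>. measure lebesgue (crossing (strip (v i) (lo' i) (hi' i)) 0 (vector [0, 1]) (3/5 * \<tau>) \<tau>)) \<le> mass x' e' D"
      unfolding mass_def vc by (rule sum_mono, rule len_le) (use D in auto)
    then show "(\<Sum>i | i \<in> I \<and> D \<le> \<bar>v i $ 2\<bar>. measure lebesgue (crossing (strip (v i) (lo' i) (hi' i)) 0 (vector [0, 1]) (3/5 * \<tau>) \<tau>)) \<le> \<tau>/500"
      using m(2) \<tau> by simp
  next
    fix q :: "real^2"
    assume q: "9/10 * \<tau> \<le> q$1 + q$2" "q$1 + q$2 \<le> \<tau>" "\<tau>/20 \<le> q$1" "\<tau>/20 \<le> q$2"
    have q0: "0 \<le> q$1" "0 \<le> q$2" "3/5 * \<tau> \<le> q$1 + q$2" using q \<tau>0 by auto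
    have "norm (aff z d d' q) \<le> norm (aff z d d' q - x) + norm x" using norm_triangle_sub by (metis add.commute)
    then have "norm (aff z d d' q) \<le> 1" using near[OF q0 q(2)] norm_uncovered[OF x(1)] r_small by simp
    then obtain i where "i \<in> I" "aff z d d' q \<in> P i" using covered out[OF q] unfolding d_def d'_def by blast
    then show "\<exists>i\<in>I. q \<in> strip (v i) (lo' i) (hi' i)" using vim by blast
  qed
  have cE: "wedge_end \<tau> \<in> lmeasurable" by (rule lmeasurable_wedge_end)
  have "overlap I P (aff z d d' ` wedge_end \<tau>) = \<bar>det2 e e'\<bar> * overlap I Q (wedge_end \<tau>)"
  proof -
    have "overlap I P (aff z d d' ` wedge_end \<tau>) = \<bar>det2 d d'\<bar> * overlap I (\<lambda>i. aff z d d' -` P i) (wedge_end \<tau>)"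
      by (rule overlap_aff[OF fin cl cE nz])
    then show ?thesis unfolding vim dd Q_def[abs_def] .
  qed
  also have "\<dots> \<ge> \<bar>det2 e e'\<bar> * (6/1000 * \<tau>\<^sup>2)" using sq by (intro mult_left_mono) auto
  finally have "\<bar>det2 e e'\<bar> * (6/1000 * \<tau>\<^sup>2) \<le> overlap I P (aff z d d' ` wedge_end \<tau>)" .
  moreover have "\<bar>det2 e e'\<bar> * (6/1000 * (1/10)\<^sup>2) \<le> \<bar>det2 e e'\<bar> * (6/1000 * \<tau>\<^sup>2)"
    using \<tau> by (intro mult_left_mono power_mono) auto
  moreover have "overlap I P (aff z d d' ` wedge_end \<tau>) \<le> overlap I P (box x e \<bar>det2 e e'\<bar>)"
  proof (rule overlap_mono[where I=I and P=P, OF fin cl _ lmeasurable_box])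
    show "aff z d d' ` wedge_end \<tau> \<in> lmeasurable" by (rule area_aff_image(2)[OF cE])
    show "aff z d d' ` wedge_end \<tau> \<subseteq> box x e \<bar>det2 e e'\<bar>"
    proof (intro subsetI, elim imageE)
      fix y q assume y: "y = aff z d d' q" and q: "q \<in> wedge_end \<tau>"
      have q': "0 \<le> q$1" "0 \<le> q$2" "3/5 * \<tau> \<le> q$1 + q$2" "q$1 + q$2 \<le> \<tau>" using q \<tau>0 by (auto simp: wedge_end_def)
      have "y - x = (s + \<sigma> * q$1) *\<^sub>R e + (\<sigma>' * q$2) *\<^sub>R e'" unfolding y aff_def z(1) d_def d'_def by (simp add: algebra_simps)
      then have "\<bar>det2 e (y - x)\<bar> = q$2 * \<bar>det2 e e'\<bar>" using \<sigma> q' by (simp add: det2_linear abs_mult)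
      also have "\<dots> \<le> 1 * \<bar>det2 e e'\<bar>" using q' \<tau> by (intro mult_right_mono) auto
      finally show "y \<in> box x e \<bar>det2 e e'\<bar>" using near[OF q'] y by (simp add: box_def)
    qed
  qed
  ultimately have "\<bar>det2 e e'\<bar> * (6/1000 * (1/10)\<^sup>2) \<le> overlap I P (box x e \<bar>det2 e e'\<bar>)" by linarith
  then show ?thesis by (simp add: power2_eq_square)
qed

text \<open>
  The choice of the wedge.  If the lines meet far from the origin, use the wedge that opens towards
  the origin and end it just before the disk of radius \<open>r\<close>.  If they meet near the origin, use an
  acute wedge that opens away from the origin.  In both cases the outer end avoids the disk of
  radius \<open>r\<close> and so is covered.
\<close>
lemma meeting_lines_overlap:
  assumes x: "x \<in> uncovered" "x' \<in> uncovered" and e: "norm e = 1" "norm e' = 1" and D: "0 < D"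
    and m: "mass x e D \<le> 1/10000" "mass x' e' D \<le> 1/10000"
    and \<theta>: "50 * D \<le> \<bar>det2 e e'\<bar>"
    and z: "z = x + s *\<^sub>R e" "z = x' + s' *\<^sub>R e'" and s: "\<bar>s\<bar> \<le> 11/20"
  shows "6/100000 * \<bar>det2 e e'\<bar> \<le> overlap I P (box x e \<bar>det2 e e'\<bar>)"
proof -
  define \<eta> \<eta>' where "\<eta> = (if 0 \<le> s then 1 else - 1 :: real)" and "\<eta>' = (if 0 \<le> s' then 1 else - 1 :: real)"
  have \<eta>: "\<bar>\<eta>\<bar> = 1" "s = \<eta> * \<bar>s\<bar>" "\<bar>\<eta>'\<bar> = 1" "s' = \<eta>' * \<bar>s'\<bar>" "\<eta> * \<eta> = 1" by (auto simp: \<eta>_def \<eta>'_def)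
  have nx: "norm x \<le> r" "norm x' \<le> r" using norm_uncovered x by auto
  \<comment> \<open>The meeting point has almost the same distance from \<open>x\<close> and \<open>x'\<close>, which are both close to \<open>0\<close>.\<close>
  have ss: "\<bar>\<bar>s'\<bar> - \<bar>s\<bar>\<bar> \<le> 2 * r"
  proof -
    have "s *\<^sub>R e - s' *\<^sub>R e' = x' - x" using z by (metis add_diff_cancel_left add_diff_cancel_left' diff_add_eq_diff_diff_swap diff_diff_eq2 add.commute)
    then have "\<bar>norm (s *\<^sub>R e) - norm (s' *\<^sub>R e')\<bar> \<le> norm (x' - x)" by (metis norm_triangle_ineq3)
    then show ?thesis using e norm_triangle_ineq4[of x' x] nx by simp
  qed
  show ?thesis
  proof (cases "1/8 \<le> \<bar>s\<bar>")
    case True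
    \<comment> \<open>The sides point back towards \<open>x\<close> and \<open>x'\<close> and stop \<open>1/40\<close> before them.\<close>
    define \<tau> where "\<tau> = \<bar>s\<bar> - 1/40"
    have \<tau>: "1/10 \<le> \<tau>" "\<tau> \<le> 1" using True s by (auto simp: \<tau>_def)
    show ?thesis
    proof (rule wedge_overlap[OF x e D m \<theta> z _ _ \<tau>, of "- \<eta>" "- \<eta>'"])
      fix t assume t: "3/5 * \<tau> \<le> t" "t \<le> \<tau>"
      have "s + - \<eta> * t = \<eta> * (\<bar>s\<bar> - t)" "s' + - \<eta>' * t = \<eta>' * (\<bar>s'\<bar> - t)"
        using \<eta>(2,4) by (simp_all add: algebra_simps)
      then have 1: "\<bar>s + - \<eta> * t\<bar> = \<bar>\<bar>s\<bar> - t\<bar>" "\<bar>s' + - \<eta>' * t\<bar> = \<bar>\<bar>s'\<bar> - t\<bar>"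
        using \<eta>(1,3) by (simp_all add: abs_mult)
      have "1/40 \<le> \<bar>s\<bar> - t" "\<bar>s\<bar> - t \<le> 235/1000" using t s by (auto simp: \<tau>_def)
      then have "\<bar>\<bar>s\<bar> - t\<bar> \<le> 1/4" "\<bar>\<bar>s'\<bar> - t\<bar> \<le> 1/4" using ss r_small r_pos by linarith+
      then show "\<bar>s + - \<eta> * t\<bar> \<le> 1/4 \<and> \<bar>s' + - \<eta>' * t\<bar> \<le> 1/4" using 1 by simp
    next
      fix q :: "real^2"
      assume q: "9/10 * \<tau> \<le> q$1 + q$2" "q$1 + q$2 \<le> \<tau>" "\<tau>/20 \<le> q$1" "\<tau>/20 \<le> q$2"
      let ?y = "aff z (- \<eta> *\<^sub>R e) (- \<eta>' *\<^sub>R e') q"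
      have ee: "e \<bullet> e = 1" using e by (simp add: norm_eq_1)
      have "(\<eta> *\<^sub>R e) \<bullet> ?y = \<eta> * (e \<bullet> x) + \<bar>s\<bar> - q$1 - q$2 * (\<eta> * \<eta>' * (e \<bullet> e'))"
      proof -
        have y: "?y = x + s *\<^sub>R e - (q$1 * \<eta>) *\<^sub>R e - (q$2 * \<eta>') *\<^sub>R e'" by (simp add: aff_def z(1))
        have "(\<eta> *\<^sub>R e) \<bullet> ?y = \<eta> * (e \<bullet> x) + \<eta> * s - q$1 * (\<eta> * \<eta>) - q$2 * (\<eta> * \<eta>' * (e \<bullet> e'))"
          unfolding y using ee by (simp add: inner_add_right inner_diff_right algebra_simps)
        moreover have "\<eta> * s = \<bar>s\<bar>" by (simp add: \<eta>_def)
        ultimately show ?thesis using \<eta>(5) by simp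
      qed
      moreover have "- r \<le> \<eta> * (e \<bullet> x)"
      proof -
        have "\<bar>\<eta> * (e \<bullet> x)\<bar> \<le> r" using Cauchy_Schwarz_ineq2[of e x] e nx \<eta>(1) by (simp add: abs_mult)
        then show ?thesis by linarith
      qed
      moreover have "q$2 * (\<eta> * \<eta>' * (e \<bullet> e')) \<le> q$2 * 1"
      proof (rule mult_left_mono)
        have "\<bar>\<eta> * \<eta>' * (e \<bullet> e')\<bar> \<le> 1" using Cauchy_Schwarz_ineq2[of e e'] e \<eta>(1,3) by (simp add: abs_mult)
        then show "\<eta> * \<eta>' * (e \<bullet> e') \<le> 1" by linarith
      qed (use q \<tau> in simp)
      ultimately have "1/40 - r \<le> (\<eta> *\<^sub>R e) \<bullet> ?y" using q(2) by (simp add: \<tau>_def)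
      also have "\<dots> \<le> norm ?y" using Cauchy_Schwarz_ineq2[of "\<eta> *\<^sub>R e" ?y] e \<eta>(1) by simp
      finally show "r < norm ?y" using r_small by simp
    qed (use \<eta> in simp_all)
  next
    case False
    \<comment> \<open>Long enough for \<open>\<tau> \<ge> 1/10\<close>, short enough for \<open>1/8 + \<tau> < 1/4\<close>.\<close>
    define \<tau> where "\<tau> = (9/80 :: real)"
    have \<tau>: "1/10 \<le> \<tau>" "\<tau> \<le> 1" by (auto simp: \<tau>_def)
    define \<sigma>' where "\<sigma>' = (if 0 \<le> \<eta> * (e \<bullet> e') then 1 else - 1 :: real)"
    have \<sigma>': "\<bar>\<sigma>'\<bar> = 1" "0 \<le> \<eta> * \<sigma>' * (e \<bullet> e')" by (auto simp: \<sigma>'_def)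
    show ?thesis
    proof (rule wedge_overlap[OF x e D m \<theta> z _ _ \<tau>, of "\<eta>" "\<sigma>'"])
      fix t assume t: "3/5 * \<tau> \<le> t" "t \<le> \<tau>"
      have "\<bar>\<eta> * t\<bar> = t" "\<bar>\<sigma>' * t\<bar> = t" using \<eta>(1) \<sigma>'(1) t by (simp_all add: abs_mult \<tau>_def)
      then have "\<bar>s + \<eta> * t\<bar> \<le> \<bar>s\<bar> + t" "\<bar>s' + \<sigma>' * t\<bar> \<le> \<bar>s'\<bar> + t" by (metis abs_triangle_ineq)+
      then show "\<bar>s + \<eta> * t\<bar> \<le> 1/4 \<and> \<bar>s' + \<sigma>' * t\<bar> \<le> 1/4"
        using False ss t r_small unfolding \<tau>_def by linarith
    next
      fix q :: "real^2"
      assume q: "9/10 * \<tau> \<le> q$1 + q$2" "q$1 + q$2 \<le> \<tau>" "\<tau>/20 \<le> q$1" "\<tau>/20 \<le> q$2"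
      let ?y = "aff z (\<eta> *\<^sub>R e) (\<sigma>' *\<^sub>R e') q"
      have ee: "e \<bullet> e = 1" using e by (simp add: norm_eq_1)
      have "(\<eta> *\<^sub>R e) \<bullet> ?y = \<eta> * (e \<bullet> x) + \<bar>s\<bar> + q$1 + q$2 * (\<eta> * \<sigma>' * (e \<bullet> e'))"
      proof -
        have y: "?y = x + s *\<^sub>R e + (q$1 * \<eta>) *\<^sub>R e + (q$2 * \<sigma>') *\<^sub>R e'" by (simp add: aff_def z(1))
        have "(\<eta> *\<^sub>R e) \<bullet> ?y = \<eta> * (e \<bullet> x) + \<eta> * s + q$1 * (\<eta> * \<eta>) + q$2 * (\<eta> * \<sigma>' * (e \<bullet> e'))"
          unfolding y using ee by (simp add: inner_add_right algebra_simps)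
        moreover have "\<eta> * s = \<bar>s\<bar>" by (simp add: \<eta>_def)
        ultimately show ?thesis using \<eta>(5) by simp
      qed
      moreover have "- r \<le> \<eta> * (e \<bullet> x)"
      proof -
        have "\<bar>\<eta> * (e \<bullet> x)\<bar> \<le> r" using Cauchy_Schwarz_ineq2[of e x] e nx \<eta>(1) by (simp add: abs_mult)
        then show ?thesis by linarith
      qed
      moreover have "0 \<le> q$2 * (\<eta> * \<sigma>' * (e \<bullet> e'))" using q(4) \<tau> by (intro mult_nonneg_nonneg[OF _ \<sigma>'(2)]) simp
      ultimately have "9/1600 - r \<le> (\<eta> *\<^sub>R e) \<bullet> ?y" using q(3) by (simp add: \<tau>_def)
      also have "\<dots> \<le> norm ?y" using Cauchy_Schwarz_ineq2[of "\<eta> *\<^sub>R e" ?y] e \<eta>(1) by simp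
      finally show "r < norm ?y" using r_small by simp
    qed (use \<eta> \<sigma>' in simp_all)
  qed
qed

section \<open>Comparing the boxes of different points\<close>

definition heavy :: "real^2 \<Rightarrow> real^2 \<Rightarrow> real \<Rightarrow> bool" where
  "heavy x e D \<longleftrightarrow> D / 10^17 \<le> overlap I P (box x e D)"

text \<open>
  The last condition makes \<open>D\<close> maximal up to a factor \<open>2\<close>.  The widths \<open>D'\<close> to which maximality will
  be applied are sines of angles and so lie in the range up to \<open>2\<close>.
\<close>
definition adapted :: "real^2 \<Rightarrow> real^2 \<Rightarrow> real \<Rightarrow> bool" where
  "adapted x e D \<longleftrightarrow> norm e = 1 \<and> 0 < D \<and> D \<le> 2 \<and> mass x e D \<le> 1/10000 \<and> heavy x e D \<and>
    (\<forall>D'. 2 * D \<le> D' \<and> D' \<le> 2 \<longrightarrow> \<not> heavy x e D')"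

text \<open>
  Enlarging \<open>D\<close> only decreases the mass, so one may start from the heavy box at the scale of \<open>x\<close> and
  pass to a nearly maximal heavy one with the same direction.
\<close>
lemma adapted_exists:
  assumes x: "x \<in> uncovered"
  shows "\<exists>e D. adapted x e D"
proof -
  obtain \<phi> e where \<phi>: "0 < \<phi>" "\<phi> \<le> 2" and e: "norm e = 1" and m: "mass x e \<phi> \<le> 1/10000"
    and m': "\<forall>e'. norm e' = 1 \<longrightarrow> 1/10000 < mass x e' (\<phi>/2)"
    using scale_exists[OF x] by (elim exE conjE)
  have h: "heavy x e \<phi>" unfolding heavy_def by (rule heavy_box[OF x e \<phi> m]) (use m' in blast)
  define S where "S = {D. \<phi> \<le> D \<and> D \<le> 2 \<and> heavy x e D}"
  have \<phi>S: "\<phi> \<in> S" using h \<phi> by (simp add: S_def)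
  have bdd: "bdd_above S" by (rule bdd_aboveI[of _ 2]) (simp add: S_def)
  have "0 < Sup S" using cSup_upper[OF \<phi>S bdd] \<phi> by simp
  then obtain D where D: "D \<in> S" "Sup S / 2 < D"
    using less_cSup_iff[of S "Sup S / 2"] \<phi>S bdd by auto
  have "\<not> heavy x e D'" if "2 * D \<le> D'" "D' \<le> 2" for D'
  proof
    assume "heavy x e D'"
    then have "D' \<in> S" using that D \<phi> by (simp add: S_def)
    then show False using cSup_upper[OF _ bdd, of D'] that D by simp
  qed
  moreover have "mass x e D \<le> 1/10000" using mass_antimono[of \<phi> D x e] m D by (simp add: S_def)
  ultimately show ?thesis using e D \<phi> unfolding adapted_def S_def by (intro exI[of _ e] exI[of _ D]) auto
qed

text \<open>
  At an angle of more than \<open>50 * D\<close>, two boxes that meet have axes that meet within distance \<open>11/20\<close>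
  of \<open>x\<close>, since each box is much narrower than the angle.  Then \<open>meeting_lines_overlap\<close> makes the box
  around \<open>x\<close> of width \<open>\<bar>det2 e e'\<bar> \<ge> 50 * D\<close> heavy, against the maximality of \<open>D\<close>.
\<close>
lemma adapted_boxes_parallel:
  assumes x: "x \<in> uncovered" "x' \<in> uncovered" and a: "adapted x e D" "adapted x' e' D'" and DD: "D' \<le> D"
    and y: "y \<in> box x e D" "y \<in> box x' e' D'"
  shows "\<bar>det2 e e'\<bar> < 50 * D"
proof (rule ccontr)
  assume "\<not> ?thesis"
  then have \<theta>: "50 * D \<le> \<bar>det2 e e'\<bar>" by simp
  have e: "norm e = 1" "norm e' = 1" and D: "0 < D" and m: "mass x e D \<le> 1/10000" "mass x' e' D' \<le> 1/10000"
    using a by (auto simp: adapted_def)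
  have m2: "mass x' e' D \<le> 1/10000" using m(2) mass_antimono[OF DD, of x' e'] by simp
  \<comment> \<open>The parameters of the intersection of the two axes, by the rule of Cramer.\<close>
  define \<delta> s s' where "\<delta> = det2 e e'" and "s = det2 (x' - x) e' / \<delta>" and "s' = det2 (x' - x) e / \<delta>"
  have \<delta>: "\<delta> \<noteq> 0" using \<theta> D by (auto simp: \<delta>_def)
  have meet: "x + s *\<^sub>R e = x' + s' *\<^sub>R e'"
  proof -
    have "det2 (x' - x) e' *\<^sub>R e - det2 (x' - x) e *\<^sub>R e' = \<delta> *\<^sub>R (x' - x)"
      by (simp add: vec_eq_iff forall_2 det2_def \<delta>_def algebra_simps)
    then have "(1/\<delta>) *\<^sub>R (det2 (x' - x) e' *\<^sub>R e - det2 (x' - x) e *\<^sub>R e') = (1/\<delta>) *\<^sub>R (\<delta> *\<^sub>R (x' - x))" by simp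
    then have "s *\<^sub>R e - s' *\<^sub>R e' = x' - x" using \<delta> by (simp add: s_def s'_def scaleR_diff_right)
    then show ?thesis by (simp add: algebra_simps)
  qed
  \<comment> \<open>The common point \<open>y\<close> of the boxes is within \<open>D\<close> of both axes, so the axes meet within
    \<open>2 * D / \<bar>\<delta>\<bar> \<le> 1/25\<close> of the projection of \<open>y\<close>, which has parameter at most \<open>1/2\<close>.\<close>
  have sb: "\<bar>s\<bar> \<le> 11/20"
  proof -
    define p t where "p = e \<bullet> (y - x)" and "t = det2 e (y - x)"
    have yx: "norm (y - x) \<le> 1/2" and t: "\<bar>t\<bar> \<le> D" using y(1) by (auto simp: box_def t_def)
    have p: "\<bar>p\<bar> \<le> 1/2" using Cauchy_Schwarz_ineq2[of e "y - x"] e yx by (simp add: p_def)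
    have "y - x = p *\<^sub>R e + t *\<^sub>R perp e" unfolding p_def t_def by (rule frame_expand[OF e(1)])
    then have "det2 (y - x) e' = p * \<delta> + t * det2 (perp e) e'" by (simp add: det2_linear \<delta>_def)
    moreover have "det2 (y - x) e' = det2 (x' - x) e' + det2 (y - x') e'" by (simp add: det2_linear)
    moreover have "det2 (x' - x) e' = s * \<delta>" using \<delta> by (simp add: s_def)
    ultimately have "(s - p) * \<delta> = t * det2 (perp e) e' - det2 (y - x') e'" by (simp add: algebra_simps)
    then have "\<bar>s - p\<bar> * \<bar>\<delta>\<bar> \<le> \<bar>t\<bar> * \<bar>det2 (perp e) e'\<bar> + \<bar>det2 (y - x') e'\<bar>"
      by (metis abs_mult abs_triangle_ineq4)
    also have "\<dots> \<le> D * 1 + D"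
    proof (intro add_mono mult_mono)
      show "\<bar>det2 (perp e) e'\<bar> \<le> 1" using abs_det2_le[of "perp e" e'] e by simp
      show "\<bar>det2 (y - x') e'\<bar> \<le> D" using y(2) DD det2_swap[of "y - x'" e'] by (simp add: box_def)
    qed (use t D in auto)
    also have "\<dots> \<le> 1/25 * \<bar>\<delta>\<bar>" using \<theta> by (simp add: \<delta>_def)
    finally have "\<bar>s - p\<bar> \<le> 1/25" using \<delta> by simp
    then show ?thesis using p by linarith
  qed
  have "6/100000 * \<bar>det2 e e'\<bar> \<le> overlap I P (box x e \<bar>det2 e e'\<bar>)"
    by (rule meeting_lines_overlap[OF x e D m(1) m2 \<theta> refl meet sb])
  moreover have "\<bar>det2 e e'\<bar> / 10^17 \<le> 6/100000 * \<bar>det2 e e'\<bar>" by simp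
  ultimately have "heavy x e \<bar>det2 e e'\<bar>" unfolding heavy_def by linarith
  moreover have "\<bar>det2 e e'\<bar> \<le> 2" using abs_det2_le[of e e'] e by simp
  ultimately show False using a(1) \<theta> D by (auto simp: adapted_def)
qed

section \<open>Covering the uncovered set by thin tiles\<close>

definition tile :: "real^2 \<Rightarrow> real^2 \<Rightarrow> real \<Rightarrow> (real^2) set" where
  "tile x e D = {y. norm y \<le> r \<and> \<bar>det2 e (y - x)\<bar> \<le> D}"

text \<open>
  Boxes that meet have almost parallel axes, up to an angle of \<open>50 * D\<close>; over the unit length of a
  box this displaces the axis by a bounded multiple of \<open>D\<close>, and within the disk of radius \<open>r\<close> the
  turn hardly matters.
\<close>
lemma tile_subset:
  assumes x: "x \<in> uncovered" "x' \<in> uncovered" and a: "adapted x e D" "adapted x' e' D'" and DD: "D' \<le> D"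
    and ne: "box x e D \<inter> box x' e' D' \<noteq> {}"
  shows "tile x' e' D' \<subseteq> tile x e (30 * D)"
proof
  fix w assume w: "w \<in> tile x' e' D'"
  obtain y where y: "y \<in> box x e D" "y \<in> box x' e' D'" using ne by blast
  have \<theta>: "\<bar>det2 e e'\<bar> < 50 * D" by (rule adapted_boxes_parallel[OF x a DD y])
  have e: "norm e = 1" "norm e' = 1" and D: "0 < D" using a by (auto simp: adapted_def)
  have turn: "\<bar>det2 e v\<bar> \<le> \<bar>det2 e' v\<bar> + 50 * D * norm v" for v
  proof -
    have "det2 e v = (e \<bullet> e') * det2 e' v - det2 e' e * (v \<bullet> e')" by (rule det2_frame[OF e(2)])
    then have "\<bar>det2 e v\<bar> \<le> \<bar>e \<bullet> e'\<bar> * \<bar>det2 e' v\<bar> + \<bar>det2 e e'\<bar> * \<bar>v \<bullet> e'\<bar>"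
      using det2_swap[of e e'] by (metis abs_minus_cancel abs_mult abs_triangle_ineq4)
    also have "\<dots> \<le> 1 * \<bar>det2 e' v\<bar> + 50 * D * norm v"
      using \<theta> D e Cauchy_Schwarz_ineq2[of e e'] Cauchy_Schwarz_ineq2[of v e']
      by (intro add_mono mult_mono) auto
    finally show ?thesis by simp
  qed
  have n: "norm (w - x') \<le> 2 * r" using w norm_uncovered[OF x(2)] norm_triangle_ineq4[of w x'] by (simp add: tile_def)
  have "det2 e (w - x) = det2 e (w - x') + det2 e (x' - y) + det2 e (y - x)" by (simp add: det2_linear)
  then have "\<bar>det2 e (w - x)\<bar> \<le> \<bar>det2 e (w - x')\<bar> + \<bar>det2 e (x' - y)\<bar> + \<bar>det2 e (y - x)\<bar>" by linarith
  also have "\<bar>det2 e (w - x')\<bar> \<le> D + 50 * D * (2 * r)"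
  proof -
    have "50 * D * norm (w - x') \<le> 50 * D * (2 * r)" using n D by (intro mult_left_mono) auto
    then show ?thesis using turn[of "w - x'"] w DD by (simp add: tile_def)
  qed
  also have "\<bar>det2 e (x' - y)\<bar> \<le> D + 50 * D * (1/2)"
  proof -
    have "\<bar>det2 e (x' - y)\<bar> = \<bar>det2 e (y - x')\<bar>" by (simp add: det2_linear)
    also have "\<dots> \<le> \<bar>det2 e' (y - x')\<bar> + 50 * D * norm (y - x')" by (rule turn)
    also have "\<dots> \<le> D + 50 * D * (1/2)" using y(2) DD D by (intro add_mono mult_left_mono) (auto simp: box_def)
    finally show ?thesis .
  qed
  also have "\<bar>det2 e (y - x)\<bar> \<le> D" using y(1) by (simp add: box_def)
  also have "D + 50 * D * (2 * r) + (D + 50 * D * (1/2)) + D \<le> 30 * D"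
  proof -
    have "D * r \<le> D * (1/100)" using r_small D by (intro mult_left_mono) auto
    moreover have "0 \<le> D * r" using r_pos D by simp
    ultimately show ?thesis by (simp add: mult.assoc mult.left_commute)
  qed
  finally show "w \<in> tile x e (30 * D)" using w by (simp add: tile_def)
qed

lemma tile_area:
  assumes e: "norm e = 1" and D: "0 < D"
  shows "area (tile x e D) \<le> 4 * D * r" "compact (tile x e D)"
proof -
  let ?T = "{y. - r \<le> e \<bullet> y \<and> e \<bullet> y \<le> r \<and> perp e \<bullet> x - D \<le> perp e \<bullet> y \<and> perp e \<bullet> y \<le> perp e \<bullet> x + D}"
  have T: "area ?T = 4 * D * r \<and> compact ?T"
    using parallelogram_area[of e "perp e" "- r" r "perp e \<bullet> x - D" "perp e \<bullet> x + D"] det2_perp_self[OF e] r_pos D by simp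
  have "tile x e D = cball 0 r \<inter> {y. \<bar>perp e \<bullet> (y - x)\<bar> \<le> D}" by (auto simp: tile_def perp_inner)
  moreover have "closed {y. \<bar>perp e \<bullet> (y - x)\<bar> \<le> D}" by (intro closed_Collect_le continuous_intros)
  ultimately show c: "compact (tile x e D)" by (simp add: compact_Int_closed)
  have "tile x e D \<subseteq> ?T"
  proof
    fix y assume y: "y \<in> tile x e D"
    have "\<bar>e \<bullet> y\<bar> \<le> r" using Cauchy_Schwarz_ineq2[of e y] e y by (simp add: tile_def)
    moreover have "\<bar>perp e \<bullet> y - perp e \<bullet> x\<bar> \<le> D" using y by (simp add: tile_def perp_inner det2_linear)
    ultimately show "y \<in> ?T" by auto
  qed
  from area_mono[OF this lmeasurable_compact[OF c] lmeasurable_compact] T show "area (tile x e D) \<le> 4 * D * r" by simp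
qed

lemma box_in_disk: "x \<in> uncovered \<Longrightarrow> box x e D \<subseteq> cball 0 1"
proof
  fix y assume x: "x \<in> uncovered" and y: "y \<in> box x e D"
  have "norm y \<le> norm (y - x) + norm x" using norm_triangle_sub by (metis add.commute)
  then show "y \<in> cball 0 1" using y norm_uncovered[OF x] r_small by (simp add: box_def)
qed

text \<open>
  A Vitali covering argument in which the disjointness of the long boxes is used for the overlap,
  but only their short tiles are needed to cover \<open>K\<close>.
\<close>
lemma compact_uncovered_bound:
  assumes K: "compact K" "K \<subseteq> uncovered"
  shows "area K \<le> 12 * 10^18 * r * overlap I P (cball 0 1)"
proof -
  have "\<exists>p. adapted x (fst p) (snd p)" if "x \<in> K" for x using adapted_exists[of x] K that by fastforce
  then obtain f where f: "\<And>x. x \<in> K \<Longrightarrow> adapted x (fst (f x)) (snd (f x))" by metis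
  define E D where "E x = fst (f x)" and "D x = snd (f x)" for x
  have ad: "adapted x (E x) (D x)" and un: "x \<in> uncovered" if "x \<in> K" for x
    using f[OF that] K that by (auto simp: E_def D_def)
  have DE: "0 < D x" "norm (E x) = 1" if "x \<in> K" for x using ad[OF that] by (auto simp: adapted_def)
  \<comment> \<open>Open strips whose traces on the disk of radius \<open>r\<close> lie in the tiles; a finite number of them
    covers the compact set.\<close>
  define T where "T x = {y. \<bar>perp (E x) \<bullet> (y - x)\<bar> < D x}" for x
  have "open (T x)" for x unfolding T_def by (intro open_Collect_less continuous_intros)
  moreover have "K \<subseteq> (\<Union>x\<in>K. T x)" using DE by (auto simp: T_def)
  ultimately obtain X where X: "X \<subseteq> K" "finite X" "K \<subseteq> (\<Union>x\<in>X. T x)"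
    using compactE_image[OF K(1), of K T] by blast
  define conflict where "conflict x y \<longleftrightarrow> box x (E x) (D x) \<inter> box y (E y) (D y) \<noteq> {}" for x y
  have "\<exists>Y\<subseteq>X. (\<forall>x\<in>Y. \<forall>y\<in>Y. x \<noteq> y \<longrightarrow> \<not> conflict x y) \<and> (\<forall>x\<in>X. \<exists>y\<in>Y. D x \<le> D y \<and> (x = y \<or> conflict x y))"
    by (rule greedy_selection[OF X(2)]) (auto simp: conflict_def)
  then obtain Y where Y: "Y \<subseteq> X" "\<forall>x\<in>Y. \<forall>y\<in>Y. x \<noteq> y \<longrightarrow> \<not> conflict x y"
    "\<forall>x\<in>X. \<exists>y\<in>Y. D x \<le> D y \<and> (x = y \<or> conflict x y)" by (elim exE conjE)
  have finY: "finite Y" by (rule finite_subset[OF Y(1) X(2)])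
  have YK: "y \<in> K" if "y \<in> Y" for y using that Y(1) X(1) by blast
  have t: "compact (tile y (E y) (30 * D y))" "area (tile y (E y) (30 * D y)) \<le> 4 * (30 * D y) * r" if "y \<in> Y" for y
    using tile_area[of "E y" "30 * D y" y] DE[OF YK[OF that]] by auto
  have cov: "K \<subseteq> (\<Union>y\<in>Y. tile y (E y) (30 * D y))"
  proof
    fix w assume w: "w \<in> K"
    then obtain x where x: "x \<in> X" "w \<in> T x" using X(3) by blast
    have xK: "x \<in> K" using x X(1) by blast
    have wx: "w \<in> tile x (E x) (D x)" using x(2) norm_uncovered[OF un[OF w]] by (simp add: tile_def T_def perp_inner)
    obtain y where y: "y \<in> Y" "D x \<le> D y" "x = y \<or> conflict x y" using bspec[OF Y(3) x(1)] by blast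
    have yK: "y \<in> K" by (rule YK[OF y(1)])
    have "tile x (E x) (D x) \<subseteq> tile y (E y) (30 * D y)"
    proof (cases "x = y")
      case True
      then show ?thesis using DE[OF yK] by (auto simp: tile_def)
    next
      case False
      then have "box y (E y) (D y) \<inter> box x (E x) (D x) \<noteq> {}" using y(3) by (auto simp: conflict_def)
      then show ?thesis by (rule tile_subset[OF un[OF yK] un[OF xK] ad[OF yK] ad[OF xK] y(2)])
    qed
    then show "w \<in> (\<Union>y\<in>Y. tile y (E y) (30 * D y))" using wx y(1) by blast
  qed
  have "area K \<le> area (\<Union>y\<in>Y. tile y (E y) (30 * D y))"
    by (rule area_mono[OF cov lmeasurable_compact[OF K(1)]]) (intro fmeasurable.finite_UN finY lmeasurable_compact t)
  also have "\<dots> \<le> (\<Sum>y\<in>Y. area (tile y (E y) (30 * D y)))"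
    by (rule area_UN_le[OF finY]) (intro lmeasurable_compact t)
  also have "\<dots> \<le> (\<Sum>y\<in>Y. 12 * 10^18 * r * overlap I P (box y (E y) (D y)))"
  proof (rule sum_mono)
    fix y assume y: "y \<in> Y"
    have "D y / 10^17 \<le> overlap I P (box y (E y) (D y))" using ad[OF YK[OF y]] by (simp add: adapted_def heavy_def)
    then have "12 * 10^18 * r * (D y / 10^17) \<le> 12 * 10^18 * r * overlap I P (box y (E y) (D y))"
      using r_pos by (intro mult_left_mono) auto
    moreover have "12 * 10^18 * r * (D y / 10^17) = 4 * (30 * D y) * r" by simp
    ultimately show "area (tile y (E y) (30 * D y)) \<le> 12 * 10^18 * r * overlap I P (box y (E y) (D y))"
      using t(2)[OF y] by linarith
  qed
  also have "\<dots> = 12 * 10^18 * r * (\<Sum>y\<in>Y. overlap I P (box y (E y) (D y)))" by (simp only: sum_distrib_left)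
  also have "\<dots> \<le> 12 * 10^18 * r * overlap I P (cball 0 1)"
  proof (intro mult_left_mono sum_overlap_le[where I=I and P=P, OF fin cl finY lmeasurable_box])
    show "box y (E y) (D y) \<subseteq> cball 0 1" if "y \<in> Y" for y by (rule box_in_disk[OF un[OF YK[OF that]]])
    show "box j (E j) (D j) \<inter> box k (E k) (D k) = {}" if "j \<in> Y" "k \<in> Y" "j \<noteq> k" for j k
      using bspec[OF bspec[OF Y(2) that(1)] that(2)] that(3) by (simp add: conflict_def)
  qed (use r_pos in simp_all)
  finally show ?thesis .
qed

lemma uncovered_lmeasurable: "uncovered \<in> lmeasurable"
proof -
  have "uncovered = cball 0 1 - (cball 0 1 \<inter> (\<Union>i\<in>I. P i))" by (auto simp: uncovered_def)
  moreover have "cball 0 1 \<inter> (\<Union>i\<in>I. P i) \<in> lmeasurable"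
    by (rule UN_lmeasurable[OF fin cl]) auto
  ultimately show ?thesis by auto
qed

text \<open>
  A compact subset carries at least half of the area of the uncovered set, whence the factor \<open>2\<close>
  compared with the compact case.
\<close>
lemma uncovered_area_le:
  "area uncovered \<le> 24 * 10^18 * r * overlap I P (cball 0 1)"
proof (cases "area uncovered = 0")
  case True
  have "0 \<le> overlap I P (cball 0 1)" by (rule overlap_nonneg[where I=I and P=P, OF fin cl]) auto
  then show ?thesis using True r_pos by simp
next
  case False
  then have pos: "0 < area uncovered / 2" using area_nonneg[of uncovered] by linarith
  obtain T where T: "closed T" "T \<subseteq> uncovered" "uncovered - T \<in> lmeasurable"
    "emeasure lebesgue (uncovered - T) < ennreal (area uncovered / 2)"
    using sets_lebesgue_inner_closed[OF fmeasurableD[OF uncovered_lmeasurable] pos] by blast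
  have "bounded T" by (rule bounded_subset[OF bounded_cball[of 0 1]]) (use T(2) in \<open>auto simp: uncovered_def\<close>)
  then have c: "compact T" using T(1) by (simp add: compact_eq_bounded_closed)
  have "area (uncovered - T) < area uncovered / 2"
    using T(3,4) pos unfolding area_def by (simp add: emeasure_eq_measure2 ennreal_less_iff)
  moreover have "area uncovered \<le> area T + area (uncovered - T)"
  proof -
    have "uncovered = T \<union> (uncovered - T)" using T(2) by auto
    then show ?thesis unfolding area_def
      using measure_Un_le[of T lebesgue "uncovered - T"] T(3) lmeasurable_compact[OF c] by (metis fmeasurableD)
  qed
  ultimately have "area uncovered \<le> 2 * area T" by linarith
  then show ?thesis using compact_uncovered_bound[OF c T(2)] by simp
qed

end

theorem theorem1p2:
  shows "\<exists>c\<^sub>0 r\<^sub>0 :: real. c\<^sub>0 > 0 \<and> r\<^sub>0 > 0 \<and>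
    (\<forall>(I :: nat set) (P :: nat \<Rightarrow> (real ^ 2) set) (H :: (real ^ 2) set) (r :: real).
       finite I \<longrightarrow> (\<forall>i\<in>I. is_plank (P i)) \<longrightarrow>
       H = unit_disk - (\<Union>i\<in>I. P i) \<longrightarrow>
       0 < r \<longrightarrow> r < r\<^sub>0 \<longrightarrow> H \<subseteq> (*\<^sub>R) r ` unit_disk \<longrightarrow>
       (\<Sum>i\<in>I. area (P i \<inter> unit_disk)) \<ge> area unit_disk + c\<^sub>0 / r * area H)"
proof (intro exI[of _ "1/10^20"] conjI allI impI)
  show "0 < (1/10^20 :: real)" by simp
  fix I :: "nat set" and P :: "nat \<Rightarrow> (real^2) set" and H :: "(real^2) set" and r :: real
  assume fin: "finite I" and pl: "\<forall>i\<in>I. is_plank (P i)" and H: "H = unit_disk - (\<Union>i\<in>I. P i)"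
    and r: "0 < r" "r < 1/10^20" and Hr: "H \<subseteq> (*\<^sub>R) r ` unit_disk"
  have "\<forall>i\<in>I. \<exists>p. norm (fst p) = 1 \<and> fst (snd p) < snd (snd p) \<and> P i = strip (fst p) (fst (snd p)) (snd (snd p))"
    using pl unfolding is_plank_def strip_def by fastforce
  then obtain f where f: "\<And>i. i \<in> I \<Longrightarrow> norm (fst (f i)) = 1 \<and> fst (snd (f i)) < snd (snd (f i)) \<and>
      P i = strip (fst (f i)) (fst (snd (f i))) (snd (snd (f i)))" using bchoice[of I] by metis
  define u lo hi where "u i = fst (f i)" and "lo i = fst (snd (f i))" and "hi i = snd (snd (f i))" for i
  have P: "P i = strip (u i) (lo i) (hi i)" "norm (u i) = 1" "lo i < hi i" if "i \<in> I" for i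
    using f[OF that] by (auto simp: u_def lo_def hi_def)
  interpret plank_cover I u lo hi r
  proof
    fix y :: "real^2" assume y: "r < norm y" "norm y \<le> 1"
    have "y \<notin> H"
    proof
      assume "y \<in> H"
      then obtain z where z: "norm z \<le> 1" "y = r *\<^sub>R z" using Hr by (auto simp: unit_disk_def)
      then have "norm y \<le> r" using r(1) by (simp add: mult_left_le)
      then show False using y by simp
    qed
    then show "\<exists>i\<in>I. y \<in> strip (u i) (lo i) (hi i)" using y P(1) by (auto simp: H unit_disk_def)
  qed (use fin P r in auto)
  let ?S = "\<lambda>i. strip (u i) (lo i) (hi i)"
  have HU: "uncovered = H" using P(1) by (auto simp: uncovered_def H unit_disk_def)
  have "overlap I ?S (cball 0 1) = (\<Sum>i\<in>I. area (P i \<inter> unit_disk)) - area (cball 0 1 \<inter> (\<Union>i\<in>I. ?S i))"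
    using P(1) by (simp add: overlap_def unit_disk_def)
  moreover have "area (cball 0 1 \<inter> (\<Union>i\<in>I. ?S i)) = area unit_disk - area H"
  proof -
    have "cball 0 1 \<inter> (\<Union>i\<in>I. ?S i) = cball 0 1 - H" using HU by (auto simp: uncovered_def)
    moreover have "H \<subseteq> cball 0 1" by (auto simp: H unit_disk_def)
    moreover have "H \<in> lmeasurable" using uncovered_lmeasurable HU by simp
    ultimately show ?thesis unfolding area_def unit_disk_def
      by (simp add: measurable_measure_Diff fmeasurableD)
  qed
  moreover have "area H / (24 * 10^18 * r) \<le> overlap I ?S (cball 0 1)"
    using uncovered_area_le r(1) unfolding HU by (simp add: pos_divide_le_eq mult.commute)
  \<comment> \<open>The summand \<open>1\<close> compensates for \<open>area H\<close> in the identity for the overlap; it is absorbed because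
    \<open>r\<close> is small.\<close>
  moreover have "(1/10^20 / r + 1) * area H \<le> (1 / (24 * 10^18 * r)) * area H"
  proof (rule mult_right_mono)
    show "1/10^20 / r + 1 \<le> 1 / (24 * 10^18 * r)" using r by (simp add: field_simps)
  qed simp
  ultimately show "area unit_disk + 1/10^20 / r * area H \<le> (\<Sum>i\<in>I. area (P i \<inter> unit_disk))"
    by (simp add: distrib_right)
qed (simp_all)

end
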